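(* Let $(M_1,\omega_1)$ and $(M_2,\omega_2)$ be symplectic manifolds and let $j:L\to M_1\times M_2$ be an immersion with $j^*\omega_1=j^*\omega_2$ (an isotropic immersion into $(M_1\times M_2,-\omega_1\oplus\omega_2)$; here $\omega_i$ also denotes its pullback to $M_1\times M_2$). Let $p\ge 1$. Then the composite smooth maps $L\to M_1\times M_2\to M_i$ induce maps $\Omega(M_i)\to\Omega(L)$, $i=1,2$, and these in turn induce maps of cdgas $$\mathrm{Cone}_{M_1}(\omega_1^p)\to\mathrm{Cone}_L(\omega^p)\leftarrow\mathrm{Cone}_{M_2}(\omega_2^p).$$ In other words, $\mathrm{Cone}_L(\omega^p)$ is a bimodule for each cone algebra.
   Context: For a manifold $X$ and a closed $2$-form $\tau$ on $X$, $\mathrm{Cone}_X(\tau^p)$ denotes the mapping cone of $\Omega(X)[-2p]\xrightarrow{\wedge\tau^p}\Omega(X)$, with its cdga structure: it is $\Omega^\bullet(X)$ with a variable $\theta$ of degree $2p-1$ freely adjoined, $d\theta=\tau^p$; in degree $k$ it is $\Omega^k(X)\oplus\theta\,\Omega^{k-2p+1}(X)$, $d(\eta+\theta\xi)=(d\eta+\tau^p\wedge\xi)-\theta\,d\xi$, and $(\alpha+\theta\alpha')(\beta+\theta\beta')=\alpha\wedge\beta+\theta(\alpha'\wedge\beta+(-1)^{|\alpha|}\alpha\wedge\beta')$. $\mathrm{Cone}_{M_i}(\omega_i^p)$ is the case $X=M_i$, $\tau=\omega_i$, and $\mathrm{Cone}_L(\omega^p)$ is the case $X=L$, $\tau=j^*\omega_2=j^*\omega_1$.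 A bimodule structure is the one induced by multiplication through a cdga map. *)

theory Defs
  imports
    "HOL-Analysis.Analysis"
    "HOL-Combinatorics.Permutations"
    "HOL-Algebra.Module"
    "HOL-Algebra.Algebraic_Closure_Type"
begin

section \<open>Smooth manifolds\<close>

text \<open>For open \<open>S\<close> in a finite-dimensional space this is the usual notion of a \<open>C\<^sup>k\<close> map.\<close>

primrec Ck_on :: "nat \<Rightarrow> 'e::real_normed_vector set \<Rightarrow> ('e \<Rightarrow> 'f::real_normed_vector) \<Rightarrow> bool" where
  "Ck_on 0 S f \<longleftrightarrow> continuous_on S f"
| "Ck_on (Suc k) S f \<longleftrightarrow> (\<forall>x\<in>S. f differentiable (at x)) \<and>
     (\<forall>v. Ck_on k S (\<lambda>x. frechet_derivative f (at x) v))"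

definition smooth_on :: "'e::real_normed_vector set \<Rightarrow> ('e \<Rightarrow> 'f::real_normed_vector) \<Rightarrow> bool" where
  "smooth_on S f \<longleftrightarrow> (\<forall>k. Ck_on k S f)"

text \<open>A chart \<open>(U, \<phi>)\<close> has domain \<open>U\<close>; the values of \<open>\<phi>\<close> outside \<open>U\<close> are irrelevant.\<close>

type_synonym ('a, 'e) chart = "'a set \<times> ('a \<Rightarrow> 'e)"

record ('a, 'e) manifold =
  mtop :: "'a topology"
  atlas :: "('a, 'e) chart set"

abbreviation chart_inv :: "('a, 'e) chart \<Rightarrow> 'e \<Rightarrow> 'a" where
  "chart_inv c \<equiv> inv_into (fst c) (snd c)"

text \<open>The model space \<open>'e\<close> is an arbitrary finite-dimensional Euclidean space. The class
  \<^class>\<open>euclidean_space\<close> is not used, because it excludes dimension zero.\<close>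

definition smooth_manifold :: "('a, 'e::real_inner) manifold \<Rightarrow> bool" where
  "smooth_manifold M \<longleftrightarrow>
     (\<exists>B::'e set. finite B \<and> span B = UNIV) \<and>
     Hausdorff_space (mtop M) \<and> second_countable (mtop M) \<and>
     (\<Union>c\<in>atlas M. fst c) = topspace (mtop M) \<and>
     (\<forall>c\<in>atlas M. openin (mtop M) (fst c) \<and> open (snd c ` fst c) \<and>
        homeomorphic_map (subtopology (mtop M) (fst c)) (top_of_set (snd c ` fst c)) (snd c)) \<and>
     (\<forall>c\<in>atlas M. \<forall>d\<in>atlas M. smooth_on (snd c ` (fst c \<inter> fst d)) (snd d \<circ> chart_inv c))"

definition prod_manifold ::
    "('a, 'e) manifold \<Rightarrow> ('b, 'f) manifold \<Rightarrow> ('a \<times> 'b, 'e \<times> 'f) manifold" where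
  "prod_manifold M N = \<lparr>mtop = prod_topology (mtop M) (mtop N),
     atlas = {(fst c \<times> fst d, map_prod (snd c) (snd d)) | c d. c \<in> atlas M \<and> d \<in> atlas N}\<rparr>"

definition smooth_map ::
    "('a, 'e::real_inner) manifold \<Rightarrow> ('b, 'f::real_inner) manifold \<Rightarrow> ('a \<Rightarrow> 'b) \<Rightarrow> bool" where
  "smooth_map M N f \<longleftrightarrow> continuous_map (mtop M) (mtop N) f \<and>
     (\<forall>c\<in>atlas M. \<forall>d\<in>atlas N.
        smooth_on (snd c ` (fst c \<inter> f -` fst d)) (snd d \<circ> f \<circ> chart_inv c))"

definition charts_at :: "('a, 'e) manifold \<Rightarrow> 'a \<Rightarrow> ('a, 'e) chart set" where
  "charts_at M p = {c \<in> atlas M. p \<in> fst c}"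

definition chart_at :: "('a, 'e) manifold \<Rightarrow> 'a \<Rightarrow> ('a, 'e) chart" where
  "chart_at M p = (SOME c. c \<in> charts_at M p)"

text \<open>A tangent vector at \<open>p\<close> assigns to every chart around \<open>p\<close> its coordinate vector in that
  chart, subject to the usual transformation rule. It is zero on the charts not containing \<open>p\<close>;
  hence the tangent space is a vector space under the pointwise operations.\<close>

type_synonym ('a, 'e) tvec = "('a, 'e) chart \<Rightarrow> 'e"

definition tangent_space :: "('a, 'e::real_inner) manifold \<Rightarrow> 'a \<Rightarrow> ('a, 'e) tvec set" where
  "tangent_space M p = {v.
     (\<forall>c. c \<notin> charts_at M p \<longrightarrow> v c = 0) \<and>
     (\<forall>c\<in>charts_at M p. \<forall>d\<in>charts_at M p.
        v d = frechet_derivative (snd d \<circ> chart_inv c) (at (snd c p)) (v c))}"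

text \<open>The tangent vector at \<open>p\<close> with coordinate vector \<open>e\<close> in the chart \<open>c\<close>.\<close>

definition coord_tvec :: "('a, 'e::real_inner) manifold \<Rightarrow> 'a \<Rightarrow> ('a, 'e) chart \<Rightarrow> 'e \<Rightarrow> ('a, 'e) tvec" where
  "coord_tvec M p c e = (\<lambda>d. if d \<in> charts_at M p
     then frechet_derivative (snd d \<circ> chart_inv c) (at (snd c p)) e else 0)"

definition tangent_map ::
    "('a, 'e::real_inner) manifold \<Rightarrow> ('b, 'f::real_inner) manifold \<Rightarrow> ('a \<Rightarrow> 'b) \<Rightarrow> 'a \<Rightarrow>
     ('a, 'e) tvec \<Rightarrow> ('b, 'f) tvec" where
  "tangent_map M N f p v = (\<lambda>d. if d \<in> charts_at N (f p)
     then let c = chart_at M p in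
       frechet_derivative (snd d \<circ> f \<circ> chart_inv c) (at (snd c p)) (v c)
     else 0)"

definition immersion ::
    "('a, 'e::real_inner) manifold \<Rightarrow> ('b, 'f::real_inner) manifold \<Rightarrow> ('a \<Rightarrow> 'b) \<Rightarrow> bool" where
  "immersion M N f \<longleftrightarrow> smooth_map M N f \<and>
     (\<forall>p\<in>topspace (mtop M). inj_on (tangent_map M N f p) (tangent_space M p))"


section \<open>Commutative differential graded algebras\<close>

text \<open>Everything is over the reals and cohomologically graded by the integers. The carrier is the
  total space, i.e. the direct sum of the homogeneous parts.\<close>

record 'a dga = "(real, 'a) module" +
  grade :: "int \<Rightarrow> 'a set"
  dif :: "'a \<Rightarrow> 'a"

abbreviation real_ring :: "real ring" where
  "real_ring \<equiv> ring_of_type_algebra"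

text \<open>Multiplication and unit of the record play no role in the notion of a complex.\<close>

locale cochain_complex =
  fixes A :: "('a, 'm) dga_scheme" (structure)
  assumes is_module: "Module.module real_ring A"
    and grade_submodule: "submodule (grade A k) real_ring A"
    and direct_sum: "a \<in> carrier A \<Longrightarrow>
      \<exists>!x. (\<forall>k. x k \<in> grade A k) \<and> finite {k. x k \<noteq> \<zero>} \<and> a = finsum A x {k. x k \<noteq> \<zero>}"
    and dif_add: "a \<in> carrier A \<Longrightarrow> b \<in> carrier A \<Longrightarrow> dif A (a \<oplus> b) = dif A a \<oplus> dif A b"
    and dif_smult: "a \<in> carrier A \<Longrightarrow> dif A (r \<odot> a) = r \<odot> dif A a"
    and dif_grade: "a \<in> grade A k \<Longrightarrow> dif A a \<in> grade A (k + 1)"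
    and dif_dif: "a \<in> carrier A \<Longrightarrow> dif A (dif A a) = \<zero>"

locale cdga =
  fixes A :: "('a, 'm) dga_scheme" (structure)
  assumes is_complex: "cochain_complex A"
    and is_ring: "Ring.ring A"
    and smult_mult_left: "a \<in> carrier A \<Longrightarrow> b \<in> carrier A \<Longrightarrow> (r \<odot> a) \<otimes> b = r \<odot> (a \<otimes> b)"
    and smult_mult_right: "a \<in> carrier A \<Longrightarrow> b \<in> carrier A \<Longrightarrow> a \<otimes> (r \<odot> b) = r \<odot> (a \<otimes> b)"
    and one_grade: "\<one> \<in> grade A 0"
    and mult_grade: "a \<in> grade A k \<Longrightarrow> b \<in> grade A l \<Longrightarrow> a \<otimes> b \<in> grade A (k + l)"
    and graded_comm: "a \<in> grade A k \<Longrightarrow> b \<in> grade A l \<Longrightarrow>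
      a \<otimes> b = ((-1) powi (k * l)) \<odot> (b \<otimes> a)"
    and Leibniz: "a \<in> grade A k \<Longrightarrow> b \<in> carrier A \<Longrightarrow>
      dif A (a \<otimes> b) = (dif A a \<otimes> b) \<oplus> ((-1) powi k) \<odot> (a \<otimes> dif A b)"

locale cdga_map =
  fixes A :: "('a, 'm) dga_scheme" and B :: "('b, 'n) dga_scheme" and f :: "'a \<Rightarrow> 'b"
  assumes source: "cdga A"
    and target: "cdga B"
    and is_ring_hom: "f \<in> ring_hom A B"
    and map_smult: "a \<in> carrier A \<Longrightarrow> f (r \<odot>\<^bsub>A\<^esub> a) = r \<odot>\<^bsub>B\<^esub> f a"
    and map_grade: "a \<in> grade A k \<Longrightarrow> f a \<in> grade B k"
    and map_dif: "a \<in> carrier A \<Longrightarrow> f (dif A a) = dif B (f a)"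

text \<open>A differential graded \<open>A\<close>-\<open>A\<close>-bimodule; \<open>lact a x\<close> and \<open>ract x a\<close> are the two actions on the
  complex \<open>N\<close>.\<close>

locale dg_bimodule =
  fixes A :: "('a, 'm) dga_scheme" and N :: "('b, 'n) dga_scheme"
    and lact :: "'a \<Rightarrow> 'b \<Rightarrow> 'b" and ract :: "'b \<Rightarrow> 'a \<Rightarrow> 'b"
  assumes algebra: "cdga A"
    and complex: "cochain_complex N"
    and lact_grade: "a \<in> grade A k \<Longrightarrow> x \<in> grade N l \<Longrightarrow> lact a x \<in> grade N (k + l)"
    and lact_add_left: "a \<in> carrier A \<Longrightarrow> b \<in> carrier A \<Longrightarrow> x \<in> carrier N \<Longrightarrow>
      lact (a \<oplus>\<^bsub>A\<^esub> b) x = lact a x \<oplus>\<^bsub>N\<^esub> lact b x"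
    and lact_add_right: "a \<in> carrier A \<Longrightarrow> x \<in> carrier N \<Longrightarrow> y \<in> carrier N \<Longrightarrow>
      lact a (x \<oplus>\<^bsub>N\<^esub> y) = lact a x \<oplus>\<^bsub>N\<^esub> lact a y"
    and lact_smult_left: "a \<in> carrier A \<Longrightarrow> x \<in> carrier N \<Longrightarrow>
      lact (r \<odot>\<^bsub>A\<^esub> a) x = r \<odot>\<^bsub>N\<^esub> lact a x"
    and lact_smult_right: "a \<in> carrier A \<Longrightarrow> x \<in> carrier N \<Longrightarrow>
      lact a (r \<odot>\<^bsub>N\<^esub> x) = r \<odot>\<^bsub>N\<^esub> lact a x"
    and lact_one: "x \<in> carrier N \<Longrightarrow> lact \<one>\<^bsub>A\<^esub> x = x"
    and lact_assoc: "a \<in> carrier A \<Longrightarrow> b \<in> carrier A \<Longrightarrow> x \<in> carrier N \<Longrightarrow>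
      lact (a \<otimes>\<^bsub>A\<^esub> b) x = lact a (lact b x)"
    and lact_Leibniz: "a \<in> grade A k \<Longrightarrow> x \<in> carrier N \<Longrightarrow>
      dif N (lact a x) = lact (dif A a) x \<oplus>\<^bsub>N\<^esub> ((-1) powi k) \<odot>\<^bsub>N\<^esub> lact a (dif N x)"
    and ract_grade: "a \<in> grade A k \<Longrightarrow> x \<in> grade N l \<Longrightarrow> ract x a \<in> grade N (l + k)"
    and ract_add_left: "a \<in> carrier A \<Longrightarrow> x \<in> carrier N \<Longrightarrow> y \<in> carrier N \<Longrightarrow>
      ract (x \<oplus>\<^bsub>N\<^esub> y) a = ract x a \<oplus>\<^bsub>N\<^esub> ract y a"
    and ract_add_right: "a \<in> carrier A \<Longrightarrow> b \<in> carrier A \<Longrightarrow> x \<in> carrier N \<Longrightarrow>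
      ract x (a \<oplus>\<^bsub>A\<^esub> b) = ract x a \<oplus>\<^bsub>N\<^esub> ract x b"
    and ract_smult_left: "a \<in> carrier A \<Longrightarrow> x \<in> carrier N \<Longrightarrow>
      ract (r \<odot>\<^bsub>N\<^esub> x) a = r \<odot>\<^bsub>N\<^esub> ract x a"
    and ract_smult_right: "a \<in> carrier A \<Longrightarrow> x \<in> carrier N \<Longrightarrow>
      ract x (r \<odot>\<^bsub>A\<^esub> a) = r \<odot>\<^bsub>N\<^esub> ract x a"
    and ract_one: "x \<in> carrier N \<Longrightarrow> ract x \<one>\<^bsub>A\<^esub> = x"
    and ract_assoc: "a \<in> carrier A \<Longrightarrow> b \<in> carrier A \<Longrightarrow> x \<in> carrier N \<Longrightarrow>
      ract x (a \<otimes>\<^bsub>A\<^esub> b) = ract (ract x a) b"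
    and ract_Leibniz: "x \<in> grade N l \<Longrightarrow> a \<in> carrier A \<Longrightarrow>
      dif N (ract x a) = ract (dif N x) a \<oplus>\<^bsub>N\<^esub> ((-1) powi l) \<odot>\<^bsub>N\<^esub> ract x (dif A a)"
    and lact_ract: "a \<in> carrier A \<Longrightarrow> b \<in> carrier A \<Longrightarrow> x \<in> carrier N \<Longrightarrow>
      ract (lact a x) b = lact a (ract x b)"


section \<open>Differential forms\<close>

text \<open>A (possibly inhomogeneous) form assigns to a point and a list of tangent vectors at that point
  a real number; its degree-\<open>k\<close> part is its restriction to lists of length \<open>k\<close>. Forms vanish on all
  arguments that are not lists of tangent vectors at a point of the manifold.\<close>

type_synonym ('a, 'e) form = "'a \<Rightarrow> ('a, 'e) tvec list \<Rightarrow> real"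

definition alternating_multilinear ::
    "('a, 'e::real_inner) tvec set \<Rightarrow> nat \<Rightarrow> (('a, 'e) tvec list \<Rightarrow> real) \<Rightarrow> bool" where
  "alternating_multilinear V k \<alpha> \<longleftrightarrow>
     (\<forall>vs i u w a b. length vs = k \<and> set vs \<subseteq> V \<and> i < k \<and> u \<in> V \<and> w \<in> V \<longrightarrow>
        \<alpha> (vs[i := (\<lambda>c. a *\<^sub>R u c + b *\<^sub>R w c)]) = a * \<alpha> (vs[i := u]) + b * \<alpha> (vs[i := w])) \<and>
     (\<forall>vs i j. length vs = k \<and> set vs \<subseteq> V \<and> i < j \<and> j < k \<and> vs ! i = vs ! j \<longrightarrow> \<alpha> vs = 0)"

text \<open>The coordinate representation of a form in the chart \<open>c\<close>.\<close>

definition local_rep ::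
    "('a, 'e::real_inner) manifold \<Rightarrow> ('a, 'e) chart \<Rightarrow> ('a, 'e) form \<Rightarrow> 'e \<Rightarrow> 'e list \<Rightarrow> real" where
  "local_rep M c \<omega> x es =
     \<omega> (chart_inv c x) (map (coord_tvec M (chart_inv c x) c) es)"

definition forms :: "('a, 'e::real_inner) manifold \<Rightarrow> nat \<Rightarrow> ('a, 'e) form set" where
  "forms M k = {\<omega>.
     (\<forall>p vs. \<omega> p vs \<noteq> 0 \<longrightarrow>
        p \<in> topspace (mtop M) \<and> length vs = k \<and> set vs \<subseteq> tangent_space M p) \<and>
     (\<forall>p\<in>topspace (mtop M). alternating_multilinear (tangent_space M p) k (\<omega> p)) \<and>
     (\<forall>c\<in>atlas M. \<forall>es. smooth_on (snd c ` fst c) (\<lambda>x. local_rep M c \<omega> x es))}"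

definition degree_part :: "nat \<Rightarrow> ('a, 'e) form \<Rightarrow> ('a, 'e) form" where
  "degree_part k \<omega> = (\<lambda>p vs. if length vs = k then \<omega> p vs else 0)"

definition wedge :: "('a, 'e) form \<Rightarrow> ('a, 'e) form \<Rightarrow> ('a, 'e) form" where
  "wedge \<alpha> \<beta> = (\<lambda>p vs. \<Sum>k\<le>length vs.
     (\<Sum>\<sigma> | \<sigma> permutes {..<length vs}. of_int (sign \<sigma>) *
        \<alpha> p (take k (permute_list \<sigma> vs)) * \<beta> p (drop k (permute_list \<sigma> vs)))
     / (fact k * fact (length vs - k)))"

text \<open>In a chart \<open>c\<close> around \<open>p\<close> and with the \<open>v\<^sub>i\<close> extended to constant vector fields,
  \<open>d\<omega> (v\<^sub>0, \<dots>, v\<^sub>k)\<close> is the alternating sum of the derivatives of \<open>\<omega> (v\<^sub>0, \<dots>, v\<^sub>k)\<close> with \<open>v\<^sub>i\<close>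
  omitted, in direction \<open>v\<^sub>i\<close>. The value does not depend on the chart.\<close>

definition ext_deriv :: "('a, 'e::real_inner) manifold \<Rightarrow> ('a, 'e) form \<Rightarrow> ('a, 'e) form" where
  "ext_deriv M \<omega> = (\<lambda>p vs.
     if p \<in> topspace (mtop M) \<and> set vs \<subseteq> tangent_space M p
     then let c = chart_at M p; es = map (\<lambda>v. v c) vs in
       \<Sum>i<length vs. (-1) ^ i *
         frechet_derivative (\<lambda>x. local_rep M c \<omega> x (take i es @ drop (Suc i) es))
           (at (snd c p)) (es ! i)
     else 0)"

definition de_rham :: "('a, 'e::real_inner) manifold \<Rightarrow> ('a, 'e) form dga" where
  "de_rham M = \<lparr>
     carrier = {\<omega>. (\<forall>k. degree_part k \<omega> \<in> forms M k) \<and>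
       finite {k. degree_part k \<omega> \<noteq> (\<lambda>p vs. 0)}},
     mult = wedge,
     one = (\<lambda>p vs. if p \<in> topspace (mtop M) \<and> vs = [] then 1 else 0),
     zero = (\<lambda>p vs. 0),
     add = (\<lambda>\<alpha> \<beta> p vs. \<alpha> p vs + \<beta> p vs),
     smult = (\<lambda>r \<alpha> p vs. r * \<alpha> p vs),
     grade = (\<lambda>k. if k < 0 then {\<lambda>p vs. 0} else forms M (nat k)),
     dif = ext_deriv M\<rparr>"

definition pullback ::
    "('a, 'e::real_inner) manifold \<Rightarrow> ('b, 'f::real_inner) manifold \<Rightarrow> ('a \<Rightarrow> 'b) \<Rightarrow>
     ('b, 'f) form \<Rightarrow> ('a, 'e) form" where
  "pullback M N f \<omega> = (\<lambda>p vs.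
     if p \<in> topspace (mtop M) \<and> set vs \<subseteq> tangent_space M p
     then \<omega> (f p) (map (tangent_map M N f p) vs) else 0)"

definition symplectic_manifold :: "('a, 'e::real_inner) manifold \<Rightarrow> ('a, 'e) form \<Rightarrow> bool" where
  "symplectic_manifold M \<omega> \<longleftrightarrow> smooth_manifold M \<and> \<omega> \<in> forms M 2 \<and>
     ext_deriv M \<omega> = \<zero>\<^bsub>de_rham M\<^esub> \<and>
     (\<forall>p\<in>topspace (mtop M). \<forall>v\<in>tangent_space M p.
        (\<forall>w\<in>tangent_space M p. \<omega> p [v, w] = 0) \<longrightarrow> v = (\<lambda>c. 0))"


section \<open>The mapping cone algebra\<close>

text \<open>\<open>signed \<alpha>\<close> is \<open>(-1)\<^sup>k \<alpha>\<close> on forms of degree \<open>k\<close>, extended linearly.\<close>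

definition signed :: "('a, 'e) form \<Rightarrow> ('a, 'e) form" where
  "signed \<alpha> = (\<lambda>p vs. (-1) ^ length vs * \<alpha> p vs)"

text \<open>The pair \<open>(\<eta>, \<xi>)\<close> stands for \<open>\<eta> + \<theta>\<xi>\<close>, where \<open>\<theta>\<close> has degree \<open>2p - 1\<close> and \<open>d\<theta> = \<tau>\<^sup>p\<close>.\<close>

definition cone_algebra ::
    "('a, 'e::real_inner) manifold \<Rightarrow> ('a, 'e) form \<Rightarrow> nat \<Rightarrow> (('a, 'e) form \<times> ('a, 'e) form) dga" where
  "cone_algebra M \<tau> p = (let \<Omega> = de_rham M in \<lparr>
     carrier = carrier \<Omega> \<times> carrier \<Omega>,
     mult = (\<lambda>(\<alpha>, \<alpha>') (\<beta>, \<beta>'). (\<alpha> \<otimes>\<^bsub>\<Omega>\<^esub> \<beta>, (\<alpha>' \<otimes>\<^bsub>\<Omega>\<^esub> \<beta>) \<oplus>\<^bsub>\<Omega>\<^esub> (signed \<alpha> \<otimes>\<^bsub>\<Omega>\<^esub> \<beta>'))),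
     one = (\<one>\<^bsub>\<Omega>\<^esub>, \<zero>\<^bsub>\<Omega>\<^esub>),
     zero = (\<zero>\<^bsub>\<Omega>\<^esub>, \<zero>\<^bsub>\<Omega>\<^esub>),
     add = (\<lambda>(\<alpha>, \<alpha>') (\<beta>, \<beta>'). (\<alpha> \<oplus>\<^bsub>\<Omega>\<^esub> \<beta>, \<alpha>' \<oplus>\<^bsub>\<Omega>\<^esub> \<beta>')),
     smult = (\<lambda>r (\<alpha>, \<alpha>'). (r \<odot>\<^bsub>\<Omega>\<^esub> \<alpha>, r \<odot>\<^bsub>\<Omega>\<^esub> \<alpha>')),
     grade = (\<lambda>k. grade \<Omega> k \<times> grade \<Omega> (k - 2 * int p + 1)),
     dif = (\<lambda>(\<eta>, \<xi>). (dif \<Omega> \<eta> \<oplus>\<^bsub>\<Omega>\<^esub> ((\<tau> [^]\<^bsub>\<Omega>\<^esub> p) \<otimes>\<^bsub>\<Omega>\<^esub> \<xi>), (-1) \<odot>\<^bsub>\<Omega>\<^esub> dif \<Omega> \<xi>))\<rparr>)"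

text \<open>The map \<open>\<eta> + \<theta>\<xi> \<mapsto> f\<^sup>*\<eta> + \<theta> f\<^sup>*\<xi>\<close> of cones induced by \<open>f : M \<rightarrow> N\<close>.\<close>

definition cone_pullback ::
    "('a, 'e::real_inner) manifold \<Rightarrow> ('b, 'f::real_inner) manifold \<Rightarrow> ('a \<Rightarrow> 'b) \<Rightarrow>
     ('b, 'f) form \<times> ('b, 'f) form \<Rightarrow> ('a, 'e) form \<times> ('a, 'e) form" where
  "cone_pullback M N f = map_prod (pullback M N f) (pullback M N f)"

end

theory Submission
  imports Defs
begin

text \<open>
  Everything rests on one functoriality statement: a smooth map \<open>f : M \<rightarrow> N\<close> induces a map of cdgas
  \<open>f\<^sup>* : \<Omega>(N) \<rightarrow> \<Omega>(M)\<close> (\<open>cdga_map_pullback\<close>). Given this, \<open>\<eta> + \<theta>\<xi> \<mapsto> f\<^sup>*\<eta> + \<theta> f\<^sup>*\<xi>\<close> is a map of cdgas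
  from the cone of \<open>\<tau>\<^sup>p\<close> to the cone of \<open>(f\<^sup>*\<tau>)\<^sup>p\<close>: it respects products and signs componentwise, and the
  only new term of the differential, \<open>\<tau>\<^sup>p \<and> \<xi>\<close>, is respected because \<open>f\<^sup>*\<close> is multiplicative
  (\<open>cdga_map_cone_pullback\<close>). The two maps \<open>L \<rightarrow> M\<^sub>1 \<times> M\<^sub>2 \<rightarrow> M\<^sub>i\<close> pull \<open>\<omega>\<^sub>i\<close> back to the same form
  \<open>\<omega>\<close>, so both cone maps end in the same algebra, and an algebra is a bimodule over every algebra that
  maps to it (\<open>dg_bimodule_cdga_map\<close>). That the cone is a cdga at all uses that \<open>\<tau>\<^sup>p\<close> is closed and
  commutes with every form, its degree being even (\<open>cdga_cone\<close>).

  The substance is the de Rham algebra itself. A form is the same as a compatible family of coordinate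
  representations on open sets, and the coordinate representation turns the wedge product, the exterior
  derivative and the pullback into operations on multilinear functions of lists of vectors that depend
  smoothly on a point (\<open>local_rep_wedge\<close>, \<open>local_rep_ext_deriv\<close>, \<open>local_rep_pullback\<close>). After
  division of \<open>k\<close>-forms by \<open>k!\<close> these have a uniform description: the wedge product is the
  alternation of the tensor product (\<open>over_fact_ext_prod\<close>), and the exterior derivative is the
  alternation of the gradient (\<open>over_fact_local_d\<close>). Alternation multiplies by the sign when its
  argument is permuted, so it absorbs every alternation performed earlier on a block of the arguments
  (\<open>alternation_signed_perm\<close>, \<open>alternation_block\<close>). All identities are consequences. Associativity of
  the wedge product is associativity of the tensor product, graded commutativity is the sign of the
  rotation that exchanges two blocks, and the Leibniz rule is the product rule for the gradient
  together with the sign for moving the new argument past the first factor. Both \<open>d \<circ> d = 0\<close> and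
  naturality of \<open>d\<close> hold because a term that is symmetric in two arguments, here a second derivative,
  has alternation zero. Independence of \<open>d\<close> from the chart is naturality under changes of
  coordinates.
\<close>

section \<open>Alternation of functions on lists\<close>

text \<open>The projection of tensors onto antisymmetric tensors. A tensor is a function on lists; its degree-\<open>k\<close>
  part is its restriction to lists of length \<open>k\<close>.\<close>

definition alternation :: "('v list \<Rightarrow> real) \<Rightarrow> 'v list \<Rightarrow> real" where
  "alternation T vs =
     (\<Sum>\<sigma> | \<sigma> permutes {..<length vs}. of_int (sign \<sigma>) * T (permute_list \<sigma> vs)) / fact (length vs)"

text \<open>The tensor product of inhomogeneous tensors: a list is cut in all possible ways.\<close>

definition conc :: "('v list \<Rightarrow> real) \<Rightarrow> ('v list \<Rightarrow> real) \<Rightarrow> 'v list \<Rightarrow> real" where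
  "conc a b vs = (\<Sum>k\<le>length vs. a (take k vs) * b (drop k vs))"

text \<open>With this normalisation the binomial factors of the exterior product and the alternating sum of the
  exterior derivative disappear.\<close>

definition over_fact :: "('v list \<Rightarrow> real) \<Rightarrow> 'v list \<Rightarrow> real" where
  "over_fact a vs = a vs / fact (length vs)"

definition antisymmetric :: "('v list \<Rightarrow> real) \<Rightarrow> bool" where
  "antisymmetric a \<longleftrightarrow> (\<forall>\<sigma> vs. \<sigma> permutes {..<length vs} \<longrightarrow>
     a (permute_list \<sigma> vs) = of_int (sign \<sigma>) * a vs)"

text \<open>The rearrangement \<open>f\<close> of lists of length \<open>n\<close> is a permutation of sign \<open>s\<close>. Rearrangements such as
  "move the \<open>i\<close>-th entry to the front" are handled in this form, without writing down the permutation.\<close>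

definition signed_perm :: "nat \<Rightarrow> int \<Rightarrow> ('v list \<Rightarrow> 'v list) \<Rightarrow> bool" where
  "signed_perm n s f \<longleftrightarrow> (\<exists>\<sigma>. \<sigma> permutes {..<n} \<and> sign \<sigma> = s \<and>
     (\<forall>vs. length vs = n \<longrightarrow> permute_list \<sigma> vs = f vs))"

lemma alternation_cong:
  assumes "\<And>us. length us = length vs \<Longrightarrow> set us = set vs \<Longrightarrow> T us = S us"
  shows "alternation T vs = alternation S vs"
  unfolding alternation_def using assms by (intro arg_cong2[where f="(/)"] sum.cong) auto

lemma alternation_sum:
  "alternation (\<lambda>us. \<Sum>i\<in>I. T i us) vs = (\<Sum>i\<in>I. alternation (T i) vs)"
  unfolding alternation_def sum_distrib_left sum_divide_distrib by (rule sum.swap)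

lemma alternation_add:
  "alternation (\<lambda>us. T us + S us) vs = alternation T vs + alternation S vs"
  by (simp add: alternation_def sum.distrib algebra_simps add_divide_distrib)

lemma alternation_cmult:
  "alternation (\<lambda>us. c * T us) vs = c * alternation T vs"
  by (simp add: alternation_def sum_distrib_left mult_ac)

lemma permutation_lessThan: "\<sigma> permutes {..<n::nat} \<Longrightarrow> permutation \<sigma>"
  by (rule permutes_imp_permutation[of "{..<n}"]) simp_all

lemma sign_sign: "of_int (sign \<sigma>) * (of_int (sign \<sigma>) * x) = (x::real)"
  by (cases \<sigma> rule: sign_cases) auto

lemma signed_perm_comp:
  assumes "signed_perm n s f" "signed_perm n t g"
  shows "signed_perm n (s * t) (\<lambda>vs. g (f vs))"
proof -
  obtain \<sigma> \<tau> where *: "\<sigma> permutes {..<n}" "sign \<sigma> = s" "\<tau> permutes {..<n}" "sign \<tau> = t"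
    and **: "\<And>vs. length vs = n \<Longrightarrow> permute_list \<sigma> vs = f vs"
      "\<And>vs. length vs = n \<Longrightarrow> permute_list \<tau> vs = g vs"
    using assms unfolding signed_perm_def by blast
  have "permute_list (\<sigma> \<circ> \<tau>) vs = g (f vs)" if "length vs = n" for vs
    using that * by (simp add: permute_list_compose flip: **)
  moreover have "sign (\<sigma> \<circ> \<tau>) = s * t"
    using * by (simp add: sign_compose permutation_lessThan)
  ultimately show ?thesis
    using * permutes_compose unfolding signed_perm_def by blast
qed

text \<open>Reindexing the sum by \<open>\<sigma> \<mapsto> \<sigma> \<circ> \<tau>\<close>, where \<open>\<tau>\<close> is the permutation behind \<open>f\<close>.\<close>

lemma alternation_signed_perm:
  assumes "signed_perm (length vs) s f"
  shows "alternation (\<lambda>us. T (f us)) vs = of_int s * alternation T vs"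
proof -
  let ?P = "{\<sigma>. \<sigma> permutes {..<length vs}}"
  obtain \<tau> where \<tau>: "\<tau> permutes {..<length vs}" "sign \<tau> = s"
    and f: "\<And>us. length us = length vs \<Longrightarrow> permute_list \<tau> us = f us"
    using assms unfolding signed_perm_def by blast
  have "of_int (sign \<sigma>) * T (f (permute_list \<sigma> vs)) =
      of_int s * (of_int (sign (\<sigma> \<circ> \<tau>)) * T (permute_list (\<sigma> \<circ> \<tau>) vs))" if "\<sigma> \<in> ?P" for \<sigma>
    using that \<tau> f[of "permute_list \<sigma> vs"] sign_sign[of \<tau>]
    by (simp add: sign_compose permutation_lessThan permute_list_compose mult.left_commute[of _ "of_int (sign \<sigma>)"])
  then have "(\<Sum>\<sigma>\<in>?P. of_int (sign \<sigma>) * T (f (permute_list \<sigma> vs))) =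
      (\<Sum>\<sigma>\<in>?P. of_int s * (of_int (sign (\<sigma> \<circ> \<tau>)) * T (permute_list (\<sigma> \<circ> \<tau>) vs)))"
    by (intro sum.cong) auto
  also have "\<dots> = (\<Sum>\<sigma>\<in>?P. of_int s * (of_int (sign \<sigma>) * T (permute_list \<sigma> vs)))"
    using sum_permutations_compose_right[OF \<tau>(1),
      of "\<lambda>\<sigma>. of_int s * (of_int (sign \<sigma>) * T (permute_list \<sigma> vs))"] by simp
  finally show ?thesis
    unfolding alternation_def by (simp add: sum_distrib_left)
qed

lemma antisymmetric_alternation: "antisymmetric (alternation T)"
  unfolding antisymmetric_def
proof (intro allI impI)
  fix \<tau> and vs :: "'a list"
  assume \<tau>: "\<tau> permutes {..<length vs}"
  let ?P = "{\<sigma>. \<sigma> permutes {..<length vs}}"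
  have "of_int (sign \<sigma>) * T (permute_list \<sigma> (permute_list \<tau> vs)) =
      of_int (sign \<tau>) * (of_int (sign (\<tau> \<circ> \<sigma>)) * T (permute_list (\<tau> \<circ> \<sigma>) vs))" if "\<sigma> \<in> ?P" for \<sigma>
    using that \<tau> by (simp add: sign_compose permutation_lessThan permute_list_compose sign_sign mult.assoc)
  then have "(\<Sum>\<sigma>\<in>?P. of_int (sign \<sigma>) * T (permute_list \<sigma> (permute_list \<tau> vs))) =
      (\<Sum>\<sigma>\<in>?P. of_int (sign \<tau>) * (of_int (sign (\<tau> \<circ> \<sigma>)) * T (permute_list (\<tau> \<circ> \<sigma>) vs)))"
    by (intro sum.cong) auto
  also have "\<dots> = (\<Sum>\<sigma>\<in>?P. of_int (sign \<tau>) * (of_int (sign \<sigma>) * T (permute_list \<sigma> vs)))"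
    using setum_permutations_compose_left[OF \<tau>,
      of "\<lambda>\<sigma>. of_int (sign \<tau>) * (of_int (sign \<sigma>) * T (permute_list \<sigma> vs))"] by simp
  finally show "alternation T (permute_list \<tau> vs) = of_int (sign \<tau>) * alternation T vs"
    unfolding alternation_def by (simp add: sum_distrib_left)
qed

text \<open>All \<open>n!\<close> terms of the sum are equal.\<close>

lemma alternation_antisymmetric:
  assumes "antisymmetric a"
  shows "alternation a = a"
proof
  fix vs
  have "of_int (sign \<sigma>) * a (permute_list \<sigma> vs) = a vs" if "\<sigma> permutes {..<length vs}" for \<sigma>
    using assms that unfolding antisymmetric_def by (simp add: sign_sign)
  then have "(\<Sum>\<sigma> | \<sigma> permutes {..<length vs}. of_int (sign \<sigma>) * a (permute_list \<sigma> vs)) =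
     (\<Sum>\<sigma> | \<sigma> permutes {..<length vs}. a vs)"
    by (intro sum.cong) auto
  then show "alternation a vs = a vs"
    by (simp add: alternation_def card_permutations)
qed

text \<open>A permutation of a block of consecutive entries, by induction on a product of transpositions: shifting
  the indices of a transposition by the starting position of the block keeps its sign.\<close>

lemma signed_perm_block:
  assumes "\<tau> permutes {..<l}" "m + l \<le> n"
  shows "signed_perm n (sign \<tau>) (\<lambda>us. take m us @ permute_list \<tau> (take l (drop m us)) @ drop (m + l) us)"
  using assms(1) finite_lessThan
proof (induction rule: permutes_induct)
  case id
  have "permute_list id us = take m us @ permute_list id (take l (drop m us)) @ drop (m + l) us"
    for us :: "'a list"
    unfolding permute_list_id by (simp add: add.commute flip: drop_drop)
  then show ?case
    unfolding signed_perm_def by (intro exI[of _ id] conjI permutes_id sign_id) auto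
next
  case (swap a b \<tau>)
  have 1: "signed_perm n (-1) (\<lambda>us::'a list. permute_list (Transposition.transpose (a + m) (b + m)) us)"
    unfolding signed_perm_def using swap assms
    by (intro exI[of _ "Transposition.transpose (a + m) (b + m)"])
       (auto simp: sign_swap_id intro!: permutes_swap_id)
  have 2: "take m ws @ permute_list \<tau> (take l (drop m ws)) @ drop (m + l) ws =
     take m us @ permute_list (Transposition.transpose a b \<circ> \<tau>) (take l (drop m us)) @ drop (m + l) us"
    if us: "length us = n" and ws: "ws = permute_list (Transposition.transpose (a + m) (b + m)) us" for us ws :: "'a list"
  proof -
    have p: "Transposition.transpose (a + m) (b + m) permutes {..<length us}"
      using swap assms us by (intro permutes_swap_id) auto
    have nth: "ws ! i = us ! Transposition.transpose (a + m) (b + m) i" if "i < n" for i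
      using permute_list_nth[OF p] that us ws by auto
    have "length ws = n" using us ws by simp
    have "take m ws = take m us"
      using \<open>length ws = n\<close> us assms by (intro nth_equalityI) (auto simp: nth Transposition.transpose_def)
    moreover have "drop (m + l) ws = drop (m + l) us"
      using \<open>length ws = n\<close> us assms swap by (intro nth_equalityI) (auto simp: nth Transposition.transpose_def)
    moreover have "take l (drop m ws) = permute_list (Transposition.transpose a b) (take l (drop m us))"
    proof (rule nth_equalityI)
      fix i assume "i < length (take l (drop m ws))"
      then have i: "i < l" "m + i < n" using \<open>length ws = n\<close> by auto
      have "Transposition.transpose a b permutes {..<length (take l (drop m us))}"
        using swap assms us by (intro permutes_swap_id) auto
      from permute_list_nth[OF this, of i] i us swap assms
      show "take l (drop m ws) ! i = permute_list (Transposition.transpose a b) (take l (drop m us)) ! i"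
        using \<open>length ws = n\<close> by (auto simp: nth Transposition.transpose_def add.commute)
    qed (use \<open>length ws = n\<close> us in simp)
    moreover have "\<tau> permutes {..<length (take l (drop m us))}"
      using swap assms us by simp
    ultimately show ?thesis
      by (simp add: permute_list_compose)
  qed
  from signed_perm_comp[OF 1 swap.IH]
  have "signed_perm n (- sign \<tau>) (\<lambda>us::'a list. take m us @ permute_list (Transposition.transpose a b \<circ> \<tau>) (take l (drop m us)) @ drop (m + l) us)"
    unfolding signed_perm_def using 2 by auto
  moreover have "sign (Transposition.transpose a b \<circ> \<tau>) = - sign \<tau>"
    using swap by (simp add: sign_compose permutation_lessThan sign_swap_id permutation_swap_id)
  ultimately show ?case by metis
qed

text \<open>Each permutation of the block contributes the same, since its sign occurs once explicitly and once by
  \<open>alternation_signed_perm\<close>. Hence an alternation over a block of the arguments is absorbed by the alternation over all of them.\<close>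

lemma alternation_block:
  fixes vs :: "'v list"
  assumes "m + l \<le> length vs"
  shows "alternation (\<lambda>us. alternation (\<lambda>ws. T (take m us @ ws @ drop (m + l) us)) (take l (drop m us))) vs
    = alternation T vs"
proof -
  let ?P = "{\<tau>. \<tau> permutes {..<l}}"
  let ?f = "\<lambda>\<tau> us. take m us @ permute_list \<tau> (take l (drop m us)) @ drop (m + l) us"
  have "alternation (\<lambda>us. alternation (\<lambda>ws. T (take m us @ ws @ drop (m + l) us)) (take l (drop m us))) vs
     = alternation (\<lambda>us. \<Sum>\<tau>\<in>?P. (of_int (sign \<tau>) / fact l) * T (?f \<tau> us)) vs"
  proof (rule alternation_cong)
    fix us :: "'v list" assume "length us = length vs" "set us = set vs"
    then have "length (take l (drop m us)) = l" using assms by simp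
    then show "alternation (\<lambda>ws. T (take m us @ ws @ drop (m + l) us)) (take l (drop m us)) =
       (\<Sum>\<tau>\<in>?P. (of_int (sign \<tau>) / fact l) * T (?f \<tau> us))"
      unfolding alternation_def by (simp add: sum_divide_distrib)
  qed
  also have "\<dots> = (\<Sum>\<tau>\<in>?P. (of_int (sign \<tau>) / fact l) * alternation (\<lambda>us. T (?f \<tau> us)) vs)"
    by (simp only: alternation_sum alternation_cmult)
  also have "\<dots> = (\<Sum>\<tau>\<in>?P. alternation T vs / fact l)"
  proof (rule sum.cong)
    fix \<tau> assume "\<tau> \<in> ?P"
    then have "alternation (\<lambda>us. T (?f \<tau> us)) vs = of_int (sign \<tau>) * alternation T vs"
      using signed_perm_block[of \<tau> l m "length vs"] assms by (intro alternation_signed_perm) auto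
    then show "(of_int (sign \<tau>) / fact l) * alternation (\<lambda>us. T (?f \<tau> us)) vs = alternation T vs / fact l"
      by (simp add: sign_sign)
  qed simp
  also have "\<dots> = alternation T vs"
    by (simp add: card_permutations)
  finally show ?thesis .
qed

lemma alternation_conc_alternation_left:
  fixes vs :: "'v list"
  shows "alternation (conc (alternation a) b) vs = alternation (conc a b) vs"
proof -
  let ?n = "length vs"
  let ?T = "\<lambda>k us. a (take k us) * b (drop k us)"
  have "alternation (conc (alternation a) b) vs =
     alternation (\<lambda>us. \<Sum>k\<le>?n. alternation a (take k us) * b (drop k us)) vs"
    by (rule alternation_cong) (simp add: conc_def)
  also have "\<dots> = (\<Sum>k\<le>?n. alternation (\<lambda>us. alternation a (take k us) * b (drop k us)) vs)"
    by (rule alternation_sum)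
  also have "\<dots> = (\<Sum>k\<le>?n. alternation (?T k) vs)"
  proof (rule sum.cong)
    fix k assume "k \<in> {..?n}"
    then have k: "k \<le> ?n" by simp
    have "alternation (\<lambda>us. alternation a (take k us) * b (drop k us)) vs =
       alternation (\<lambda>us. alternation (\<lambda>ws. ?T k (take 0 us @ ws @ drop (0 + k) us)) (take k (drop 0 us))) vs"
    proof (rule alternation_cong)
      fix us :: "'v list" assume us: "length us = ?n"
      have "alternation (\<lambda>ws. ?T k (ws @ drop k us)) (take k us) =
        alternation (\<lambda>ws. b (drop k us) * a ws) (take k us)"
        by (rule alternation_cong) (use us k in simp)
      also have "\<dots> = b (drop k us) * alternation a (take k us)"
        by (rule alternation_cmult)
      also have "\<dots> = alternation a (take k us) * b (drop k us)"
        by (rule mult.commute)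
      finally show "alternation a (take k us) * b (drop k us) =
        alternation (\<lambda>ws. ?T k (take 0 us @ ws @ drop (0 + k) us)) (take k (drop 0 us))"
        by simp
    qed
    then show "alternation (\<lambda>us. alternation a (take k us) * b (drop k us)) vs = alternation (?T k) vs"
      using k alternation_block[of 0 k vs "?T k"] by simp
  qed simp
  also have "\<dots> = alternation (\<lambda>us. \<Sum>k\<le>?n. ?T k us) vs"
    by (rule alternation_sum[symmetric])
  also have "\<dots> = alternation (conc a b) vs"
    by (rule alternation_cong) (simp add: conc_def)
  finally show ?thesis .
qed

lemma alternation_conc_alternation_right:
  fixes vs :: "'v list"
  shows "alternation (conc a (alternation b)) vs = alternation (conc a b) vs"
proof -
  let ?n = "length vs"
  let ?T = "\<lambda>k us. a (take k us) * b (drop k us)"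
  have "alternation (conc a (alternation b)) vs =
     alternation (\<lambda>us. \<Sum>k\<le>?n. a (take k us) * alternation b (drop k us)) vs"
    by (rule alternation_cong) (simp add: conc_def)
  also have "\<dots> = (\<Sum>k\<le>?n. alternation (\<lambda>us. a (take k us) * alternation b (drop k us)) vs)"
    by (rule alternation_sum)
  also have "\<dots> = (\<Sum>k\<le>?n. alternation (?T k) vs)"
  proof (rule sum.cong)
    fix k assume "k \<in> {..?n}"
    then have k: "k \<le> ?n" by simp
    have "alternation (\<lambda>us. a (take k us) * alternation b (drop k us)) vs =
       alternation (\<lambda>us. alternation (\<lambda>ws. ?T k (take k us @ ws @ drop (k + (?n - k)) us))
         (take (?n - k) (drop k us))) vs"
    proof (rule alternation_cong)
      fix us :: "'v list" assume us: "length us = ?n"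
      have "alternation (\<lambda>ws. ?T k (take k us @ ws)) (drop k us) =
        alternation (\<lambda>ws. a (take k us) * b ws) (drop k us)"
        by (rule alternation_cong) (use us k in simp)
      then show "a (take k us) * alternation b (drop k us) =
        alternation (\<lambda>ws. ?T k (take k us @ ws @ drop (k + (?n - k)) us)) (take (?n - k) (drop k us))"
        using us by (simp add: alternation_cmult)
    qed
    then show "alternation (\<lambda>us. a (take k us) * alternation b (drop k us)) vs = alternation (?T k) vs"
      using k alternation_block[of k "?n - k" vs "?T k"] by simp
  qed simp
  also have "\<dots> = alternation (\<lambda>us. \<Sum>k\<le>?n. ?T k us) vs"
    by (rule alternation_sum[symmetric])
  also have "\<dots> = alternation (conc a b) vs"
    by (rule alternation_cong) (simp add: conc_def)
  finally show ?thesis .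
qed

text \<open>The block consisting of all entries but the first. This is the case needed for the gradient, whose first
  argument is the direction of differentiation.\<close>

lemma alternation_tail:
  fixes vs :: "'v list"
  assumes "vs \<noteq> []"
  shows "alternation (\<lambda>us. alternation (\<lambda>ws. T (hd us # ws)) (tl us)) vs = alternation T vs"
proof -
  have "alternation (\<lambda>us. alternation (\<lambda>ws. T (hd us # ws)) (tl us)) vs =
    alternation (\<lambda>us. alternation (\<lambda>ws. T (take 1 us @ ws @ drop (1 + (length vs - 1)) us))
       (take (length vs - 1) (drop 1 us))) vs"
  proof (rule alternation_cong)
    fix us :: "'v list" assume us: "length us = length vs"
    obtain v ws where "us = v # ws" using us assms by (cases us) auto
    then show "alternation (\<lambda>ws. T (hd us # ws)) (tl us) =
      alternation (\<lambda>ws. T (take 1 us @ ws @ drop (1 + (length vs - 1)) us)) (take (length vs - 1) (drop 1 us))"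
      by (simp add: us[symmetric])
  qed
  then show ?thesis
    using alternation_block[of 1 "length vs - 1" vs T] assms by (cases vs) auto
qed


lemma permute_list_transpose:
  assumes "i < length vs" "j < length vs"
  shows "permute_list (Transposition.transpose i j) vs = vs[i := vs ! j, j := vs ! i]"
proof (rule nth_equalityI)
  have p: "Transposition.transpose i j permutes {..<length vs}"
    using assms by (intro permutes_swap_id) auto
  fix m assume "m < length (permute_list (Transposition.transpose i j) vs)"
  then show "permute_list (Transposition.transpose i j) vs ! m = vs[i := vs ! j, j := vs ! i] ! m"
    using assms by (auto simp: permute_list_nth[OF p] nth_list_update transpose_def)
qed simp

lemma signed_perm_id: "signed_perm n 1 (\<lambda>vs. vs)"
  unfolding signed_perm_def by (intro exI[of _ id] conjI permutes_id sign_id) auto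

lemma signed_perm_swap:
  assumes "i < n" "j < n" "i \<noteq> j"
  shows "signed_perm n (-1) (\<lambda>vs. vs[i := vs ! j, j := vs ! i])"
  unfolding signed_perm_def using assms
  by (intro exI[of _ "Transposition.transpose i j"])
     (auto simp: sign_swap_id permute_list_transpose intro!: permutes_swap_id)

lemma signed_perm_cong:
  assumes "signed_perm n s f" "\<And>vs. length vs = n \<Longrightarrow> f vs = g vs"
  shows "signed_perm n s g"
  using assms unfolding signed_perm_def by simp

text \<open>By \<open>i\<close> exchanges of neighbours.\<close>

lemma signed_perm_to_front:
  assumes "i < n"
  shows "signed_perm n ((-1) ^ i) (\<lambda>vs. vs ! i # take i vs @ drop (Suc i) vs)"
  using assms
proof (induction i)
  case 0
  have "vs = vs ! 0 # take 0 vs @ drop (Suc 0) vs" if "length vs = n" for vs :: "'a list"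
    using that 0 by (cases vs) auto
  with signed_perm_id[of n] show ?case by (auto intro: signed_perm_cong)
next
  case (Suc i)
  let ?s = "\<lambda>vs::'a list. vs[i := vs ! Suc i, Suc i := vs ! i]"
  have "?s vs ! i # take i (?s vs) @ drop (Suc i) (?s vs) = vs ! Suc i # take (Suc i) vs @ drop (Suc (Suc i)) vs"
    if "length vs = n" for vs :: "'a list"
  proof -
    have "drop (Suc i) (?s vs) = vs ! i # drop (Suc (Suc i)) vs"
      using that Suc.prems by (simp add: drop_update_swap Cons_nth_drop_Suc[symmetric])
    then show ?thesis
      using that Suc.prems by (simp add: take_Suc_conv_app_nth)
  qed
  with signed_perm_comp[OF signed_perm_swap[of i n "Suc i"] Suc.IH] Suc.prems show ?case
    by (auto intro: signed_perm_cong)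
qed

text \<open>Exchanging a block of length \<open>l\<close> with the following block of length \<open>k\<close> moves the last entry to the
  front \<open>k\<close> times. This gives \<open>-1\<close> to the power \<open>k(k + l - 1)\<close>, which has the parity of \<open>kl\<close> because \<open>k(k - 1)\<close> is even.\<close>

lemma signed_perm_rotate:
  assumes "n = k + l"
  shows "signed_perm n ((-1) ^ (k * l)) (\<lambda>vs. drop l vs @ take l vs)"
proof -
  have "signed_perm n (((-1) ^ (n - 1)) ^ k) (\<lambda>vs::'a list. drop (n - k) vs @ take (n - k) vs)"
    if "k \<le> n" for k
    using that
  proof (induction k)
    case 0
    then show ?case using signed_perm_id[of n] by (auto intro: signed_perm_cong)
  next
    case (Suc k)
    let ?f = "\<lambda>vs::'a list. drop (n - k) vs @ take (n - k) vs"
    have "?f vs ! (n - 1) # take (n - 1) (?f vs) @ drop (Suc (n - 1)) (?f vs) =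
       drop (n - Suc k) vs @ take (n - Suc k) vs" if "length vs = n" for vs
    proof -
      define m where "m = n - Suc k"
      have m: "n - k = Suc m" "m < n" "n - 1 - k = m" using Suc.prems by (auto simp: m_def)
      have "take (Suc m) vs = take m vs @ [vs ! m]" "drop m vs = vs ! m # drop (Suc m) vs"
        using that m by (auto simp: take_Suc_conv_app_nth Cons_nth_drop_Suc)
      then show ?thesis
        using that m Suc.prems unfolding m_def[symmetric] by (simp add: nth_append) linarith
    qed
    then show ?case
      using signed_perm_comp[OF Suc.IH signed_perm_to_front[of "n - 1" n]] Suc.prems
      by (auto intro: signed_perm_cong simp: mult.commute)
  qed
  from this[of k] have "signed_perm n ((-1) ^ ((n - 1) * k)) (\<lambda>vs::'a list. drop l vs @ take l vs)"
    using assms by (simp add: power_mult)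
  moreover have "(-1::int) ^ ((n - 1) * k) = (-1) ^ (k * l)"
    using assms by (cases k) (auto simp: minus_one_power_iff)
  ultimately show ?thesis by simp
qed

text \<open>The set \<open>S\<close> of movable positions allows for functions that are antisymmetric only in some of their
  arguments.\<close>

lemma sign_permute_list_if_swap:
  assumes "\<sigma> permutes S" "S \<subseteq> {..<n}" "length vs = n"
    and swap: "\<And>vs i j. length vs = n \<Longrightarrow> i \<in> S \<Longrightarrow> j \<in> S \<Longrightarrow> i \<noteq> j \<Longrightarrow>
      a (vs[i := vs ! j, j := vs ! i]) = - a vs"
  shows "a (permute_list \<sigma> vs) = of_int (sign \<sigma>) * (a vs :: real)"
proof -
  have "finite S" using assms(2) finite_subset by blast
  with assms(1) show ?thesis using assms(3)
  proof (induction arbitrary: vs rule: permutes_induct)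
    case id
    then show ?case unfolding permute_list_id by simp
  next
    case (swap i j \<sigma>)
    have ij: "i < length vs" "j < length vs" using swap assms(2) by auto
    have \<sigma>: "\<sigma> permutes {..<length vs}"
      using permutes_subset[OF swap.hyps(4) assms(2)] swap.prems by simp
    have "a (permute_list (Transposition.transpose i j \<circ> \<sigma>) vs) =
      of_int (sign \<sigma>) * a (permute_list (Transposition.transpose i j) vs)"
      using \<sigma> swap by (simp add: permute_list_compose)
    also have "\<dots> = - of_int (sign \<sigma>) * a vs"
      using ij swap assms(4)[of vs i j] by (simp add: permute_list_transpose)
    also have "- sign \<sigma> = sign (Transposition.transpose i j \<circ> \<sigma>)"
      using \<sigma> swap by (simp add: sign_compose permutation_lessThan sign_swap_id permutation_swap_id)
    then have "- of_int (sign \<sigma>) = real_of_int (sign (Transposition.transpose i j \<circ> \<sigma>))"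
      by (metis of_int_minus)
    finally show ?case .
  qed
qed

lemma antisymmetricI:
  assumes "\<And>vs i j. i < length vs \<Longrightarrow> j < length vs \<Longrightarrow> i \<noteq> j \<Longrightarrow>
      a (vs[i := vs ! j, j := vs ! i]) = - a vs"
  shows "antisymmetric a"
  unfolding antisymmetric_def
proof (intro allI impI)
  fix \<sigma> and vs :: "'a list" assume "\<sigma> permutes {..<length vs}"
  then show "a (permute_list \<sigma> vs) = of_int (sign \<sigma>) * a vs"
    by (rule sign_permute_list_if_swap) (use assms in auto)
qed

lemma antisymmetric_swap:
  assumes "antisymmetric a" "i < length vs" "j < length vs" "i \<noteq> j"
  shows "a (vs[i := vs ! j, j := vs ! i]) = - a vs"
proof -
  have "Transposition.transpose i j permutes {..<length vs}"
    using assms by (intro permutes_swap_id) auto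
  then have "a (permute_list (Transposition.transpose i j) vs) =
      of_int (sign (Transposition.transpose i j)) * a vs"
    using assms(1) unfolding antisymmetric_def by blast
  then show ?thesis using assms by (simp add: sign_swap_id permute_list_transpose)
qed

lemma antisymmetric_signed_perm:
  assumes "antisymmetric a" "signed_perm (length vs) s f"
  shows "a (f vs) = of_int s * a vs"
proof -
  obtain \<sigma> where "\<sigma> permutes {..<length vs}" "sign \<sigma> = s" "permute_list \<sigma> vs = f vs"
    using assms(2) unfolding signed_perm_def by blast
  then show ?thesis using assms(1) unfolding antisymmetric_def by metis
qed

lemma antisymmetric_repeat:
  assumes "antisymmetric a" "i < length vs" "j < length vs" "i \<noteq> j" "vs ! i = vs ! j"
  shows "a vs = 0"
  using antisymmetric_swap[OF assms(1-4)] assms(5)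
  by (metis add.inverse_neutral equal_neg_zero list_update_id)

text \<open>For a function that is already antisymmetric in all arguments but the first, the \<open>n!\<close> terms of the
  alternation fall into \<open>n\<close> groups of equal terms, according to which entry comes first. This is the
  passage from the alternation to the alternating sum in the definition of the exterior derivative.\<close>

lemma alternation_antisymmetric_tail:
  assumes tail: "\<And>v. antisymmetric (\<lambda>ws. T (v # ws))" and "vs \<noteq> []"
  shows "alternation T vs =
    (\<Sum>i<length vs. (-1) ^ i * T (vs ! i # take i vs @ drop (Suc i) vs)) / length vs"
proof -
  obtain n where n: "length vs = Suc n" using assms(2) by (cases vs) auto
  let ?S = "{1..<Suc n}" and ?t = "Transposition.transpose (0::nat)"
  have inner: "T (permute_list \<sigma> us) = of_int (sign \<sigma>) * T us"
    if "\<sigma> permutes ?S" "length us = Suc n" for \<sigma> us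
    using that(1) _ that(2)
  proof (rule sign_permute_list_if_swap)
    fix us :: "'a list" and i j assume *: "length us = Suc n" "i \<in> ?S" "j \<in> ?S" "i \<noteq> j"
    then obtain v ws i' j' where "us = v # ws" "i = Suc i'" "j = Suc j'"
      by (cases us; cases i; cases j) auto
    then show "T (us[i := us ! j, j := us ! i]) = - T us"
      using antisymmetric_swap[OF tail, of i' ws j' v] * by auto
  qed auto
  have perm: "?t b \<circ> \<sigma> permutes {..<Suc n}" "\<sigma> permutes {..<Suc n}" "?t b permutes {..<Suc n}"
    if "b < Suc n" "\<sigma> permutes ?S" for b \<sigma>
  proof -
    show 1: "\<sigma> permutes {..<Suc n}" using that(2) by (rule permutes_subset) auto
    show 2: "?t b permutes {..<Suc n}" using that by (intro permutes_swap_id) auto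
    show "?t b \<circ> \<sigma> permutes {..<Suc n}" using permutes_compose[OF 1 2] .
  qed
  \<comment> \<open>The transposition of \<open>0\<close> and \<open>b\<close> puts the right entry in front, but leaves the old first entry at
    position \<open>b\<close>; moving that one back to the front of the tail costs \<open>(-1)\<^sup>b\<^sup>-\<^sup>1\<close>.\<close>
  have step: "of_int (sign (?t b)) * T (permute_list (?t b) vs) = (-1) ^ b * T (vs ! b # take b vs @ drop (Suc b) vs)"
    if b: "b < Suc n" for b
  proof (cases b)
    case 0
    then show ?thesis using n by (cases vs) (auto simp: permute_list_transpose sign_swap_id)
  next
    case (Suc b')
    obtain u us where vs: "vs = u # us" using n by (cases vs) auto
    have us: "length us = n" using n vs by simp
    have "T (us ! b' # us[b' := u] ! b' # take b' (us[b' := u]) @ drop (Suc b') (us[b' := u])) =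
      (-1) ^ b' * T (us ! b' # us[b' := u])"
      using antisymmetric_signed_perm[OF tail signed_perm_to_front[of b' "length (us[b' := u])"]]
        us b Suc by simp
    then show ?thesis
      using b Suc us by (simp add: vs permute_list_transpose sign_swap_id)
  qed
  have "(\<Sum>\<sigma> | \<sigma> permutes {..<Suc n}. of_int (sign \<sigma>) * T (permute_list \<sigma> vs)) =
    (\<Sum>b<Suc n. \<Sum>\<sigma> | \<sigma> permutes ?S. of_int (sign (?t b \<circ> \<sigma>)) * T (permute_list (?t b \<circ> \<sigma>) vs))"
  proof -
    have "insert 0 ?S = {..<Suc n}" by auto
    then show ?thesis
      using sum_over_permutations_insert[of ?S 0 "\<lambda>\<sigma>. of_int (sign \<sigma>) * T (permute_list \<sigma> vs)"]
      by simp
  qed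
  also have "\<dots> = (\<Sum>b<Suc n. \<Sum>\<sigma> | \<sigma> permutes ?S. (-1) ^ b * T (vs ! b # take b vs @ drop (Suc b) vs))"
  proof (intro sum.cong refl)
    fix b \<sigma> assume "b \<in> {..<Suc n}" "\<sigma> \<in> {\<sigma>. \<sigma> permutes ?S}"
    then have b: "b < Suc n" and \<sigma>: "\<sigma> permutes ?S" by auto
    have "of_int (sign (?t b \<circ> \<sigma>)) * T (permute_list (?t b \<circ> \<sigma>) vs) =
      of_int (sign (?t b)) * T (permute_list (?t b) vs)"
      using inner[OF \<sigma>, of "permute_list (?t b) vs"] perm[OF b \<sigma>] n
      by (simp add: permute_list_compose sign_compose permutation_lessThan sign_sign mult.assoc)
    then show "of_int (sign (?t b \<circ> \<sigma>)) * T (permute_list (?t b \<circ> \<sigma>) vs) =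
      (-1) ^ b * T (vs ! b # take b vs @ drop (Suc b) vs)"
      using step[OF b] by simp
  qed
  also have "\<dots> = (\<Sum>b<Suc n. fact n * ((-1) ^ b * T (vs ! b # take b vs @ drop (Suc b) vs)))"
    by (simp add: card_permutations)
  finally show ?thesis
    unfolding alternation_def n by (simp add: sum_distrib_left[symmetric] divide_simps)
qed

definition multilinear :: "('v::real_vector list \<Rightarrow> real) \<Rightarrow> bool" where
  "multilinear a \<longleftrightarrow> (\<forall>us ws. linear (\<lambda>v. a (us @ v # ws)))"

text \<open>Polarisation: put \<open>v + w\<close> into both slots and expand.\<close>

lemma antisymmetric_if_alternating:
  assumes lin: "multilinear a" and alt: "\<And>us v ws xs. a (us @ v # ws @ v # xs) = 0"
  shows "antisymmetric a"
proof (rule antisymmetricI)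
  have add: "a (us @ (v + w) # ws) = a (us @ v # ws) + a (us @ w # ws)" for us v w ws
    using lin linear_add[of "\<lambda>v. a (us @ v # ws)" v w] by (simp add: multilinear_def)
  have ordered: "a (vs[i := vs ! j, j := vs ! i]) = - a vs" if "i < j" "j < length vs" for vs :: "'a list" and i j
  proof -
    define us ws xs where "us = take i vs" "ws = take (j - Suc i) (drop (Suc i) vs)" "xs = drop (Suc j) vs"
    have vs: "vs = us @ vs ! i # ws @ vs ! j # xs"
    proof -
      have "drop (Suc i) vs = ws @ vs ! j # xs"
        using id_take_nth_drop[of "j - Suc i" "drop (Suc i) vs"] that by (simp add: us_ws_xs_def)
      moreover have "vs = us @ vs ! i # drop (Suc i) vs"
        using id_take_nth_drop[of i vs] that by (simp add: us_ws_xs_def)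
      ultimately show ?thesis by simp
    qed
    have len: "length us = i" "length ws = j - Suc i" using that unfolding us_ws_xs_def by auto
    define v w where "v = vs ! i" "w = vs ! j"
    have eq: "vs = us @ v # ws @ w # xs" using vs unfolding v_w_def .
    have eq': "vs[i := vs ! j, j := vs ! i] = us @ w # ws @ v # xs"
      unfolding v_w_def[symmetric] unfolding eq using len that
      by (auto simp: list_update_append split: nat.split)
    have "0 = a (us @ (v + w) # ws @ (v + w) # xs)" using alt by simp
    also have "\<dots> = a (us @ v # ws @ w # xs) + a (us @ w # ws @ v # xs)"
      using alt[of us v ws xs] alt[of us w ws xs] add[of "us @ v # ws" v w xs] add[of "us @ w # ws" v w xs]
        add[of us v w "ws @ (v + w) # xs"] by simp
    finally show ?thesis unfolding eq' using eq by simp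
  qed
  fix vs :: "'a list" and i j assume "i < length vs" "j < length vs" "i \<noteq> j"
  then show "a (vs[i := vs ! j, j := vs ! i]) = - a vs"
    using ordered[of i j vs] ordered[of j i vs] list_update_swap[of i j vs "vs ! j" "vs ! i"]
    by (cases "i < j") simp_all
qed

section \<open>The exterior product\<close>

definition ext_prod :: "('v list \<Rightarrow> real) \<Rightarrow> ('v list \<Rightarrow> real) \<Rightarrow> 'v list \<Rightarrow> real" where
  "ext_prod a b vs = (\<Sum>k\<le>length vs.
     (\<Sum>\<sigma> | \<sigma> permutes {..<length vs}. of_int (sign \<sigma>) *
        a (take k (permute_list \<sigma> vs)) * b (drop k (permute_list \<sigma> vs)))
     / (fact k * fact (length vs - k)))"

text \<open>The wedge product of forms is formed pointwise, so its algebraic laws concern lists only.\<close>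

lemma wedge_eq_ext_prod: "wedge \<alpha> \<beta> p = ext_prod (\<alpha> p) (\<beta> p)"
  by (simp add: wedge_def ext_prod_def fun_eq_iff)

text \<open>The factors \<open>1 / (k! (n - k)!)\<close> in the exterior product are exactly what the normalisation of the two
  factors produces.\<close>

lemma over_fact_ext_prod:
  "over_fact (ext_prod a b) = alternation (conc (over_fact a) (over_fact b))"
proof
  fix vs :: "'a list"
  let ?P = "{\<sigma>. \<sigma> permutes {..<length vs}}"
  have "alternation (conc (over_fact a) (over_fact b)) vs =
    (\<Sum>\<sigma>\<in>?P. \<Sum>k\<le>length vs. of_int (sign \<sigma>) * a (take k (permute_list \<sigma> vs)) *
       b (drop k (permute_list \<sigma> vs)) / (fact k * fact (length vs - k)) / fact (length vs))"
    unfolding alternation_def conc_def over_fact_def sum_divide_distrib sum_distrib_left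
    by (intro sum.cong) (auto simp: min_def)
  also have "\<dots> = (\<Sum>k\<le>length vs. \<Sum>\<sigma>\<in>?P. of_int (sign \<sigma>) * a (take k (permute_list \<sigma> vs)) *
       b (drop k (permute_list \<sigma> vs)) / (fact k * fact (length vs - k)) / fact (length vs))"
    by (rule sum.swap)
  finally show "over_fact (ext_prod a b) vs = alternation (conc (over_fact a) (over_fact b)) vs"
    by (simp add: over_fact_def ext_prod_def sum_divide_distrib)
qed

lemma over_fact_inject: "over_fact a = over_fact b \<Longrightarrow> a = b"
  by (auto simp: over_fact_def fun_eq_iff)

lemma antisymmetric_over_fact: "antisymmetric (over_fact a) \<longleftrightarrow> antisymmetric a"
  by (simp add: antisymmetric_def over_fact_def)

lemma antisymmetric_ext_prod: "antisymmetric (ext_prod a b)"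
  by (subst antisymmetric_over_fact[symmetric]) (simp add: over_fact_ext_prod antisymmetric_alternation)

lemma conc_Nil: "conc a b [] = a [] * b []"
  by (simp add: conc_def)

text \<open>The first entry belongs to the second factor, or else to the first one. This recursion makes induction on
  the list available for tensor products.\<close>

lemma conc_Cons: "conc a b (v # vs) = a [] * b (v # vs) + conc (\<lambda>us. a (v # us)) b vs"
  by (simp add: conc_def sum.atMost_Suc_shift del: sum.atMost_Suc)

lemma conc_assoc: "conc (conc a b) c vs = conc a (conc b c) vs"
proof (induction vs arbitrary: a b)
  case Nil
  show ?case by (simp add: conc_Nil)
next
  case (Cons v vs)
  have "conc (\<lambda>us. conc a b (v # us)) c vs =
    a [] * conc (\<lambda>us. b (v # us)) c vs + conc (conc (\<lambda>us. a (v # us)) b) c vs"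
    unfolding conc_Cons by (simp add: conc_def algebra_simps sum.distrib sum_distrib_left)
  then show ?case
    by (simp add: conc_Cons conc_Nil Cons.IH algebra_simps)
qed

text \<open>Both sides are the alternation of the same threefold tensor product, because the inner alternation is
  absorbed by the outer one.\<close>

lemma ext_prod_assoc: "ext_prod (ext_prod a b) c = ext_prod a (ext_prod b c)"
proof (rule over_fact_inject)
  have "conc (conc (over_fact a) (over_fact b)) (over_fact c) = conc (over_fact a) (conc (over_fact b) (over_fact c))"
    using conc_assoc by blast
  then show "over_fact (ext_prod (ext_prod a b) c) = over_fact (ext_prod a (ext_prod b c))"
    unfolding over_fact_ext_prod
    by (intro ext) (simp add: alternation_conc_alternation_left alternation_conc_alternation_right)
qed

definition ext_unit :: "'v list \<Rightarrow> real" where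
  "ext_unit vs = (if vs = [] then 1 else 0)"

lemma conc_zero_left: "conc (\<lambda>_. 0) b vs = 0"
  by (simp add: conc_def)

lemma conc_unit_left: "conc ext_unit b = b"
proof
  fix vs show "conc ext_unit b vs = b vs"
    by (cases vs) (simp_all add: conc_Nil conc_Cons ext_unit_def conc_zero_left)
qed

lemma conc_unit_right: "conc b ext_unit = b"
proof
  fix vs show "conc b ext_unit vs = b vs"
    by (induction vs arbitrary: b) (simp_all add: conc_Nil conc_Cons ext_unit_def)
qed

lemma over_fact_unit: "over_fact ext_unit = ext_unit"
  by (auto simp: over_fact_def ext_unit_def)

lemma ext_prod_unit_left: "antisymmetric a \<Longrightarrow> ext_prod ext_unit a = a"
  by (rule over_fact_inject)
     (simp add: over_fact_ext_prod over_fact_unit conc_unit_left alternation_antisymmetric antisymmetric_over_fact)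

lemma ext_prod_unit_right: "antisymmetric a \<Longrightarrow> ext_prod a ext_unit = a"
  by (rule over_fact_inject)
     (simp add: over_fact_ext_prod over_fact_unit conc_unit_right alternation_antisymmetric antisymmetric_over_fact)

definition homogeneous :: "nat \<Rightarrow> ('v list \<Rightarrow> real) \<Rightarrow> bool" where
  "homogeneous k a \<longleftrightarrow> (\<forall>vs. length vs \<noteq> k \<longrightarrow> a vs = 0)"

lemma homogeneous_over_fact: "homogeneous k (over_fact a) \<longleftrightarrow> homogeneous k a"
  by (simp add: homogeneous_def over_fact_def)

lemma conc_homogeneous:
  assumes "homogeneous k a"
  shows "conc a b vs = (if k \<le> length vs then a (take k vs) * b (drop k vs) else 0)"
proof -
  have "conc a b vs = (\<Sum>i\<le>length vs. if i = k then a (take k vs) * b (drop k vs) else 0)"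
    unfolding conc_def using assms by (intro sum.cong) (auto simp: homogeneous_def min_def)
  then show ?thesis by (simp add: sum.delta)
qed

lemma alternation_zero: "alternation (\<lambda>_. 0) vs = 0"
  by (simp add: alternation_def)

lemma conc_homogeneous_right:
  assumes "homogeneous k a"
  shows "conc b a vs = (if k \<le> length vs then b (take (length vs - k) vs) * a (drop (length vs - k) vs) else 0)"
proof -
  have "conc b a vs = (\<Sum>i\<le>length vs. if i + k = length vs then b (take i vs) * a (drop i vs) else 0)"
    unfolding conc_def using assms by (intro sum.cong) (auto simp: homogeneous_def)
  also have "\<dots> = (\<Sum>i\<le>length vs. if i = length vs - k then (if k \<le> length vs then b (take i vs) * a (drop i vs) else 0) else 0)"
    by (intro sum.cong) auto
  finally show ?thesis by (simp add: sum.delta)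
qed

text \<open>Exchanging the two blocks is a rotation. As \<open>a\<close> is homogeneous, the length of the list determines the
  length of the part that goes into \<open>b\<close>, and with it the sign.\<close>

lemma alternation_conc_commute_homogeneous:
  assumes a: "homogeneous k a"
  shows "alternation (conc a b) vs = (-1) ^ (k * (length vs - k)) * alternation (conc b a) vs"
proof (cases "k \<le> length vs")
  case True
  define l where "l = length vs - k"
  have n: "length vs = k + l" using True by (simp add: l_def)
  have "alternation (conc b a) vs = alternation (\<lambda>us. conc a b (drop l us @ take l us)) vs"
    using n by (intro alternation_cong) (simp add: conc_homogeneous[OF a] conc_homogeneous_right[OF a])
  also have "\<dots> = of_int ((-1) ^ (k * l)) * alternation (conc a b) vs"
    using signed_perm_rotate[OF n] by (rule alternation_signed_perm)
  finally show ?thesis unfolding l_def[symmetric] by (simp flip: mult.assoc power_add)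
next
  case False
  have "alternation (conc a b) vs = alternation (\<lambda>_. 0) vs" "alternation (conc b a) vs = alternation (\<lambda>_. 0) vs"
    by (rule alternation_cong, use False in \<open>simp add: conc_homogeneous[OF a] conc_homogeneous_right[OF a]\<close>)+
  then show ?thesis by (simp add: alternation_zero)
qed

lemma ext_prod_commute_homogeneous:
  assumes "homogeneous k a"
  shows "ext_prod a b vs = (-1) ^ (k * (length vs - k)) * ext_prod b a vs"
proof -
  have "homogeneous k (over_fact a)" using assms by (simp only: homogeneous_over_fact)
  from alternation_conc_commute_homogeneous[OF this, of "over_fact b" vs]
  have "over_fact (ext_prod a b) vs = (-1) ^ (k * (length vs - k)) * over_fact (ext_prod b a) vs"
    by (simp only: over_fact_ext_prod)
  then show ?thesis by (simp add: over_fact_def)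
qed

lemma homogeneous_ext_prod:
  assumes "homogeneous k a" "homogeneous l b"
  shows "homogeneous (k + l) (ext_prod a b)"
proof -
  have "alternation (conc (over_fact a) (over_fact b)) vs = 0" if "length vs \<noteq> k + l" for vs
  proof -
    have "alternation (conc (over_fact a) (over_fact b)) vs = alternation (\<lambda>_. 0) vs"
      using assms that
      by (intro alternation_cong)
         (auto simp: conc_homogeneous[of k "over_fact a"] homogeneous_over_fact, auto simp: homogeneous_def over_fact_def)
    then show ?thesis by (simp add: alternation_zero)
  qed
  then have "homogeneous (k + l) (over_fact (ext_prod a b))"
    by (simp add: homogeneous_def over_fact_ext_prod)
  then show ?thesis by (simp add: homogeneous_over_fact)
qed

lemma ext_prod_commute:
  assumes a: "homogeneous k a" and b: "homogeneous l b"
  shows "ext_prod a b vs = (-1) ^ (k * l) * ext_prod b a vs"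
proof (cases "length vs = k + l")
  case True
  then show ?thesis using ext_prod_commute_homogeneous[OF a, of b vs] by simp
next
  case False
  then show ?thesis
    using homogeneous_ext_prod[OF a b] homogeneous_ext_prod[OF b a] by (simp add: homogeneous_def)
qed

lemma ext_prod_nonzero:
  assumes "ext_prod a b vs \<noteq> 0"
  shows "\<exists>k \<sigma>. k \<le> length vs \<and> \<sigma> permutes {..<length vs} \<and>
    a (take k (permute_list \<sigma> vs)) \<noteq> 0 \<and> b (drop k (permute_list \<sigma> vs)) \<noteq> 0"
proof (rule ccontr)
  assume "\<not> ?thesis"
  then have "of_int (sign \<sigma>) * a (take k (permute_list \<sigma> vs)) * b (drop k (permute_list \<sigma> vs)) = 0"
    if "k \<le> length vs" "\<sigma> permutes {..<length vs}" for k \<sigma>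
    using that by auto
  then have "(\<Sum>\<sigma> | \<sigma> permutes {..<length vs}. of_int (sign \<sigma>) * a (take k (permute_list \<sigma> vs)) *
      b (drop k (permute_list \<sigma> vs))) = 0" if "k \<le> length vs" for k
    using that by (intro sum.neutral) blast
  then show False using assms by (simp add: ext_prod_def)
qed

lemma ext_prod_map:
  "ext_prod (\<lambda>us. a (map g us)) (\<lambda>us. b (map g us)) vs = ext_prod a b (map g vs)"
  unfolding ext_prod_def length_map
  by (intro sum.cong arg_cong2[where f="(/)"] refl) (simp add: permute_list_map take_map drop_map)

lemma ext_prod_add_left: "ext_prod (\<lambda>us. a us + b us) c vs = ext_prod a c vs + ext_prod b c vs"
  unfolding ext_prod_def distrib_left distrib_right sum.distrib add_divide_distrib ..

lemma ext_prod_add_right: "ext_prod c (\<lambda>us. a us + b us) vs = ext_prod c a vs + ext_prod c b vs"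
  unfolding ext_prod_def distrib_left distrib_right sum.distrib add_divide_distrib ..

lemma ext_prod_cmult_left: "ext_prod (\<lambda>us. r * a us) c vs = r * ext_prod a c vs"
  unfolding ext_prod_def sum_distrib_left sum_divide_distrib
  by (intro sum.cong refl) (simp only: times_divide_eq_right mult_ac)

lemma ext_prod_cmult_right: "ext_prod c (\<lambda>us. r * a us) vs = r * ext_prod c a vs"
  unfolding ext_prod_def sum_distrib_left sum_divide_distrib
  by (intro sum.cong refl) (simp only: times_divide_eq_right mult_ac)

lemma linear_const_mult: "linear f \<Longrightarrow> linear (\<lambda>v. c * f v)" for f :: "'a::real_vector \<Rightarrow> real"
  by (intro linearI) (simp_all add: linear_add linear_scale distrib_left)

lemma multilinear_update:
  assumes "multilinear a" "i < length vs"
  shows "linear (\<lambda>v. a (vs[i := v]))"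
  using assms by (simp add: upd_conv_take_nth_drop multilinear_def)

lemma multilinear_Cons: "multilinear a \<Longrightarrow> multilinear (\<lambda>us. a (u # us))"
proof -
  assume "multilinear a"
  then have "linear (\<lambda>v. a ((u # us) @ v # ws))" for us ws
    unfolding multilinear_def by blast
  then show ?thesis by (simp add: multilinear_def)
qed

lemma multilinear_conc:
  assumes "multilinear a" "multilinear b"
  shows "multilinear (conc a b)"
proof -
  have "linear (\<lambda>v. conc a b (us @ v # ws))" for us ws
    using assms(1)
  proof (induction us arbitrary: a)
    case Nil
    have "linear (\<lambda>v. a ([] @ v # take k ws))" for k
      using Nil unfolding multilinear_def by blast
    then have "linear (\<lambda>v. a (v # take k ws) * b (drop k ws))" for k
      by (simp add: linear_iff algebra_simps)
    then have "linear (\<lambda>v. conc (\<lambda>us. a (v # us)) b ws)"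
      unfolding conc_def by (intro linear_compose_sum) simp
    moreover have "linear (\<lambda>v. b ([] @ v # ws))"
      using assms(2) unfolding multilinear_def by blast
    ultimately show ?case
      by (simp add: conc_Cons linear_iff algebra_simps)
  next
    case (Cons u us)
    have "linear (\<lambda>v. conc (\<lambda>us. a (u # us)) b (us @ v # ws))"
      using Cons multilinear_Cons by blast
    moreover have "linear (\<lambda>v. b ((u # us) @ v # ws))"
      using assms(2) unfolding multilinear_def by blast
    ultimately show ?case
      by (simp add: conc_Cons linear_iff algebra_simps)
  qed
  then show ?thesis unfolding multilinear_def by blast
qed

text \<open>A permutation moves a single entry from position \<open>i\<close> to position \<open>\<sigma>\<^sup>-\<^sup>1(i)\<close>.\<close>

lemma permute_list_update:
  assumes \<sigma>: "\<sigma> permutes {..<length vs}" and "i < length vs"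
  shows "permute_list \<sigma> (vs[i := v]) = (permute_list \<sigma> vs)[inv_into UNIV \<sigma> i := v]"
proof (rule nth_equalityI)
  fix m assume "m < length (permute_list \<sigma> (vs[i := v]))"
  then have m: "m < length vs" by simp
  have "inv_into UNIV \<sigma> i < length vs"
    using permutes_in_image[OF permutes_inv[OF \<sigma>], of i] assms by simp
  moreover have "\<sigma> m < length vs"
    using permutes_in_image[OF \<sigma>, of m] m by simp
  moreover have "\<sigma> m = i \<longleftrightarrow> m = inv_into UNIV \<sigma> i"
    using permutes_inv_eq[OF \<sigma>, of i m] by metis
  ultimately show "permute_list \<sigma> (vs[i := v]) ! m = (permute_list \<sigma> vs)[inv_into UNIV \<sigma> i := v] ! m"
    using m \<sigma> assms(2) by (cases "\<sigma> m = i") (simp_all add: permute_list_nth)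
qed simp

lemma multilinear_alternation:
  assumes "multilinear T"
  shows "multilinear (alternation T)"
  unfolding multilinear_def
proof (intro allI)
  fix us ws :: "'a list"
  let ?vs = "us @ 0 # ws"
  have "linear (\<lambda>v. of_int (sign \<sigma>) * T (permute_list \<sigma> (us @ v # ws)))" if "\<sigma> permutes {..<length ?vs}" for \<sigma>
  proof -
    define xs where "xs = permute_list \<sigma> ?vs"
    have "inv_into UNIV \<sigma> (length us) < length ?vs"
      using permutes_in_image[OF permutes_inv[OF that], of "length us"] by simp
    then have "linear (\<lambda>v. T (xs[inv_into UNIV \<sigma> (length us) := v]))"
      by (intro multilinear_update[OF assms]) (simp add: xs_def)
    then have "linear (\<lambda>v. of_int (sign \<sigma>) * T (xs[inv_into UNIV \<sigma> (length us) := v]))"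
      by (rule linear_const_mult)
    moreover have "permute_list \<sigma> (us @ v # ws) = xs[inv_into UNIV \<sigma> (length us) := v]" for v
      unfolding xs_def using permute_list_update[OF that, of "length us" v] by simp
    ultimately show ?thesis by simp
  qed
  then have sum: "linear (\<lambda>v. \<Sum>\<sigma> | \<sigma> permutes {..<length ?vs}. of_int (sign \<sigma>) * T (permute_list \<sigma> (us @ v # ws)))"
    by (intro linear_compose_sum) simp
  show "linear (\<lambda>v. alternation T (us @ v # ws))"
    using linear_const_mult[OF sum, of "1 / fact (length ?vs)"]
    by (simp add: alternation_def del: fact_Suc)
qed

lemma multilinear_over_fact: "multilinear (over_fact a) \<longleftrightarrow> multilinear a"
proof -
  have "linear (\<lambda>v. f v / fact n) \<longleftrightarrow> linear f" for f :: "'a \<Rightarrow> real" and n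
  proof
    assume "linear (\<lambda>v. f v / fact n)"
    from linear_const_mult[OF this, of "fact n"] show "linear f" by simp
  next
    assume "linear f"
    from linear_const_mult[OF this, of "1 / fact n"] show "linear (\<lambda>v. f v / fact n)" by simp
  qed
  then show ?thesis by (simp only: multilinear_def over_fact_def length_append list.size)
qed

lemma multilinear_ext_prod:
  assumes "multilinear a" "multilinear b"
  shows "multilinear (ext_prod a b)"
proof -
  have "multilinear (over_fact (ext_prod a b))"
    unfolding over_fact_ext_prod using assms
    by (intro multilinear_alternation multilinear_conc) (simp_all only: multilinear_over_fact)
  then show ?thesis by (simp only: multilinear_over_fact)
qed

section \<open>Smooth functions on open sets\<close>

definition fin_dim :: "'e::real_inner itself \<Rightarrow> bool" where
  "fin_dim _ \<longleftrightarrow> (\<exists>B::'e set. finite B \<and> span B = UNIV)"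

text \<open>A finite set with coordinate functionals \<open>x \<mapsto> x \<bullet> d b\<close>. It plays the role of the standard basis of a
  Euclidean space and also exists in dimension zero.\<close>

definition dual_frame :: "'e::real_inner set \<Rightarrow> ('e \<Rightarrow> 'e) \<Rightarrow> bool" where
  "dual_frame B d \<longleftrightarrow> finite B \<and> (\<forall>x. x = (\<Sum>b\<in>B. (x \<bullet> d b) *\<^sub>R b))"

text \<open>An orthogonal spanning set, with the functionals \<open>x \<mapsto> (x \<bullet> b) / (b \<bullet> b)\<close>.\<close>

lemma dual_frame_exists:
  assumes "fin_dim TYPE('e::real_inner)"
  obtains B :: "'e::real_inner set" and d where "dual_frame B d"
proof -
  obtain B :: "'e set" where "finite B" "span B = UNIV"
    using assms unfolding fin_dim_def by blast
  then obtain C :: "'e set" where C: "finite C" "span C = UNIV" "pairwise orthogonal C"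
    using basis_orthogonal[of B] by auto
  define d where "d b = (1 / (b \<bullet> b)) *\<^sub>R b" for b :: 'e
  have "(\<Sum>b\<in>C. (x \<bullet> d b) *\<^sub>R b) = x" for x
  proof -
    have "x \<in> span C" using C by simp
    then show ?thesis
    proof (induction rule: span_induct)
      case base
      have "(\<Sum>b\<in>C. ((c *\<^sub>R x) \<bullet> d b) *\<^sub>R b) = c *\<^sub>R (\<Sum>b\<in>C. (x \<bullet> d b) *\<^sub>R b)" for c x
        by (simp add: scaleR_sum_right)
      then show ?case
        by (simp add: subspace_def inner_add_left scaleR_add_left sum.distrib del: inner_scaleR_left)
    next
      case (step c)
      have "(c \<bullet> d b) *\<^sub>R b = (if b = c then c else 0)" if "b \<in> C" for b
        using C(3) step that by (auto simp: d_def pairwise_def orthogonal_def)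
      then have "(\<Sum>b\<in>C. (c \<bullet> d b) *\<^sub>R b) = (\<Sum>b\<in>C. if b = c then c else 0)"
        by (intro sum.cong) auto
      then show ?case using C(1) step by simp
    qed
  qed
  then show ?thesis using that[of C d] C(1) unfolding dual_frame_def by simp
qed

lemma dual_frame_linear:
  assumes "dual_frame B d" "linear f"
  shows "f v = (\<Sum>b\<in>B. (v \<bullet> d b) *\<^sub>R f b)"
proof -
  have "f v = f (\<Sum>b\<in>B. (v \<bullet> d b) *\<^sub>R b)"
    using assms(1) unfolding dual_frame_def by metis
  then show ?thesis
    using assms(2) by (simp add: linear_sum linear_scale)
qed

lemma has_frechet_derivative: "f differentiable at x \<Longrightarrow> (f has_derivative frechet_derivative f (at x)) (at x)"
  by (rule frechet_derivative_works[THEN iffD1])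

lemma Ck_on_cong:
  assumes "open S" "\<And>x. x \<in> S \<Longrightarrow> f x = g x" "Ck_on k S f"
  shows "Ck_on k S g"
  using assms
proof (induction k arbitrary: f g)
  case 0
  then show ?case by (simp cong: continuous_on_cong)
next
  case (Suc k)
  have D: "(g has_derivative frechet_derivative f (at x)) (at x)" if "x \<in> S" for x
    by (rule has_derivative_transform_within_open[OF has_frechet_derivative \<open>open S\<close> that]) (use Suc that in auto)
  have eq: "frechet_derivative f (at x) = frechet_derivative g (at x)" if "x \<in> S" for x
    by (rule frechet_derivative_at[OF D[OF that]])
  have "Ck_on k S (\<lambda>x. frechet_derivative g (at x) v)" for v
    by (rule Suc.IH[OF \<open>open S\<close>, of "\<lambda>x. frechet_derivative f (at x) v"]) (use Suc.prems eq in auto)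
  then show ?case using D by (auto simp: differentiable_def)
qed

lemma Ck_on_subset: "Ck_on k S f \<Longrightarrow> T \<subseteq> S \<Longrightarrow> Ck_on k T f"
proof (induction k arbitrary: f)
  case 0
  then show ?case by (auto intro: continuous_on_subset)
next
  case (Suc k)
  then show ?case by auto
qed

lemma Ck_on_SucD: "Ck_on (Suc k) S f \<Longrightarrow> Ck_on k S f"
proof (induction k arbitrary: f)
  case 0
  then show ?case
    by (auto intro!: continuous_at_imp_continuous_on differentiable_imp_continuous_within)
next
  case (Suc k)
  have "Ck_on k S (\<lambda>x. frechet_derivative f (at x) v)" for v
    by (rule Suc.IH) (use Suc.prems in auto)
  then show ?case using Suc.prems by simp
qed

lemma Ck_on_const: "Ck_on k S (\<lambda>x. c)"
  by (induction k arbitrary: c) auto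

lemma Ck_on_bounded_linear:
  assumes "bounded_linear f" shows "Ck_on k S f"
proof (cases k)
  case 0
  then show ?thesis using assms by (simp add: linear_continuous_on)
next
  case (Suc k')
  have "frechet_derivative f (at x) = f" for x
    using frechet_derivative_at[OF bounded_linear_imp_has_derivative[OF assms]] by simp
  then show ?thesis
    using Suc assms by (auto simp: Ck_on_const bounded_linear_imp_differentiable)
qed

lemma Ck_on_bounded_linear_compose:
  assumes "bounded_linear L" "open S" "Ck_on k S f"
  shows "Ck_on k S (\<lambda>x. L (f x))"
  using assms(3)
proof (induction k arbitrary: f)
  case 0
  then show ?case using bounded_linear.continuous_on[OF assms(1)] by simp
next
  case (Suc k)
  have D: "((\<lambda>x. L (f x)) has_derivative (\<lambda>v. L (frechet_derivative f (at x) v))) (at x)" if "x \<in> S" for x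
    by (rule bounded_linear.has_derivative[OF assms(1) has_frechet_derivative]) (use Suc that in auto)
  have eq: "L (frechet_derivative f (at x) v) = frechet_derivative (\<lambda>x. L (f x)) (at x) v" if "x \<in> S" for x v
    using frechet_derivative_at[OF D[OF that]] by (rule fun_cong)
  have "Ck_on k S (\<lambda>x. frechet_derivative (\<lambda>x. L (f x)) (at x) v)" for v
    by (rule Ck_on_cong[OF \<open>open S\<close> eq Suc.IH]) (use Suc.prems in auto)
  then show ?case using D by (auto simp: differentiable_def)
qed

lemma Ck_on_add:
  assumes "open S" "Ck_on k S f" "Ck_on k S g"
  shows "Ck_on k S (\<lambda>x. f x + g x)"
  using assms(2,3)
proof (induction k arbitrary: f g)
  case 0
  then show ?case by (auto intro: continuous_on_add)
next
  case (Suc k)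
  have D: "((\<lambda>x. f x + g x) has_derivative (\<lambda>v. frechet_derivative f (at x) v + frechet_derivative g (at x) v)) (at x)"
    if "x \<in> S" for x
    by (rule has_derivative_add[OF has_frechet_derivative has_frechet_derivative]) (use Suc that in auto)
  have eq: "frechet_derivative f (at x) v + frechet_derivative g (at x) v = frechet_derivative (\<lambda>x. f x + g x) (at x) v"
    if "x \<in> S" for x v
    using frechet_derivative_at[OF D[OF that]] by (rule fun_cong)
  have "Ck_on k S (\<lambda>x. frechet_derivative (\<lambda>x. f x + g x) (at x) v)" for v
    by (rule Ck_on_cong[OF \<open>open S\<close> eq Suc.IH]) (use Suc.prems in auto)
  then show ?case using D by (auto simp: differentiable_def)
qed

lemma Ck_on_sum:
  assumes "open S" "\<And>i. i \<in> I \<Longrightarrow> Ck_on k S (f i)"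
  shows "Ck_on k S (\<lambda>x. \<Sum>i\<in>I. f i x)"
  using assms(2)
proof (induction I rule: infinite_finite_induct)
  case (insert i I)
  then show ?case using Ck_on_add[OF assms(1), of k "f i" "\<lambda>x. \<Sum>i\<in>I. f i x"] by simp
qed (auto simp: Ck_on_const)

lemma Ck_on_scaleR:
  fixes f :: "'e::real_normed_vector \<Rightarrow> real"
  assumes "open S" "Ck_on k S f" "Ck_on k S g"
  shows "Ck_on k S (\<lambda>x. f x *\<^sub>R g x)"
  using assms(2,3)
proof (induction k arbitrary: f g)
  case 0
  then show ?case by (auto intro: continuous_on_scaleR)
next
  case (Suc k)
  have D: "((\<lambda>x. f x *\<^sub>R g x) has_derivative
      (\<lambda>v. f x *\<^sub>R frechet_derivative g (at x) v + frechet_derivative f (at x) v *\<^sub>R g x)) (at x)"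
    if "x \<in> S" for x
    by (rule has_derivative_scaleR[OF has_frechet_derivative has_frechet_derivative]) (use Suc that in auto)
  have eq: "f x *\<^sub>R frechet_derivative g (at x) v + frechet_derivative f (at x) v *\<^sub>R g x =
      frechet_derivative (\<lambda>x. f x *\<^sub>R g x) (at x) v"
    if "x \<in> S" for x v
    using frechet_derivative_at[OF D[OF that]] by (rule fun_cong)
  have "Ck_on k S (\<lambda>x. frechet_derivative (\<lambda>x. f x *\<^sub>R g x) (at x) v)" for v
  proof (rule Ck_on_cong[OF \<open>open S\<close> eq])
    show "Ck_on k S (\<lambda>x. f x *\<^sub>R frechet_derivative g (at x) v + frechet_derivative f (at x) v *\<^sub>R g x)"
      by (intro Ck_on_add \<open>open S\<close> Suc.IH Ck_on_SucD[OF Suc.prems(1)] Ck_on_SucD[OF Suc.prems(2)])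
         (use Suc.prems in auto)
  qed
  then show ?case using D by (auto simp: differentiable_def)
qed

lemma Ck_on_local:
  assumes "\<And>x. x \<in> S \<Longrightarrow> \<exists>T. open T \<and> x \<in> T \<and> Ck_on k T f"
  shows "Ck_on k S f"
  using assms
proof (induction k arbitrary: f)
  case 0
  show ?case
    unfolding Ck_on.simps
  proof (rule continuous_at_imp_continuous_on, rule ballI)
    fix x assume "x \<in> S"
    then obtain T where "open T" "x \<in> T" "continuous_on T f" using 0 by force
    then show "isCont f x" by (simp add: continuous_on_eq_continuous_at)
  qed
next
  case (Suc k)
  have "f differentiable at x" if "x \<in> S" for x
    using Suc.prems[OF that] by auto
  moreover have "Ck_on k S (\<lambda>x. frechet_derivative f (at x) v)" for v
    by (rule Suc.IH) (use Suc.prems in force)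
  ultimately show ?case by simp
qed

text \<open>In coordinates the chain rule writes a directional derivative of \<open>g \<circ> f\<close> as a finite sum of products of a
  derivative of \<open>f\<close> with a partial derivative of \<open>g\<close> composed with \<open>f\<close>, and the induction hypothesis
  applies to the latter. This is where finite dimension of the intermediate space enters.\<close>

lemma Ck_on_compose:
  fixes f :: "'e::real_normed_vector \<Rightarrow> 'f::real_inner"
  assumes fin: "fin_dim TYPE('f)" and "open S"
    and "Ck_on k S f" "Ck_on k T g" "f ` S \<subseteq> T"
  shows "Ck_on k S (\<lambda>x. g (f x))"
  using assms(3-5)
proof (induction k arbitrary: g)
  case 0
  then show ?case using continuous_on_compose2[of T g S f] by auto
next
  case (Suc k)
  obtain B :: "'f set" and d where B: "dual_frame B d" using dual_frame_exists[OF fin] .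
  have Df: "f differentiable at x" and Dg: "g differentiable at (f x)" if "x \<in> S" for x
    using Suc.prems that by auto
  have D: "((\<lambda>x. g (f x)) has_derivative (\<lambda>v. frechet_derivative g (at (f x)) (frechet_derivative f (at x) v))) (at x)"
    if "x \<in> S" for x
    using diff_chain_at[OF has_frechet_derivative[OF Df[OF that]] has_frechet_derivative[OF Dg[OF that]]]
    by (simp add: o_def)
  have eq: "(\<Sum>b\<in>B. (frechet_derivative f (at x) v \<bullet> d b) *\<^sub>R frechet_derivative g (at (f x)) b) =
      frechet_derivative (\<lambda>x. g (f x)) (at x) v" if "x \<in> S" for x v
    using fun_cong[OF frechet_derivative_at[OF D[OF that]], of v]
      dual_frame_linear[OF B linear_frechet_derivative[OF Dg[OF that]], of "frechet_derivative f (at x) v"] by simp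
  have f: "Ck_on k S f" using Suc.prems(1) by (rule Ck_on_SucD)
  have "Ck_on k S (\<lambda>x. frechet_derivative (\<lambda>x. g (f x)) (at x) v)" for v
  proof (rule Ck_on_cong[OF \<open>open S\<close> eq])
    show "Ck_on k S (\<lambda>x. \<Sum>b\<in>B. (frechet_derivative f (at x) v \<bullet> d b) *\<^sub>R frechet_derivative g (at (f x)) b)"
    proof (intro Ck_on_sum Ck_on_scaleR \<open>open S\<close>)
      fix b
      show "Ck_on k S (\<lambda>x. frechet_derivative f (at x) v \<bullet> d b)"
        by (rule Ck_on_bounded_linear_compose[OF bounded_linear_inner_left \<open>open S\<close>]) (use Suc.prems in auto)
      show "Ck_on k S (\<lambda>x. frechet_derivative g (at (f x)) b)"
        by (rule Suc.IH[OF f]) (use Suc.prems in auto)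
    qed
  qed
  then show ?case using D by (auto simp: differentiable_def)
qed

lemma smooth_on_cong:
  "open S \<Longrightarrow> (\<And>x. x \<in> S \<Longrightarrow> f x = g x) \<Longrightarrow> smooth_on S f \<Longrightarrow> smooth_on S g"
  unfolding smooth_on_def by (intro allI, rule Ck_on_cong[where f = f]) auto

lemma smooth_on_subset: "smooth_on S f \<Longrightarrow> T \<subseteq> S \<Longrightarrow> smooth_on T f"
  unfolding smooth_on_def by (intro allI, rule Ck_on_subset) auto

lemma smooth_on_const: "smooth_on S (\<lambda>x. c)"
  unfolding smooth_on_def by (intro allI Ck_on_const)

lemma smooth_on_bounded_linear: "bounded_linear f \<Longrightarrow> smooth_on S f"
  unfolding smooth_on_def by (intro allI, rule Ck_on_bounded_linear) auto

lemma smooth_on_bounded_linear_compose: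
  "bounded_linear L \<Longrightarrow> open S \<Longrightarrow> smooth_on S f \<Longrightarrow> smooth_on S (\<lambda>x. L (f x))"
  unfolding smooth_on_def by (intro allI, rule Ck_on_bounded_linear_compose) auto

lemma smooth_on_add: "open S \<Longrightarrow> smooth_on S f \<Longrightarrow> smooth_on S g \<Longrightarrow> smooth_on S (\<lambda>x. f x + g x)"
  unfolding smooth_on_def by (intro allI, rule Ck_on_add) auto

lemma smooth_on_sum:
  "open S \<Longrightarrow> (\<And>i. i \<in> I \<Longrightarrow> smooth_on S (f i)) \<Longrightarrow> smooth_on S (\<lambda>x. \<Sum>i\<in>I. f i x)"
  unfolding smooth_on_def by (intro allI, rule Ck_on_sum) auto

lemma smooth_on_scaleR:
  "open S \<Longrightarrow> smooth_on S f \<Longrightarrow> smooth_on S g \<Longrightarrow> smooth_on S (\<lambda>x. f x *\<^sub>R g x)"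
  unfolding smooth_on_def by (intro allI, rule Ck_on_scaleR) auto

lemma smooth_on_mult:
  fixes f g :: "'e::real_normed_vector \<Rightarrow> real"
  shows "open S \<Longrightarrow> smooth_on S f \<Longrightarrow> smooth_on S g \<Longrightarrow> smooth_on S (\<lambda>x. f x * g x)"
  using smooth_on_scaleR[of S f g] by simp

lemma smooth_on_local:
  assumes "\<And>x. x \<in> S \<Longrightarrow> \<exists>T. open T \<and> x \<in> T \<and> smooth_on T f"
  shows "smooth_on S f"
  unfolding smooth_on_def
proof (intro allI Ck_on_local)
  fix k x assume "x \<in> S"
  with assms obtain T where "open T" "x \<in> T" "smooth_on T f" by blast
  then show "\<exists>T. open T \<and> x \<in> T \<and> Ck_on k T f" unfolding smooth_on_def by blast
qed

lemma smooth_on_compose: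
  fixes f :: "'e::real_normed_vector \<Rightarrow> 'f::real_inner"
  assumes "fin_dim TYPE('f)" "open S" "smooth_on S f" "smooth_on T g" "f ` S \<subseteq> T"
  shows "smooth_on S (\<lambda>x. g (f x))"
  unfolding smooth_on_def
  using assms(3,4) by (auto simp: smooth_on_def intro: Ck_on_compose[OF assms(1,2) _ _ assms(5)])

lemma smooth_on_differentiable: "smooth_on S f \<Longrightarrow> x \<in> S \<Longrightarrow> f differentiable at x"
  unfolding smooth_on_def by (drule spec[of _ "Suc 0"]) simp

lemma smooth_on_frechet_derivative:
  "smooth_on S f \<Longrightarrow> smooth_on S (\<lambda>x. frechet_derivative f (at x) v)"
  unfolding smooth_on_def by (intro allI) (drule_tac x = "Suc k" in spec, simp)

lemma smooth_on_isCont: "smooth_on S f \<Longrightarrow> x \<in> S \<Longrightarrow> isCont f x"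
  by (intro differentiable_imp_continuous_within smooth_on_differentiable)

lemma smooth_on_Pair:
  fixes f :: "'e::real_normed_vector \<Rightarrow> 'f::real_normed_vector" and g :: "'e \<Rightarrow> 'g::real_normed_vector"
  assumes "open S" "smooth_on S f" "smooth_on S g"
  shows "smooth_on S (\<lambda>x. (f x, g x))"
proof -
  have 1: "bounded_linear (\<lambda>y::'f. (y, 0::'g))" "bounded_linear (\<lambda>y::'g. (0::'f, y))"
    by (intro bounded_linear_Pair bounded_linear_ident bounded_linear_zero)+
  from smooth_on_add[OF assms(1) smooth_on_bounded_linear_compose[OF 1(1) assms(1,2)]
    smooth_on_bounded_linear_compose[OF 1(2) assms(1,3)]]
  show ?thesis by simp
qed


lemma has_derivative_along_line:
  fixes f :: "'e::real_normed_vector \<Rightarrow> real"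
  assumes "f differentiable (at (p + t *\<^sub>R v))"
  shows "((\<lambda>t. f (p + t *\<^sub>R v)) has_real_derivative frechet_derivative f (at (p + t *\<^sub>R v)) v) (at t)"
proof -
  have 1: "((\<lambda>t. p + t *\<^sub>R v) has_derivative (\<lambda>h. h *\<^sub>R v)) (at t)"
    by (auto intro!: derivative_eq_intros)
  have 2: "((\<lambda>t. f (p + t *\<^sub>R v)) has_derivative (\<lambda>h. frechet_derivative f (at (p + t *\<^sub>R v)) (h *\<^sub>R v))) (at t)"
    using diff_chain_at[OF 1 has_frechet_derivative[OF assms]] by (simp add: o_def)
  have "frechet_derivative f (at (p + t *\<^sub>R v)) (h *\<^sub>R v) = frechet_derivative f (at (p + t *\<^sub>R v)) v * h" for h
    using linear_scale[OF linear_frechet_derivative[OF assms], of h v] by simp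
  with 2 show ?thesis unfolding has_field_derivative_def by simp
qed

text \<open>The mean value theorem, first along \<open>u\<close> for the difference in direction \<open>v\<close>, then along \<open>v\<close> for the
  derivative in direction \<open>u\<close>.\<close>

lemma second_difference_mvt:
  fixes f :: "'e::real_normed_vector \<Rightarrow> real"
  assumes h: "h > 0"
    and S: "\<And>s t. 0 \<le> s \<Longrightarrow> s \<le> h \<Longrightarrow> 0 \<le> t \<Longrightarrow> t \<le> h \<Longrightarrow> x + s *\<^sub>R u + t *\<^sub>R v \<in> S"
    and f: "\<And>y. y \<in> S \<Longrightarrow> f differentiable (at y)"
    and f': "\<And>y. y \<in> S \<Longrightarrow> (\<lambda>y. frechet_derivative f (at y) u) differentiable (at y)"
  obtains s t where "0 \<le> s" "s \<le> h" "0 \<le> t" "t \<le> h"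
    "f (x + h *\<^sub>R u + h *\<^sub>R v) - f (x + h *\<^sub>R u) - f (x + h *\<^sub>R v) + f x =
      h * h * frechet_derivative (\<lambda>y. frechet_derivative f (at y) u) (at (x + s *\<^sub>R u + t *\<^sub>R v)) v"
proof -
  let ?f' = "\<lambda>y. frechet_derivative f (at y) u"
  have S0: "x + s *\<^sub>R u \<in> S" if "0 \<le> s" "s \<le> h" for s
    using S[of s 0] that h by simp
  have Sh: "(x + h *\<^sub>R v) + s *\<^sub>R u \<in> S" if "0 \<le> s" "s \<le> h" for s
    using S[of s h] that h by (simp add: algebra_simps)
  have "\<exists>s>0. s < h \<and>
     (f ((x + h *\<^sub>R v) + h *\<^sub>R u) - f (x + h *\<^sub>R u)) - (f ((x + h *\<^sub>R v) + 0 *\<^sub>R u) - f (x + 0 *\<^sub>R u)) =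
     (h - 0) * (?f' ((x + h *\<^sub>R v) + s *\<^sub>R u) - ?f' (x + s *\<^sub>R u))"
    by (rule MVT2[OF h]) (auto intro!: DERIV_diff has_derivative_along_line f S0 Sh)
  then obtain s where s: "0 < s" "s < h" and eq1:
    "(f ((x + h *\<^sub>R v) + h *\<^sub>R u) - f (x + h *\<^sub>R u)) - (f (x + h *\<^sub>R v) - f x) =
     h * (?f' ((x + h *\<^sub>R v) + s *\<^sub>R u) - ?f' (x + s *\<^sub>R u))"
    by auto
  have "\<exists>t>0. t < h \<and> ?f' (x + s *\<^sub>R u + h *\<^sub>R v) - ?f' (x + s *\<^sub>R u + 0 *\<^sub>R v) =
     (h - 0) * frechet_derivative ?f' (at (x + s *\<^sub>R u + t *\<^sub>R v)) v"
    by (rule MVT2[OF h]) (use s in \<open>auto intro!: has_derivative_along_line f' S\<close>)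
  then obtain t where t: "0 < t" "t < h" and eq2: "?f' (x + s *\<^sub>R u + h *\<^sub>R v) - ?f' (x + s *\<^sub>R u) =
     h * frechet_derivative ?f' (at (x + s *\<^sub>R u + t *\<^sub>R v)) v"
    by auto
  have c: "(x + h *\<^sub>R v) + s *\<^sub>R u = x + s *\<^sub>R u + h *\<^sub>R v" "(x + h *\<^sub>R v) + h *\<^sub>R u = x + h *\<^sub>R u + h *\<^sub>R v"
    by simp_all
  have "f (x + h *\<^sub>R u + h *\<^sub>R v) - f (x + h *\<^sub>R u) - f (x + h *\<^sub>R v) + f x =
     h * (?f' (x + s *\<^sub>R u + h *\<^sub>R v) - ?f' (x + s *\<^sub>R u))"
    using eq1 unfolding c by linarith
  then show ?thesis
    using that[of s t] s t eq2 by (simp add: mult.assoc)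
qed

text \<open>The second difference of \<open>f\<close> is symmetric in \<open>u\<close> and \<open>v\<close>. The mean value theorem in both orders shows
  that the two mixed derivatives agree at two points arbitrarily close to \<open>x\<close>, hence at \<open>x\<close> by continuity.\<close>

lemma symmetric_second_derivative_real:
  fixes f :: "'e::real_normed_vector \<Rightarrow> real"
  assumes "open S" "x \<in> S" "smooth_on S f"
  shows "frechet_derivative (\<lambda>y. frechet_derivative f (at y) u) (at x) v =
    frechet_derivative (\<lambda>y. frechet_derivative f (at y) v) (at x) u"
proof (rule ccontr)
  define A where "A y = frechet_derivative (\<lambda>y. frechet_derivative f (at y) u) (at y) v" for y
  define B where "B y = frechet_derivative (\<lambda>y. frechet_derivative f (at y) v) (at y) u" for y
  assume "\<not> ?thesis"
  then have ne: "\<bar>A x - B x\<bar> / 2 > 0" unfolding A_def B_def by simp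
  have "isCont A x" "isCont B x"
    unfolding A_def B_def using assms
    by (auto intro!: smooth_on_isCont[of S] smooth_on_frechet_derivative)
  with ne obtain d1 d2 where d1: "d1 > 0" "\<And>y. dist y x < d1 \<Longrightarrow> \<bar>A y - A x\<bar> < \<bar>A x - B x\<bar> / 2"
    and d2: "d2 > 0" "\<And>y. dist y x < d2 \<Longrightarrow> \<bar>B y - B x\<bar> < \<bar>A x - B x\<bar> / 2"
    unfolding continuous_at_eps_delta dist_real_def by metis
  obtain r where r: "r > 0" "ball x r \<subseteq> S"
    using assms(1,2) open_contains_ball by blast
  define e where "e = min r (min d1 d2)"
  have e: "e > 0" using r d1 d2 by (simp add: e_def)
  \<comment> \<open>Small enough for all points of the parallelogram to be closer than \<open>e\<close> to \<open>x\<close>; the summand 1 covers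
    the case \<open>u = v = 0\<close>.\<close>
  define h where "h = e / (norm u + norm v + 1)"
  have h: "h > 0" unfolding h_def using e by (simp add: add_nonneg_pos)
  have near: "dist (x + s *\<^sub>R a + t *\<^sub>R b) x < e"
    if st: "0 \<le> s" "s \<le> h" "0 \<le> t" "t \<le> h" and ab: "norm a + norm b = norm u + norm v" for s t a b
  proof -
    have "dist (x + s *\<^sub>R a + t *\<^sub>R b) x = norm (s *\<^sub>R a + t *\<^sub>R b)"
      by (simp add: dist_norm add.assoc)
    also have "\<dots> \<le> s * norm a + t * norm b"
      using norm_triangle_ineq[of "s *\<^sub>R a" "t *\<^sub>R b"] st by simp
    also have "\<dots> \<le> h * norm a + h * norm b"
      using st by (intro add_mono mult_right_mono) auto
    also have "\<dots> = h * (norm u + norm v)"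
      using ab by (simp add: distrib_left[symmetric])
    also have "\<dots> < h * (norm u + norm v + 1)" using h by simp
    also have "\<dots> = e"
    proof -
      have "norm u + norm v + 1 \<noteq> 0"
        using norm_ge_zero[of u] norm_ge_zero[of v] by linarith
      then show ?thesis unfolding h_def by simp
    qed
    finally show ?thesis .
  qed
  have inS: "y \<in> S" if "dist y x < e" for y
    using r that by (auto simp: e_def dist_commute)
  have diff: "f differentiable (at y)" "(\<lambda>y. frechet_derivative f (at y) w) differentiable (at y)" if "y \<in> S" for y w
    using assms that by (auto intro: smooth_on_differentiable smooth_on_frechet_derivative)
  obtain s t where st: "0 \<le> s" "s \<le> h" "0 \<le> t" "t \<le> h"
    and A: "f (x + h *\<^sub>R u + h *\<^sub>R v) - f (x + h *\<^sub>R u) - f (x + h *\<^sub>R v) + f x = h * h * A (x + s *\<^sub>R u + t *\<^sub>R v)"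
    unfolding A_def by (rule second_difference_mvt[OF h, of x u v S f]) (auto intro: inS near diff)
  obtain s' t' where st': "0 \<le> s'" "s' \<le> h" "0 \<le> t'" "t' \<le> h"
    and B: "f (x + h *\<^sub>R v + h *\<^sub>R u) - f (x + h *\<^sub>R v) - f (x + h *\<^sub>R u) + f x = h * h * B (x + s' *\<^sub>R v + t' *\<^sub>R u)"
    unfolding B_def
    by (rule second_difference_mvt[OF h, of x v u S f]) (auto intro: inS near[OF _ _ _ _ add.commute] diff)
  have "x + h *\<^sub>R v + h *\<^sub>R u = x + h *\<^sub>R u + h *\<^sub>R v" by (simp only: add_ac)
  with A B[unfolded this] have "h * h * A (x + s *\<^sub>R u + t *\<^sub>R v) = h * h * B (x + s' *\<^sub>R v + t' *\<^sub>R u)"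
    by linarith
  then have eq: "A (x + s *\<^sub>R u + t *\<^sub>R v) = B (x + s' *\<^sub>R v + t' *\<^sub>R u)"
    using h by simp
  have "\<bar>A (x + s *\<^sub>R u + t *\<^sub>R v) - A x\<bar> < \<bar>A x - B x\<bar> / 2"
    using near[OF st, of u v] by (intro d1) (simp add: e_def)
  moreover have "\<bar>B (x + s' *\<^sub>R v + t' *\<^sub>R u) - B x\<bar> < \<bar>A x - B x\<bar> / 2"
    using near[OF st', of v u] by (intro d2) (simp add: e_def)
  ultimately show False using eq by (smt (verit) field_sum_of_halves)
qed

lemma frechet_derivative_inner_left:
  assumes "f differentiable (at x)"
  shows "frechet_derivative (\<lambda>y. f y \<bullet> w) (at x) v = frechet_derivative f (at x) v \<bullet> w"
proof -
  have "((\<lambda>y. f y \<bullet> w) has_derivative (\<lambda>v. frechet_derivative f (at x) v \<bullet> w)) (at x)"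
    by (rule bounded_linear.has_derivative[OF bounded_linear_inner_left has_frechet_derivative[OF assms]])
  from fun_cong[OF frechet_derivative_at[OF this], of v] show ?thesis by simp
qed

lemma frechet_derivative_cong_open:
  assumes "open S" "x \<in> S" "\<And>y. y \<in> S \<Longrightarrow> f y = g y" "f differentiable (at x)"
  shows "frechet_derivative f (at x) = frechet_derivative g (at x)"
  by (rule frechet_derivative_transform_within_open[OF assms(4,1,2,3)])

text \<open>Reduction to real-valued functions by pairing with an arbitrary vector.\<close>

lemma symmetric_second_derivative:
  fixes f :: "'e::real_normed_vector \<Rightarrow> 'f::real_inner"
  assumes S: "open S" "x \<in> S" and f: "smooth_on S f"
  shows "frechet_derivative (\<lambda>y. frechet_derivative f (at y) u) (at x) v =
    frechet_derivative (\<lambda>y. frechet_derivative f (at y) v) (at x) u"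
proof -
  have *: "frechet_derivative (\<lambda>y. frechet_derivative (\<lambda>z. f z \<bullet> w) (at y) a) (at x) b =
     frechet_derivative (\<lambda>y. frechet_derivative f (at y) a) (at x) b \<bullet> w" for w a b
  proof -
    have "frechet_derivative (\<lambda>y. frechet_derivative f (at y) a \<bullet> w) (at x) =
        frechet_derivative (\<lambda>y. frechet_derivative (\<lambda>z. f z \<bullet> w) (at y) a) (at x)"
    proof (rule frechet_derivative_cong_open[OF S])
      show "frechet_derivative f (at y) a \<bullet> w = frechet_derivative (\<lambda>z. f z \<bullet> w) (at y) a" if "y \<in> S" for y
        using frechet_derivative_inner_left[OF smooth_on_differentiable[OF f that]] by simp
      show "(\<lambda>y. frechet_derivative f (at y) a \<bullet> w) differentiable (at x)"
        by (intro smooth_on_differentiable[OF _ S(2)] smooth_on_bounded_linear_compose[OF bounded_linear_inner_left]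
            S smooth_on_frechet_derivative f)
    qed
    from fun_cong[OF this, of b] show ?thesis
      using frechet_derivative_inner_left[OF smooth_on_differentiable[OF smooth_on_frechet_derivative[OF f] S(2)], of a w b]
      by simp
  qed
  have "smooth_on S (\<lambda>z. f z \<bullet> w)" for w
    by (intro smooth_on_bounded_linear_compose[OF bounded_linear_inner_left] S f)
  then have "frechet_derivative (\<lambda>y. frechet_derivative f (at y) u) (at x) v \<bullet> w =
    frechet_derivative (\<lambda>y. frechet_derivative f (at y) v) (at x) u \<bullet> w" for w
    using symmetric_second_derivative_real[OF S] * by metis
  then show ?thesis by (rule vector_eq_rdot[THEN iffD1, rule_format])
qed

section \<open>Families of multilinear functions\<close>

lemma multilinear_expand:
  assumes "dual_frame B d" "multilinear a"
  shows "a (us @ v # ws) = (\<Sum>b\<in>B. (v \<bullet> d b) * a (us @ b # ws))"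
  using dual_frame_linear[OF assms(1), of "\<lambda>v. a (us @ v # ws)" v] assms(2)
  unfolding multilinear_def by simp

text \<open>The product rule for a multilinear function \<open>a\<close> that depends on the point \<open>f y\<close> and has moving arguments
  \<open>g y\<close> as well as fixed arguments \<open>ws\<close>. The fixed arguments serve the induction: the last moving argument
  is expanded in a frame, which makes it a fixed argument with a scalar coefficient.\<close>

lemma has_derivative_multilinear:
  fixes f :: "'e::real_normed_vector \<Rightarrow> 'f::real_inner" and a :: "'f \<Rightarrow> 'f list \<Rightarrow> real"
  assumes fin: "fin_dim TYPE('f)" and T: "open T" "f x \<in> T"
    and lin: "\<And>y. y \<in> T \<Longrightarrow> multilinear (a y)"
    and a: "\<And>us. (\<lambda>y. a y us) differentiable (at (f x))"
    and f: "(f has_derivative f') (at x)"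
    and gs: "\<And>g. g \<in> set gs \<Longrightarrow> g differentiable (at x)"
  shows "((\<lambda>y. a (f y) (map (\<lambda>g. g y) gs @ ws)) has_derivative
    (\<lambda>h. frechet_derivative (\<lambda>y. a y (map (\<lambda>g. g x) gs @ ws)) (at (f x)) (f' h) +
      (\<Sum>i<length gs. a (f x) (map (\<lambda>g. g x) (take i gs) @ frechet_derivative (gs ! i) (at x) h #
          map (\<lambda>g. g x) (drop (Suc i) gs) @ ws)))) (at x)"
  using gs
proof (induction gs arbitrary: ws rule: rev_induct)
  case Nil
  show ?case
    using diff_chain_at[OF f has_frechet_derivative[OF a]] by (simp add: o_def)
next
  case (snoc g gs)
  obtain B :: "'f set" and d where B: "dual_frame B d" using dual_frame_exists[OF fin] .
  define D where "D us = frechet_derivative (\<lambda>y. a y us) (at (f x))" for us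
  define G where "G = map (\<lambda>g. g x) gs"
  define P where "P h i = map (\<lambda>g. g x) (take i gs) @ frechet_derivative (gs ! i) (at x) h #
      map (\<lambda>g. g x) (drop (Suc i) gs)" for h i
  define R where "R h ws = (\<Sum>i<length gs. a (f x) (P h i @ ws))" for h ws
  have IH: "((\<lambda>y. a (f y) (map (\<lambda>g. g y) gs @ ws)) has_derivative (\<lambda>h. D (G @ ws) (f' h) + R h ws)) (at x)" for ws
    using snoc.IH[of ws] snoc.prems unfolding D_def G_def R_def P_def by simp
  have g: "(g has_derivative frechet_derivative g (at x)) (at x)"
    using snoc.prems by (intro has_frechet_derivative) simp
  let ?F' = "\<lambda>h. \<Sum>b\<in>B. (g x \<bullet> d b) * (D (G @ b # ws) (f' h) + R h (b # ws)) +
      (frechet_derivative g (at x) h \<bullet> d b) * a (f x) (G @ b # ws)"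
  have F': "((\<lambda>y. \<Sum>b\<in>B. (g y \<bullet> d b) * a (f y) (map (\<lambda>g. g y) gs @ b # ws)) has_derivative ?F') (at x)"
  proof (rule has_derivative_sum)
    fix b
    have "((\<lambda>y. (g y \<bullet> d b) * a (f y) (map (\<lambda>g. g y) gs @ b # ws)) has_derivative
        (\<lambda>h. (g x \<bullet> d b) * (D (G @ b # ws) (f' h) + R h (b # ws)) +
          (frechet_derivative g (at x) h \<bullet> d b) * a (f x) (map (\<lambda>g. g x) gs @ b # ws))) (at x)"
      by (rule has_derivative_mult[OF bounded_linear.has_derivative[OF bounded_linear_inner_left g] IH])
    then show "((\<lambda>y. (g y \<bullet> d b) * a (f y) (map (\<lambda>g. g y) gs @ b # ws)) has_derivative
        (\<lambda>h. (g x \<bullet> d b) * (D (G @ b # ws) (f' h) + R h (b # ws)) +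
          (frechet_derivative g (at x) h \<bullet> d b) * a (f x) (G @ b # ws))) (at x)"
      by (simp only: G_def)
  qed
  have "eventually (\<lambda>y. f y \<in> T) (at x)"
  proof -
    have "isCont f x" using f by (rule has_derivative_continuous)
    then show ?thesis using T by (simp add: isCont_def topological_tendstoD)
  qed
  moreover have expand: "(\<Sum>b\<in>B. (g y \<bullet> d b) * a (f y) (map (\<lambda>g. g y) gs @ b # ws)) =
      a (f y) (map (\<lambda>g. g y) (gs @ [g]) @ ws)" if "f y \<in> T" for y
    using multilinear_expand[OF B lin[OF that], of "map (\<lambda>g. g y) gs" "g y" ws] by simp
  ultimately have ev: "eventually (\<lambda>y. (\<Sum>b\<in>B. (g y \<bullet> d b) * a (f y) (map (\<lambda>g. g y) gs @ b # ws)) =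
      a (f y) (map (\<lambda>g. g y) (gs @ [g]) @ ws)) (at x)"
    by (rule eventually_mono)
  have main: "((\<lambda>y. a (f y) (map (\<lambda>g. g y) (gs @ [g]) @ ws)) has_derivative ?F') (at x)"
    by (rule has_derivative_transform_eventually[OF F' ev expand]) (use T in simp_all)
  have "?F' h = D (G @ g x # ws) (f' h) + (R h (g x # ws) + a (f x) (G @ frechet_derivative g (at x) h # ws))" for h
  proof -
    have "(\<Sum>b\<in>B. (g x \<bullet> d b) * D (G @ b # ws) (f' h)) = D (G @ g x # ws) (f' h)"
    proof -
      have "((\<lambda>y. \<Sum>b\<in>B. (g x \<bullet> d b) * a y (G @ b # ws)) has_derivative
          (\<lambda>k. \<Sum>b\<in>B. (g x \<bullet> d b) * D (G @ b # ws) k)) (at (f x))"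
        unfolding D_def by (rule has_derivative_sum) (rule has_derivative_mult_right[OF has_frechet_derivative[OF a]])
      then have "((\<lambda>y. a y (G @ g x # ws)) has_derivative (\<lambda>k. \<Sum>b\<in>B. (g x \<bullet> d b) * D (G @ b # ws) k)) (at (f x))"
        by (rule has_derivative_transform_within_open[OF _ T]) (rule multilinear_expand[OF B lin, symmetric])
      from fun_cong[OF frechet_derivative_at[OF this], of "f' h"] show ?thesis by (simp add: D_def)
    qed
    moreover have "(\<Sum>b\<in>B. (g x \<bullet> d b) * R h (b # ws)) = R h (g x # ws)"
    proof -
      have "(\<Sum>b\<in>B. (g x \<bullet> d b) * a (f x) (P @ b # ws)) = a (f x) (P @ g x # ws)" for P
        using multilinear_expand[OF B lin[OF T(2)], of P "g x" ws] by simp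
      then have "(\<Sum>i<length gs. \<Sum>b\<in>B. (g x \<bullet> d b) * a (f x) (P h i @ b # ws)) = R h (g x # ws)"
        unfolding R_def by (intro sum.cong refl)
      then show ?thesis
        unfolding R_def sum_distrib_left by (subst sum.swap)
    qed
    moreover have "(\<Sum>b\<in>B. (frechet_derivative g (at x) h \<bullet> d b) * a (f x) (G @ b # ws)) =
        a (f x) (G @ frechet_derivative g (at x) h # ws)"
      by (rule multilinear_expand[OF B lin[OF T(2)], symmetric])
    ultimately show ?thesis by (simp only: sum.distrib distrib_left add.assoc)
  qed
  with main have "((\<lambda>y. a (f y) (map (\<lambda>g. g y) (gs @ [g]) @ ws)) has_derivative
      (\<lambda>h. D (G @ g x # ws) (f' h) + (R h (g x # ws) + a (f x) (G @ frechet_derivative g (at x) h # ws)))) (at x)"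
    by (simp only:)
  moreover have "(\<Sum>i<length (gs @ [g]). a (f x) (map (\<lambda>g. g x) (take i (gs @ [g])) @ frechet_derivative ((gs @ [g]) ! i) (at x) h #
          map (\<lambda>g. g x) (drop (Suc i) (gs @ [g])) @ ws)) = R h (g x # ws) + a (f x) (G @ frechet_derivative g (at x) h # ws)" for h
    unfolding R_def P_def G_def by (simp add: nth_append)
  moreover have "map (\<lambda>g. g x) (gs @ [g]) @ ws = G @ g x # ws"
    unfolding G_def by simp
  ultimately show ?case
    unfolding D_def by (simp only:)
qed

text \<open>The same expansion of the moving arguments in a frame, one at a time.\<close>

lemma smooth_on_multilinear:
  fixes f :: "'e::real_normed_vector \<Rightarrow> 'f::real_inner" and a :: "'f \<Rightarrow> 'f list \<Rightarrow> real"
  assumes fin: "fin_dim TYPE('f)" and S: "open S" and T: "f ` S \<subseteq> T"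
    and lin: "\<And>y. y \<in> T \<Longrightarrow> multilinear (a y)"
    and a: "\<And>us. smooth_on T (\<lambda>y. a y us)"
    and f: "smooth_on S f"
    and gs: "\<And>g. g \<in> set gs \<Longrightarrow> smooth_on S g"
  shows "smooth_on S (\<lambda>y. a (f y) (map (\<lambda>g. g y) gs @ ws))"
  using gs
proof (induction gs arbitrary: ws rule: rev_induct)
  case Nil
  show ?case using smooth_on_compose[OF fin S f a T] by simp
next
  case (snoc g gs)
  obtain B :: "'f set" and d where B: "dual_frame B d" using dual_frame_exists[OF fin] .
  have "smooth_on S (\<lambda>y. \<Sum>b\<in>B. (g y \<bullet> d b) * a (f y) (map (\<lambda>g. g y) gs @ b # ws))"
    by (intro smooth_on_sum smooth_on_mult S smooth_on_bounded_linear_compose[OF bounded_linear_inner_left] snoc.IH)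
       (use snoc.prems in auto)
  then show ?case
  proof (rule smooth_on_cong[OF S, rotated])
    fix y assume "y \<in> S"
    then show "(\<Sum>b\<in>B. (g y \<bullet> d b) * a (f y) (map (\<lambda>g. g y) gs @ b # ws)) = a (f y) (map (\<lambda>g. g y) (gs @ [g]) @ ws)"
      using multilinear_expand[OF B lin, of "f y" "map (\<lambda>g. g y) gs" "g y" ws] T by auto
  qed
qed

section \<open>Differential forms on open sets\<close>

definition local_form :: "'e::real_inner set \<Rightarrow> ('e \<Rightarrow> 'e list \<Rightarrow> real) \<Rightarrow> bool" where
  "local_form S a \<longleftrightarrow>
     (\<forall>x\<in>S. multilinear (a x) \<and> antisymmetric (a x)) \<and> (\<forall>us. smooth_on S (\<lambda>x. a x us))"

text \<open>The total derivative as a tensor: the first entry of the list is the direction. It vanishes on the empty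
  list, as there is no direction to differentiate in.\<close>

definition grad :: "('e::real_inner \<Rightarrow> 'e list \<Rightarrow> real) \<Rightarrow> 'e \<Rightarrow> 'e list \<Rightarrow> real" where
  "grad a x us = (case us of [] \<Rightarrow> 0 | v # ws \<Rightarrow> frechet_derivative (\<lambda>y. a y ws) (at x) v)"

text \<open>The exterior derivative in a single chart, with the entries of the list regarded as constant vector fields.\<close>

definition local_d :: "('e::real_inner \<Rightarrow> 'e list \<Rightarrow> real) \<Rightarrow> 'e \<Rightarrow> 'e list \<Rightarrow> real" where
  "local_d a x us = (\<Sum>i<length us. (-1) ^ i *
     frechet_derivative (\<lambda>y. a y (take i us @ drop (Suc i) us)) (at x) (us ! i))"

definition local_pull :: "('e::real_inner \<Rightarrow> 'f::real_inner) \<Rightarrow> ('f \<Rightarrow> 'f list \<Rightarrow> real) \<Rightarrow> 'e \<Rightarrow> 'e list \<Rightarrow> real" where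
  "local_pull F a x us = a (F x) (map (frechet_derivative F (at x)) us)"

lemma grad_simps [simp]:
  "grad a x [] = 0" "grad a x (v # ws) = frechet_derivative (\<lambda>y. a y ws) (at x) v"
  by (simp_all add: grad_def)

lemma local_formD:
  assumes "local_form S a"
  shows "x \<in> S \<Longrightarrow> multilinear (a x)" "x \<in> S \<Longrightarrow> antisymmetric (a x)" "smooth_on S (\<lambda>x. a x us)"
  using assms by (auto simp: local_form_def)

lemma frechet_derivative_cmult:
  fixes f :: "'e::real_normed_vector \<Rightarrow> real"
  assumes "f differentiable (at x)"
  shows "frechet_derivative (\<lambda>y. c * f y) (at x) v = c * frechet_derivative f (at x) v"
  using fun_cong[OF frechet_derivative_at[OF has_derivative_mult_right[OF has_frechet_derivative[OF assms], of c]], of v]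
  by simp

lemma frechet_derivative_add:
  assumes "f differentiable (at x)" "g differentiable (at x)"
  shows "frechet_derivative (\<lambda>y. f y + g y) (at x) v = frechet_derivative f (at x) v + frechet_derivative g (at x) v"
  using fun_cong[OF frechet_derivative_at[OF has_derivative_add[OF has_frechet_derivative[OF assms(1)]
    has_frechet_derivative[OF assms(2)]]], of v] by simp

lemma frechet_derivative_sum:
  assumes "\<And>i. i \<in> I \<Longrightarrow> f i differentiable (at x)"
  shows "frechet_derivative (\<lambda>y. \<Sum>i\<in>I. f i y) (at x) v = (\<Sum>i\<in>I. frechet_derivative (f i) (at x) v)"
proof -
  have "((\<lambda>y. \<Sum>i\<in>I. f i y) has_derivative (\<lambda>v. \<Sum>i\<in>I. frechet_derivative (f i) (at x) v)) (at x)"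
    by (rule has_derivative_sum) (rule has_frechet_derivative[OF assms])
  from fun_cong[OF frechet_derivative_at[OF this], of v] show ?thesis by simp
qed

lemma frechet_derivative_mult:
  fixes f g :: "'e::real_normed_vector \<Rightarrow> real"
  assumes "f differentiable (at x)" "g differentiable (at x)"
  shows "frechet_derivative (\<lambda>y. f y * g y) (at x) v =
    frechet_derivative f (at x) v * g x + f x * frechet_derivative g (at x) v"
  using fun_cong[OF frechet_derivative_at[OF has_derivative_mult[OF has_frechet_derivative[OF assms(1)]
    has_frechet_derivative[OF assms(2)]]], of v] by simp

text \<open>Alternation is a finite linear combination, so it commutes with differentiation.\<close>

lemma frechet_derivative_alternation:
  fixes T :: "'e::real_normed_vector \<Rightarrow> 'v list \<Rightarrow> real"
  assumes "\<And>us. (\<lambda>y. T y us) differentiable (at x)"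
  shows "frechet_derivative (\<lambda>y. alternation (T y) ws) (at x) v =
    alternation (\<lambda>us. frechet_derivative (\<lambda>y. T y us) (at x) v) ws"
proof -
  have "((\<lambda>y. alternation (T y) ws) has_derivative
     (\<lambda>v. alternation (\<lambda>us. frechet_derivative (\<lambda>y. T y us) (at x) v) ws)) (at x)"
    unfolding alternation_def
    by (rule bounded_linear.has_derivative[OF bounded_linear_divide], rule has_derivative_sum,
        rule has_derivative_mult_right, rule has_frechet_derivative[OF assms])
  from fun_cong[OF frechet_derivative_at[OF this], of v] show ?thesis by simp
qed

lemma alternation_Nil: "alternation T [] = T []"
  by (simp add: alternation_def)

lemma alternation_hd_tl_cong:
  fixes vs :: "'v list"
  assumes "T [] = S []" "\<And>v us. length us < length vs \<Longrightarrow> T (v # us) = S (v # us)"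
  shows "alternation T vs = alternation S vs"
proof (rule alternation_cong)
  fix us :: "'v list" assume "length us = length vs"
  then show "T us = S us" using assms by (cases us) auto
qed

text \<open>Differentiation commutes with the inner alternation, which runs over all arguments but the direction and is
  therefore absorbed.\<close>

lemma alternation_grad_alternation:
  fixes us :: "'e::real_inner list"
  assumes "\<And>us. (\<lambda>y. T y us) differentiable (at x)"
  shows "alternation (grad (\<lambda>y. alternation (T y)) x) us = alternation (grad T x) us"
proof (cases "us = []")
  case True
  then show ?thesis by (simp add: alternation_Nil)
next
  case False
  have "alternation (grad (\<lambda>y. alternation (T y)) x) us =
    alternation (\<lambda>vs. alternation (\<lambda>ws. grad T x (hd vs # ws)) (tl vs)) us"
  proof (rule alternation_cong)
    fix vs :: "'e list" assume "length vs = length us"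
    then obtain v ws where "vs = v # ws" using False by (cases vs) auto
    then show "grad (\<lambda>y. alternation (T y)) x vs = alternation (\<lambda>ws. grad T x (hd vs # ws)) (tl vs)"
      by (simp add: frechet_derivative_alternation[OF assms])
  qed
  then show ?thesis using alternation_tail[OF False, of "grad T x"] by simp
qed

lemma local_form_over_fact:
  assumes "open S" "local_form S a"
  shows "local_form S (\<lambda>x. over_fact (a x))"
proof -
  have "smooth_on S (\<lambda>x. over_fact (a x) us)" for us
    using smooth_on_mult[OF assms(1) smooth_on_const[of S "1 / fact (length us)"] local_formD(3)[OF assms(2)], of us]
    by (simp add: over_fact_def)
  then show ?thesis
    using assms(2) by (simp add: local_form_def multilinear_over_fact antisymmetric_over_fact)
qed

lemma local_form_differentiable:
  "local_form S a \<Longrightarrow> x \<in> S \<Longrightarrow> (\<lambda>y. a y us) differentiable (at x)"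
  by (rule smooth_on_differentiable[OF local_formD(3)])

lemma antisymmetric_grad_tail:
  assumes "open S" "x \<in> S" "local_form S a"
  shows "antisymmetric (\<lambda>ws. grad a x (v # ws))"
  unfolding antisymmetric_def grad_simps
proof (intro allI impI)
  fix \<sigma> and ws :: "'a list" assume \<sigma>: "\<sigma> permutes {..<length ws}"
  have "frechet_derivative (\<lambda>y. a y (permute_list \<sigma> ws)) (at x) =
     frechet_derivative (\<lambda>y. of_int (sign \<sigma>) * a y ws) (at x)"
    by (rule frechet_derivative_cong_open[OF assms(1,2)])
       (use local_formD(2)[OF assms(3)] \<sigma> local_form_differentiable[OF assms(3,2)] in \<open>auto simp: antisymmetric_def\<close>)
  then show "frechet_derivative (\<lambda>y. a y (permute_list \<sigma> ws)) (at x) v =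
     of_int (sign \<sigma>) * frechet_derivative (\<lambda>y. a y ws) (at x) v"
    by (simp add: frechet_derivative_cmult[OF local_form_differentiable[OF assms(3,2)]])
qed

text \<open>The alternating sum is the alternation of the gradient, since the gradient of a form is antisymmetric in all
  arguments but the first. Grouping the \<open>n!\<close> terms of the alternation leaves a factor
  \<open>1 / n\<close>, which turns the \<open>1 / (n - 1)!\<close> of the gradient into \<open>1 / n!\<close>.\<close>

lemma over_fact_local_d:
  assumes "open S" "x \<in> S" "local_form S a"
  shows "over_fact (local_d a x) = alternation (grad (\<lambda>y. over_fact (a y)) x)"
proof
  fix us :: "'a list"
  let ?A = "\<lambda>y. over_fact (a y)"
  show "over_fact (local_d a x) us = alternation (grad ?A x) us"
  proof (cases "us = []")
    case True
    then show ?thesis by (simp add: alternation_Nil over_fact_def local_d_def)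
  next
    case False
    then obtain n where n: "length us = Suc n" by (cases us) auto
    have "grad ?A x (v # ws) = frechet_derivative (\<lambda>y. a y ws) (at x) v / fact (length ws)" for v ws
      using frechet_derivative_cmult[OF local_form_differentiable[OF assms(3,2)], of "1 / fact (length ws)" ws v]
      by (simp add: over_fact_def)
    then have "(\<Sum>i<length us. (-1) ^ i * grad ?A x (us ! i # take i us @ drop (Suc i) us)) =
      (\<Sum>i<length us. (-1) ^ i * frechet_derivative (\<lambda>y. a y (take i us @ drop (Suc i) us)) (at x) (us ! i) / fact n)"
      by (intro sum.cong) (auto simp: n)
    then have "(\<Sum>i<length us. (-1) ^ i * grad ?A x (us ! i # take i us @ drop (Suc i) us)) = local_d a x us / fact n"
      by (simp add: local_d_def sum_divide_distrib)
    then have "alternation (grad ?A x) us = local_d a x us / fact n / Suc n"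
      using alternation_antisymmetric_tail[of "grad ?A x" us, OF antisymmetric_grad_tail[OF assms(1,2)
        local_form_over_fact[OF assms(1,3)]] False] n by simp
    then show ?thesis by (simp add: over_fact_def n)
  qed
qed

lemma multilinear_grad:
  assumes "open S" "x \<in> S" "local_form S a"
  shows "multilinear (grad a x)"
  unfolding multilinear_def
proof (intro allI)
  fix us ws :: "'a list"
  show "linear (\<lambda>v. grad a x (us @ v # ws))"
  proof (cases us)
    case Nil
    then show ?thesis
      using linear_frechet_derivative[OF local_form_differentiable[OF assms(3,2)], of ws] by simp
  next
    case (Cons u us')
    have lin: "linear (\<lambda>v. a y (us' @ v # ws))" if "y \<in> S" for y
      using local_formD(1)[OF assms(3) that] unfolding multilinear_def by blast
    note diff = local_form_differentiable[OF assms(3,2)]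
    show ?thesis
      unfolding Cons append_Cons grad_simps
    proof (rule linearI)
      fix v w
      have "frechet_derivative (\<lambda>y. a y (us' @ (v + w) # ws)) (at x) =
        frechet_derivative (\<lambda>y. a y (us' @ v # ws) + a y (us' @ w # ws)) (at x)"
        by (rule frechet_derivative_cong_open[OF assms(1,2) linear_add[OF lin] diff])
      then show "frechet_derivative (\<lambda>y. a y (us' @ (v + w) # ws)) (at x) u =
        frechet_derivative (\<lambda>y. a y (us' @ v # ws)) (at x) u + frechet_derivative (\<lambda>y. a y (us' @ w # ws)) (at x) u"
        by (simp add: frechet_derivative_add diff)
    next
      fix c v
      have "frechet_derivative (\<lambda>y. a y (us' @ (c *\<^sub>R v) # ws)) (at x) =
        frechet_derivative (\<lambda>y. c * a y (us' @ v # ws)) (at x)"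
        by (rule frechet_derivative_cong_open[OF assms(1,2) _ diff]) (use linear_scale[OF lin] in simp)
      then show "frechet_derivative (\<lambda>y. a y (us' @ (c *\<^sub>R v) # ws)) (at x) u =
        c *\<^sub>R frechet_derivative (\<lambda>y. a y (us' @ v # ws)) (at x) u"
        by (simp add: frechet_derivative_cmult diff)
    qed
  qed
qed

text \<open>Multilinearity comes from the gradient and antisymmetry from the alternation; smoothness is visible in the
  alternating sum.\<close>

lemma local_form_local_d:
  assumes "open S" "local_form S a"
  shows "local_form S (local_d a)"
  unfolding local_form_def
proof (intro conjI ballI allI)
  fix x assume x: "x \<in> S"
  have eq: "over_fact (local_d a x) = alternation (grad (\<lambda>y. over_fact (a y)) x)"
    by (rule over_fact_local_d[OF assms(1) x assms(2)])
  have "multilinear (over_fact (local_d a x))"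
    unfolding eq by (intro multilinear_alternation multilinear_grad[OF assms(1) x] local_form_over_fact assms)
  then show "multilinear (local_d a x)" by (simp only: multilinear_over_fact)
  have "antisymmetric (over_fact (local_d a x))"
    unfolding eq by (rule antisymmetric_alternation)
  then show "antisymmetric (local_d a x)" by (simp only: antisymmetric_over_fact)
next
  fix us
  show "smooth_on S (\<lambda>x. local_d a x us)"
    unfolding local_d_def
    by (intro smooth_on_sum smooth_on_mult smooth_on_const smooth_on_frechet_derivative
        local_formD(3)[OF assms(2)] assms(1))
qed

lemma alternation_map: "alternation (\<lambda>us. T (map g us)) vs = alternation T (map g vs)"
  unfolding alternation_def length_map
  by (intro arg_cong2[where f = "(/)"] sum.cong refl) (simp add: permute_list_map)

lemma over_fact_local_pull: "over_fact (local_pull F a x) = local_pull F (\<lambda>y. over_fact (a y)) x"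
  by (simp add: over_fact_def local_pull_def fun_eq_iff)

lemma antisymmetric_map: "antisymmetric a \<Longrightarrow> antisymmetric (\<lambda>us. a (map g us))"
  unfolding antisymmetric_def by (auto simp flip: permute_list_map)

lemma multilinear_map:
  assumes "multilinear a" "linear g"
  shows "multilinear (\<lambda>us. a (map g us))"
  unfolding multilinear_def
proof (intro allI)
  fix us ws
  have "linear (\<lambda>v. a (map g us @ v # map g ws))"
    using assms(1) unfolding multilinear_def by blast
  from linear_compose[OF assms(2) this] show "linear (\<lambda>v. a (map g (us @ v # ws)))"
    by (simp add: o_def)
qed

text \<open>The only analytic point is smoothness, where the arguments \<open>DF(x) u\<close> move with \<open>x\<close>.\<close>

lemma local_form_local_pull:
  fixes F :: "'e::real_inner \<Rightarrow> 'f::real_inner"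
  assumes fin: "fin_dim TYPE('f)" and S: "open S" and F: "smooth_on S F" "F ` S \<subseteq> T" and a: "local_form T a"
  shows "local_form S (local_pull F a)"
  unfolding local_form_def
proof (intro conjI ballI allI)
  fix x assume "x \<in> S"
  then have Fx: "F x \<in> T" "F differentiable (at x)"
    using F smooth_on_differentiable by auto
  show "multilinear (local_pull F a x)"
    unfolding local_pull_def
    by (rule multilinear_map[OF local_formD(1)[OF a Fx(1)] linear_frechet_derivative[OF Fx(2)]])
  show "antisymmetric (local_pull F a x)"
    unfolding local_pull_def by (rule antisymmetric_map[OF local_formD(2)[OF a Fx(1)]])
next
  fix us
  have "smooth_on S (\<lambda>x. a (F x) (map (\<lambda>g. g x) (map (\<lambda>u x. frechet_derivative F (at x) u) us) @ []))"
    by (rule smooth_on_multilinear[OF fin S F(2) local_formD(1)[OF a] local_formD(3)[OF a] F(1)])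
       (auto intro: smooth_on_frechet_derivative F(1))
  then show "smooth_on S (\<lambda>x. local_pull F a x us)"
    by (simp add: local_pull_def o_def)
qed

text \<open>Naturality of the exterior derivative. The gradient of the pulled back form is the pulled back gradient plus
  a sum of terms that contain a second derivative \<open>D\<^sup>2F(v, w\<^sub>i)\<close>. Each of these is symmetric under the
  exchange of \<open>v\<close> and \<open>w\<^sub>i\<close>, so its alternation vanishes.\<close>

lemma local_d_local_pull:
  fixes F :: "'e::real_inner \<Rightarrow> 'f::real_inner"
  assumes fin: "fin_dim TYPE('f)" and S: "open S" "x \<in> S" and T: "open T"
    and F: "smooth_on S F" "F ` S \<subseteq> T" and a: "local_form T a"
  shows "local_d (local_pull F a) x = local_pull F (local_d a) x"
proof (rule over_fact_inject)
  define A where "A y = over_fact (a y)" for y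
  have A: "local_form T A" unfolding A_def by (rule local_form_over_fact[OF T a])
  let ?D = "frechet_derivative F (at x)"
  have Fx: "F x \<in> T" using F(2) S(2) by auto
  have DF: "(F has_derivative ?D) (at x)"
    by (rule has_frechet_derivative[OF smooth_on_differentiable[OF F(1) S(2)]])
  \<comment> \<open>The term in which the derivative falls on the \<open>i\<close>-th argument \<open>DF(x) w\<^sub>i\<close>.\<close>
  define R where "R i us = A (F x) (map ?D (take i (tl us)) @
     frechet_derivative (\<lambda>y. frechet_derivative F (at y) (tl us ! i)) (at x) (hd us) # map ?D (drop (Suc i) (tl us)))"
    for i us
  have grad: "grad (local_pull F A) x (v # ws) =
      grad A (F x) (map ?D (v # ws)) + (\<Sum>i<length ws. R i (v # ws))" for v ws
  proof -
    let ?gs = "map (\<lambda>u y. frechet_derivative F (at y) u) ws"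
    have "((\<lambda>y. A (F y) (map (\<lambda>g. g y) ?gs @ [])) has_derivative
      (\<lambda>h. frechet_derivative (\<lambda>y. A y (map (\<lambda>g. g x) ?gs @ [])) (at (F x)) (?D h) +
      (\<Sum>i<length ?gs. A (F x) (map (\<lambda>g. g x) (take i ?gs) @ frechet_derivative (?gs ! i) (at x) h #
          map (\<lambda>g. g x) (drop (Suc i) ?gs) @ [])))) (at x)"
      by (rule has_derivative_multilinear[OF fin T Fx local_formD(1)[OF A] local_form_differentiable[OF A Fx] DF])
         (auto intro!: smooth_on_differentiable[OF smooth_on_frechet_derivative[OF F(1)] S(2)])
    from fun_cong[OF frechet_derivative_at[OF this], of v] show ?thesis
      by (simp add: local_pull_def R_def o_def take_map drop_map)
  qed
  have R: "alternation (R i) us = 0" if "Suc i < length us" for i us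
  proof -
    have "alternation (R i) us = alternation (\<lambda>us. R i (us[0 := us ! Suc i, Suc i := us ! 0])) us"
    proof (rule alternation_cong)
      fix vs :: "'e list" assume "length vs = length us"
      with that obtain v ws where vs: "vs = v # ws" "i < length ws" by (cases vs) auto
      then show "R i vs = R i (vs[0 := vs ! Suc i, Suc i := vs ! 0])"
        using symmetric_second_derivative[OF S F(1), of v "ws ! i"] by (simp add: R_def)
    qed
    also have "\<dots> = - alternation (R i) us"
      using alternation_signed_perm[OF signed_perm_swap[of 0 "length us" "Suc i"], of "R i"] that by (cases us) auto
    finally show ?thesis by simp
  qed
  have Apull: "over_fact (local_pull F a y) = local_pull F A y" for y
    unfolding A_def by (rule over_fact_local_pull)
  have "over_fact (local_d (local_pull F a) x) us = over_fact (local_pull F (local_d a) x) us" for us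
  proof -
    have "over_fact (local_d (local_pull F a) x) us = alternation (grad (local_pull F A) x) us"
      using over_fact_local_d[OF S local_form_local_pull[OF fin S(1) F a]] by (simp add: Apull)
    also have "\<dots> = alternation (\<lambda>us. grad A (F x) (map ?D us) + (\<Sum>i<length us - 1. R i us)) us"
      by (rule alternation_hd_tl_cong) (simp, simp only: grad list.size, simp)
    also have "\<dots> = alternation (\<lambda>us. grad A (F x) (map ?D us)) us + alternation (\<lambda>vs. \<Sum>i<length us - 1. R i vs) us"
      unfolding alternation_add[symmetric] by (rule alternation_cong) simp
    also have "alternation (\<lambda>vs. \<Sum>i<length us - 1. R i vs) us = 0"
      unfolding alternation_sum by (intro sum.neutral ballI R) auto
    also have "alternation (\<lambda>us. grad A (F x) (map ?D us)) us = alternation (grad A (F x)) (map ?D us)"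
      by (rule alternation_map)
    also have "\<dots> = over_fact (local_d a (F x)) (map ?D us)"
      using over_fact_local_d[OF T Fx a] by (simp add: A_def[abs_def])
    also have "\<dots> = over_fact (local_pull F (local_d a) x) us"
      by (simp add: over_fact_def local_pull_def)
    finally show ?thesis by simp
  qed
  then show "over_fact (local_d (local_pull F a) x) = over_fact (local_pull F (local_d a) x)" by blast
qed

lemma grad_cong_open:
  assumes "open S" "x \<in> S" "\<And>y us. y \<in> S \<Longrightarrow> a y us = b y us"
    and "\<And>us. (\<lambda>y. a y us) differentiable (at x)"
  shows "grad a x us = grad b x us"
proof (cases us)
  case (Cons v ws)
  have "frechet_derivative (\<lambda>y. a y ws) (at x) = frechet_derivative (\<lambda>y. b y ws) (at x)"
    by (rule frechet_derivative_cong_open[OF assms(1,2) assms(3) assms(4)])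
  then show ?thesis using Cons by simp
qed simp

lemma smooth_on_grad:
  assumes "\<And>us. smooth_on S (\<lambda>x. a x us)"
  shows "smooth_on S (\<lambda>x. grad a x us)"
  by (cases us) (auto intro: smooth_on_const smooth_on_frechet_derivative assms)

text \<open>The inner alternation is absorbed, so this is the alternation of the second derivative, which is symmetric
  in its first two arguments.\<close>

lemma local_d_local_d:
  fixes S :: "'e::real_inner set"
  assumes S: "open S" "x \<in> S" and a: "local_form S a"
  shows "local_d (local_d a) x us = 0"
proof -
  define A where "A y = over_fact (a y)" for y
  have A: "local_form S A" unfolding A_def by (rule local_form_over_fact[OF S(1) a])
  have eq: "over_fact (local_d a y) = alternation (grad A y)" if "y \<in> S" for y
    using over_fact_local_d[OF S(1) that a] by (simp add: A_def[abs_def])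
  have d: "local_form S (local_d a)" by (rule local_form_local_d[OF S(1) a])
  have diff: "(\<lambda>y. grad A y us) differentiable (at x)" for us
    by (rule smooth_on_differentiable[OF smooth_on_grad[OF local_formD(3)[OF A]] S(2)])
  have sym: "grad (grad A) x (us[0 := us ! 1, 1 := us ! 0]) = grad (grad A) x us" if "2 \<le> length us" for us
  proof -
    obtain u v ws where "us = u # v # ws" using \<open>2 \<le> length us\<close> by (cases us; cases "tl us") auto
    then show ?thesis
      using symmetric_second_derivative[OF S local_formD(3)[OF A]] by simp
  qed
  have zero: "alternation (grad (grad A) x) us = 0"
  proof (cases "2 \<le> length us")
    case True
    have "alternation (grad (grad A) x) us = alternation (\<lambda>us. grad (grad A) x (us[0 := us ! 1, 1 := us ! 0])) us"
      by (rule alternation_cong) (use True sym in simp)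
    also have "\<dots> = - alternation (grad (grad A) x) us"
      using alternation_signed_perm[OF signed_perm_swap[of 0 "length us" 1], of "grad (grad A) x"] True
      by (cases us; cases "tl us") auto
    finally show ?thesis by simp
  next
    case False
    have "alternation (grad (grad A) x) us = alternation (\<lambda>_. 0) us"
    proof (rule alternation_cong)
      fix vs :: "'e list" assume "length vs = length us"
      with False have "vs = [] \<or> (\<exists>v. vs = [v])" by (cases vs; cases "tl vs") auto
      then show "grad (grad A) x vs = 0" by auto
    qed
    then show ?thesis by (simp add: alternation_zero)
  qed
  have "over_fact (local_d (local_d a) x) us = alternation (grad (\<lambda>y. over_fact (local_d a y)) x) us"
    by (simp add: over_fact_local_d[OF S d])
  also have "\<dots> = alternation (grad (\<lambda>y. alternation (grad A y)) x) us"
    by (rule alternation_cong, rule grad_cong_open[OF S])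
       (simp add: eq, rule local_form_differentiable[OF local_form_over_fact[OF S(1) d] S(2)])
  also have "\<dots> = alternation (grad (grad A) x) us"
    by (rule alternation_grad_alternation[OF diff])
  finally show ?thesis using zero by (simp add: over_fact_def)
qed

lemma local_form_ext_prod:
  assumes "open S" "local_form S a" "local_form S b"
  shows "local_form S (\<lambda>x. ext_prod (a x) (b x))"
  unfolding local_form_def
proof (intro conjI ballI allI)
  fix us
  have *: "ext_prod (a x) (b x) us = (\<Sum>k\<le>length us. 1 / (fact k * fact (length us - k)) *
     (\<Sum>\<sigma> | \<sigma> permutes {..<length us}. of_int (sign \<sigma>) *
        (a x (take k (permute_list \<sigma> us)) * b x (drop k (permute_list \<sigma> us)))))" for x
    by (simp add: ext_prod_def mult.assoc)
  show "smooth_on S (\<lambda>x. ext_prod (a x) (b x) us)"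
    unfolding *
    by (intro smooth_on_sum smooth_on_mult smooth_on_const local_formD(3)[OF assms(2)] local_formD(3)[OF assms(3)] assms(1))
qed (auto intro: multilinear_ext_prod antisymmetric_ext_prod local_formD[OF assms(2)] local_formD[OF assms(3)])

text \<open>Again the inner alternation is absorbed, and the product rule applies to the gradient of the tensor product.
  In the terms where \<open>b\<close> is differentiated, the direction is the first argument but belongs after the \<open>k\<close>
  arguments of \<open>a\<close>; moving it there costs \<open>(-1)\<^sup>k\<close>.\<close>

lemma local_d_ext_prod:
  fixes S :: "'e::real_inner set"
  assumes S: "open S" "x \<in> S" and a: "local_form S a" and b: "local_form S b"
    and hom: "\<And>y. y \<in> S \<Longrightarrow> homogeneous k (a y)"
  shows "local_d (\<lambda>y. ext_prod (a y) (b y)) x us =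
    ext_prod (local_d a x) (b x) us + (-1) ^ k * ext_prod (a x) (local_d b x) us"
proof -
  define A where "A y = over_fact (a y)" for y
  define B where "B y = over_fact (b y)" for y
  have A: "local_form S A" unfolding A_def by (rule local_form_over_fact[OF S(1) a])
  have B: "local_form S B" unfolding B_def by (rule local_form_over_fact[OF S(1) b])
  note diffA = local_form_differentiable[OF A S(2)] and diffB = local_form_differentiable[OF B S(2)]
  have homA: "homogeneous k (A x)"
    unfolding A_def using hom[OF S(2)] by (simp only: homogeneous_over_fact)
  \<comment> \<open>The part of the gradient of the tensor product in which the second factor is differentiated.\<close>
  define E where "E us = (if us = [] then 0 else
    \<Sum>j\<le>length (tl us). A x (take j (tl us)) * grad B x (hd us # drop j (tl us)))" for us
  have gradconc: "grad (\<lambda>y. conc (A y) (B y)) x (v # ws) = conc (grad A x) (B x) (v # ws) + E (v # ws)" for v ws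
  proof -
    have "frechet_derivative (\<lambda>y. conc (A y) (B y) ws) (at x) v =
      (\<Sum>j\<le>length ws. frechet_derivative (\<lambda>y. A y (take j ws) * B y (drop j ws)) (at x) v)"
      unfolding conc_def by (rule frechet_derivative_sum) (intro differentiable_mult diffA diffB)
    also have "\<dots> = (\<Sum>j\<le>length ws. frechet_derivative (\<lambda>y. A y (take j ws)) (at x) v * B x (drop j ws) +
         A x (take j ws) * frechet_derivative (\<lambda>y. B y (drop j ws)) (at x) v)"
      by (simp only: frechet_derivative_mult[OF diffA diffB])
    finally show ?thesis
      by (simp add: conc_Cons E_def sum.distrib) (simp add: conc_def)
  qed
  have conc_diff: "(\<lambda>y. conc (A y) (B y) us) differentiable (at x)" for us
    unfolding conc_def by (rule differentiable_sum) (auto intro!: differentiable_mult diffA diffB)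
  have E: "E (v # ws) = (if k \<le> length ws then A x (take k ws) * grad B x (v # drop k ws) else 0)" for v ws
    using conc_homogeneous[OF homA, of "\<lambda>zs. grad B x (v # zs)" ws] by (simp add: E_def conc_def)
  have altE: "alternation (conc (A x) (grad B x)) us = (-1) ^ k * alternation E us"
  proof (cases "k < length us")
    case True
    have "alternation (conc (A x) (grad B x)) us = alternation (\<lambda>vs. E (vs ! k # take k vs @ drop (Suc k) vs)) us"
    proof (rule alternation_cong)
      fix vs :: "'e list" assume "length vs = length us"
      then show "conc (A x) (grad B x) vs = E (vs ! k # take k vs @ drop (Suc k) vs)"
        using True by (simp add: E conc_homogeneous[OF homA] Cons_nth_drop_Suc[symmetric])
    qed
    also have "\<dots> = of_int ((-1) ^ k) * alternation E us"
      by (rule alternation_signed_perm[OF signed_perm_to_front[OF True]])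
    finally show ?thesis by simp
  next
    case False
    have "alternation (conc (A x) (grad B x)) us = alternation (\<lambda>_. 0) us"
      by (rule alternation_cong) (use False in \<open>auto simp: conc_homogeneous[OF homA]\<close>)
    moreover have "alternation E us = alternation (\<lambda>_. 0) us"
      by (rule alternation_hd_tl_cong) (use False homA in \<open>auto simp: E, simp add: E_def\<close>)
    ultimately show ?thesis by (simp add: alternation_zero)
  qed
  have eqA: "over_fact (local_d a x) = alternation (grad A x)"
    using over_fact_local_d[OF S a] by (simp add: A_def[abs_def])
  have eqB: "over_fact (local_d b x) = alternation (grad B x)"
    using over_fact_local_d[OF S b] by (simp add: B_def[abs_def])
  have "over_fact (local_d (\<lambda>y. ext_prod (a y) (b y)) x) us =
     alternation (grad (\<lambda>y. alternation (conc (A y) (B y))) x) us"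
    using over_fact_local_d[OF S local_form_ext_prod[OF S(1) a b]]
    by (simp add: over_fact_ext_prod A_def[abs_def] B_def[abs_def])
  also have "\<dots> = alternation (grad (\<lambda>y. conc (A y) (B y)) x) us"
    by (rule alternation_grad_alternation[OF conc_diff])
  also have "\<dots> = alternation (\<lambda>us. conc (grad A x) (B x) us + E us) us"
    by (rule alternation_hd_tl_cong) (simp add: conc_Nil E_def, simp only: gradconc)
  also have "\<dots> = alternation (conc (grad A x) (B x)) us + alternation E us"
    by (rule alternation_add)
  also have "alternation E us = (-1) ^ k * alternation (conc (A x) (grad B x)) us"
    unfolding altE by (simp flip: mult.assoc power_add)
  also have "alternation (conc (grad A x) (B x)) us = over_fact (ext_prod (local_d a x) (b x)) us"
    unfolding over_fact_ext_prod eqA by (simp only: alternation_conc_alternation_left B_def)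
  also have "alternation (conc (A x) (grad B x)) us = over_fact (ext_prod (a x) (local_d b x)) us"
    unfolding over_fact_ext_prod eqB by (simp only: alternation_conc_alternation_right A_def)
  finally show ?thesis by (simp add: over_fact_def field_simps)
qed

lemma local_form_zero: "local_form S (\<lambda>x us. 0)"
  by (simp add: local_form_def multilinear_def antisymmetric_def smooth_on_const linear_iff)

lemma local_form_add:
  assumes "open S" "local_form S a" "local_form S b"
  shows "local_form S (\<lambda>x us. a x us + b x us)"
  unfolding local_form_def
proof (intro conjI ballI allI)
  fix x assume "x \<in> S"
  then show "multilinear (\<lambda>us. a x us + b x us)" "antisymmetric (\<lambda>us. a x us + b x us)"
    using local_formD(1,2)[OF assms(2)] local_formD(1,2)[OF assms(3)]
    by (simp_all add: multilinear_def antisymmetric_def linear_compose_add distrib_left)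
qed (intro smooth_on_add local_formD(3)[OF assms(2)] local_formD(3)[OF assms(3)] assms(1))

lemma local_form_cmult:
  assumes "open S" "local_form S a"
  shows "local_form S (\<lambda>x us. r * a x us)"
  unfolding local_form_def
proof (intro conjI ballI allI)
  fix x assume x: "x \<in> S"
  show "multilinear (\<lambda>us. r * a x us)"
    using local_formD(1)[OF assms(2) x] unfolding multilinear_def by (intro allI linear_const_mult) blast
  show "antisymmetric (\<lambda>us. r * a x us)"
    using local_formD(2)[OF assms(2) x] unfolding antisymmetric_def by simp
qed (intro smooth_on_mult smooth_on_const local_formD(3)[OF assms(2)] assms(1))

lemma antisymmetric_ext_unit: "antisymmetric ext_unit"
  unfolding antisymmetric_def
proof (intro allI impI)
  fix \<sigma> and vs :: "'a list" assume \<sigma>: "\<sigma> permutes {..<length vs}"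
  have "permute_list \<sigma> vs = [] \<longleftrightarrow> vs = []"
    using length_permute_list[of \<sigma> vs] by (metis length_0_conv)
  then show "ext_unit (permute_list \<sigma> vs) = of_int (sign \<sigma>) * ext_unit vs"
    using \<sigma> by (cases "vs = []") (simp_all add: ext_unit_def)
qed

lemma local_form_unit: "local_form S (\<lambda>x. ext_unit)"
  by (simp add: local_form_def multilinear_def antisymmetric_ext_unit smooth_on_const linear_iff)
     (simp add: ext_unit_def)

lemma local_d_cong_open:
  assumes "open S" "x \<in> S" "local_form S a" "\<And>y us. y \<in> S \<Longrightarrow> a y us = b y us"
  shows "local_d a x = local_d b x"
proof
  fix us
  have "frechet_derivative (\<lambda>y. a y ws) (at x) = frechet_derivative (\<lambda>y. b y ws) (at x)" for ws
    by (rule frechet_derivative_cong_open[OF assms(1,2,4) local_form_differentiable[OF assms(3,2)]])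
  then show "local_d a x us = local_d b x us" by (simp only: local_d_def)
qed

lemma local_form_subset: "local_form S a \<Longrightarrow> T \<subseteq> S \<Longrightarrow> local_form T a"
  unfolding local_form_def using smooth_on_subset by blast

section \<open>Charts and tangent spaces\<close>

lemma charts_atI: "c \<in> atlas M \<Longrightarrow> p \<in> fst c \<Longrightarrow> c \<in> charts_at M p"
  by (simp add: charts_at_def)

lemma charts_atD: "c \<in> charts_at M p \<Longrightarrow> c \<in> atlas M" "c \<in> charts_at M p \<Longrightarrow> p \<in> fst c"
  by (simp_all add: charts_at_def)

lemma smooth_manifold_fin_dim:
  "smooth_manifold (M :: ('a, 'e::real_inner) manifold) \<Longrightarrow> fin_dim TYPE('e)"
  by (simp add: smooth_manifold_def fin_dim_def)

lemma atlas_open: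
  assumes "smooth_manifold M" "c \<in> atlas M"
  shows "openin (mtop M) (fst c)" "open (snd c ` fst c)" "fst c \<subseteq> topspace (mtop M)"
    "homeomorphic_map (subtopology (mtop M) (fst c)) (top_of_set (snd c ` fst c)) (snd c)"
  using assms openin_subset[of "mtop M" "fst c"] by (auto simp: smooth_manifold_def)

lemma atlas_transition:
  assumes "smooth_manifold M" "c \<in> atlas M" "d \<in> atlas M"
  shows "smooth_on (snd c ` (fst c \<inter> fst d)) (snd d \<circ> chart_inv c)"
  using assms unfolding smooth_manifold_def by blast

lemma chart_at_in_charts_at:
  assumes "smooth_manifold M" "p \<in> topspace (mtop M)"
  shows "chart_at M p \<in> charts_at M p"
proof -
  have "p \<in> (\<Union>c\<in>atlas M. fst c)"
    using assms by (simp add: smooth_manifold_def)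
  then have "\<exists>c. c \<in> charts_at M p" by (auto simp: charts_at_def)
  then show ?thesis unfolding chart_at_def by (rule someI_ex)
qed

lemma charts_at_topspace:
  "smooth_manifold M \<Longrightarrow> c \<in> charts_at M p \<Longrightarrow> p \<in> topspace (mtop M)"
  using atlas_open(3)[of M c] by (auto simp: charts_at_def)

lemma chart_inj:
  assumes "smooth_manifold M" "c \<in> atlas M"
  shows "inj_on (snd c) (fst c)"
proof -
  have "topspace (subtopology (mtop M) (fst c)) = fst c"
    using atlas_open(3)[OF assms] by auto
  with homeomorphic_imp_injective_map[OF atlas_open(4)[OF assms]] show ?thesis by simp
qed

lemma chart_inv_left:
  "smooth_manifold M \<Longrightarrow> c \<in> atlas M \<Longrightarrow> p \<in> fst c \<Longrightarrow> chart_inv c (snd c p) = p"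
  by (rule inv_into_f_f[OF chart_inj])

lemma chart_inv_right: "x \<in> snd c ` fst c \<Longrightarrow> snd c (chart_inv c x) = x"
  by (rule f_inv_into_f)

lemma chart_inv_in: "x \<in> snd c ` fst c \<Longrightarrow> chart_inv c x \<in> fst c"
  by (rule inv_into_into)

lemma chart_image_open:
  assumes "smooth_manifold M" "c \<in> atlas M" "openin (mtop M) U"
  shows "open (snd c ` (fst c \<inter> U))"
proof -
  have "openin (subtopology (mtop M) (fst c)) (fst c \<inter> U)"
    using assms(3) by (rule openin_subtopology_Int2)
  then have "openin (top_of_set (snd c ` fst c)) (snd c ` (fst c \<inter> U))"
    using homeomorphic_imp_open_map[OF atlas_open(4)[OF assms(1,2)]] unfolding open_map_def by blast
  then show ?thesis
    by (rule openin_open_trans[OF _ atlas_open(2)[OF assms(1,2)]])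
qed

lemma preimage_image_open:
  assumes "smooth_manifold M" "c \<in> atlas M" "continuous_map (mtop M) T f" "openin T U"
  shows "open (snd c ` (fst c \<inter> f -` U))"
proof -
  have "openin (mtop M) {p \<in> topspace (mtop M). f p \<in> U}"
    using assms(3,4) by (rule openin_continuous_map_preimage)
  moreover have "fst c \<inter> {p \<in> topspace (mtop M). f p \<in> U} = fst c \<inter> f -` U"
    using atlas_open(3)[OF assms(1,2)] by auto
  ultimately show ?thesis
    using chart_image_open[OF assms(1,2), of "{p \<in> topspace (mtop M). f p \<in> U}"] by simp
qed

lemma smooth_mapD:
  assumes "smooth_map M N f"
  shows "continuous_map (mtop M) (mtop N) f"
    "c \<in> atlas M \<Longrightarrow> d \<in> atlas N \<Longrightarrow> smooth_on (snd c ` (fst c \<inter> f -` fst d)) (snd d \<circ> f \<circ> chart_inv c)"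
  using assms unfolding smooth_map_def by blast+

lemma smooth_map_topspace: "smooth_map M N f \<Longrightarrow> p \<in> topspace (mtop M) \<Longrightarrow> f p \<in> topspace (mtop N)"
  using continuous_map_image_subset_topspace[OF smooth_mapD(1), of M N f] by auto

lemma smooth_map_id: "smooth_manifold M \<Longrightarrow> smooth_map M M id"
  unfolding smooth_map_def using atlas_transition[of M] by auto

lemma coordinate_map_differentiable:
  assumes "smooth_map M N f" "c \<in> charts_at M p" "d \<in> charts_at N (f p)"
  shows "(snd d \<circ> f \<circ> chart_inv c) differentiable (at (snd c p))"
  by (rule smooth_on_differentiable[OF smooth_mapD(2)[OF assms(1), of c d]])
     (use assms in \<open>auto simp: charts_at_def\<close>)

text \<open>The chain rule for coordinate expressions. With identity maps in the place of \<open>f\<close> or \<open>g\<close> it also covers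
  changes of charts, so it is the only computation behind all facts about tangent maps below.\<close>

lemma coordinate_map_chain:
  assumes M: "smooth_manifold M" and N: "smooth_manifold N" and f: "smooth_map M N f" and g: "smooth_map N P g"
    and c: "c \<in> charts_at M p" and d: "d \<in> charts_at N (f p)" and e: "e \<in> charts_at P (g (f p))"
  shows "frechet_derivative (snd e \<circ> g \<circ> chart_inv d) (at (snd d (f p)))
      (frechet_derivative (snd d \<circ> f \<circ> chart_inv c) (at (snd c p)) v) =
    frechet_derivative (snd e \<circ> (g \<circ> f) \<circ> chart_inv c) (at (snd c p)) v"
proof -
  let ?F = "snd d \<circ> f \<circ> chart_inv c" and ?G = "snd e \<circ> g \<circ> chart_inv d"
  let ?S = "snd c ` (fst c \<inter> f -` fst d)"
  have inv: "chart_inv c (snd c p) = p" by (rule chart_inv_left[OF M charts_atD[OF c]])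
  then have Fp: "?F (snd c p) = snd d (f p)" by simp
  have F: "?F differentiable (at (snd c p))" by (rule coordinate_map_differentiable[OF f c d])
  have G: "?G differentiable (at (?F (snd c p)))"
    unfolding Fp by (rule coordinate_map_differentiable[OF g d e])
  have eq: "frechet_derivative (?G \<circ> ?F) (at (snd c p)) = frechet_derivative (snd e \<circ> (g \<circ> f) \<circ> chart_inv c) (at (snd c p))"
  proof (rule frechet_derivative_cong_open)
    show "open ?S"
      by (rule preimage_image_open[OF M charts_atD(1)[OF c] smooth_mapD(1)[OF f]
          atlas_open(1)[OF N charts_atD(1)[OF d]]])
    show "snd c p \<in> ?S" using charts_atD(2)[OF c] charts_atD(2)[OF d] by auto
    show "(?G \<circ> ?F) differentiable (at (snd c p))" by (rule differentiable_chain_at[OF F G])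
    fix y assume "y \<in> ?S"
    then obtain q where "q \<in> fst c" "f q \<in> fst d" "y = snd c q" by auto
    then show "(?G \<circ> ?F) y = (snd e \<circ> (g \<circ> f) \<circ> chart_inv c) y"
      using chart_inv_left[OF M charts_atD(1)[OF c]] chart_inv_left[OF N charts_atD(1)[OF d]] by simp
  qed
  have "frechet_derivative (?G \<circ> ?F) (at (snd c p)) =
      frechet_derivative ?G (at (snd d (f p))) \<circ> frechet_derivative ?F (at (snd c p))"
    using frechet_derivative_compose[OF F G] by (simp only: Fp)
  from fun_cong[OF trans[OF this[symmetric] eq], of v] show ?thesis by (rule trans[OF o_apply[symmetric]])
qed

lemma smooth_map_compose:
  assumes M: "smooth_manifold M" and N: "smooth_manifold N" and P: "smooth_manifold P"
    and f: "smooth_map M N f" and g: "smooth_map N P g"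
  shows "smooth_map M P (g \<circ> f)"
  unfolding smooth_map_def
proof (intro conjI ballI)
  show "continuous_map (mtop M) (mtop P) (g \<circ> f)"
    by (rule continuous_map_compose[OF smooth_mapD(1)[OF f] smooth_mapD(1)[OF g]])
next
  fix c e assume c: "c \<in> atlas M" and e: "e \<in> atlas P"
  show "smooth_on (snd c ` (fst c \<inter> (g \<circ> f) -` fst e)) (snd e \<circ> (g \<circ> f) \<circ> chart_inv c)"
  proof (rule smooth_on_local)
    fix x assume "x \<in> snd c ` (fst c \<inter> (g \<circ> f) -` fst e)"
    then obtain p where p: "p \<in> fst c" "g (f p) \<in> fst e" "x = snd c p" by auto
    have "f p \<in> topspace (mtop N)"
      using smooth_map_topspace[OF f] atlas_open(3)[OF M c] p by blast
    define d where "d = chart_at N (f p)"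
    have d: "d \<in> atlas N" "f p \<in> fst d"
      using chart_at_in_charts_at[OF N \<open>f p \<in> _\<close>] unfolding d_def by (simp_all add: charts_at_def)
    \<comment> \<open>Where \<open>f\<close> lands in the chart \<open>d\<close> and \<open>g \<circ> f\<close> in \<open>e\<close>, the coordinate expression factors through \<open>d\<close>.\<close>
    let ?U = "fst d \<inter> {q \<in> topspace (mtop N). g q \<in> fst e}"
    let ?S = "snd c ` (fst c \<inter> f -` ?U)"
    let ?F = "snd d \<circ> f \<circ> chart_inv c" and ?G = "snd e \<circ> g \<circ> chart_inv d"
    have "openin (mtop N) {q \<in> topspace (mtop N). g q \<in> fst e}"
      by (rule openin_continuous_map_preimage[OF smooth_mapD(1)[OF g] atlas_open(1)[OF P e]])
    then have S: "open ?S"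
      by (intro preimage_image_open[OF M c smooth_mapD(1)[OF f]] openin_Int atlas_open(1)[OF N d(1)])
    have F: "smooth_on ?S ?F"
      by (rule smooth_on_subset[OF smooth_mapD(2)[OF f c d(1)]]) auto
    have inS: "\<exists>q. q \<in> fst c \<and> f q \<in> fst d \<and> g (f q) \<in> fst e \<and> y = snd c q \<and> chart_inv c y = q" if "y \<in> ?S" for y
      using that chart_inv_left[OF M c] by auto
    have "?F ` ?S \<subseteq> snd d ` (fst d \<inter> g -` fst e)"
    proof (rule image_subsetI)
      fix y assume "y \<in> ?S"
      from inS[OF this] show "?F y \<in> snd d ` (fst d \<inter> g -` fst e)" by auto
    qed
    then have "smooth_on ?S (\<lambda>y. ?G (?F y))"
      by (rule smooth_on_compose[OF smooth_manifold_fin_dim[OF N] S F smooth_mapD(2)[OF g d(1) e]])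
    moreover have "?G (?F y) = (snd e \<circ> (g \<circ> f) \<circ> chart_inv c) y" if "y \<in> ?S" for y
      using inS[OF that] chart_inv_left[OF N d(1)] by auto
    ultimately have "smooth_on ?S (snd e \<circ> (g \<circ> f) \<circ> chart_inv c)"
      by (rule smooth_on_cong[OF S, rotated])
    moreover have "x \<in> ?S" using p d \<open>f p \<in> topspace (mtop N)\<close> by auto
    ultimately show "\<exists>T. open T \<and> x \<in> T \<and> smooth_on T (snd e \<circ> (g \<circ> f) \<circ> chart_inv c)" using S by blast
  qed
qed

abbreviation coord_deriv ::
    "('a, 'e::real_inner) chart \<Rightarrow> ('b, 'f::real_inner) chart \<Rightarrow> ('a \<Rightarrow> 'b) \<Rightarrow> 'a \<Rightarrow> 'e \<Rightarrow> 'f" where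
  "coord_deriv c d f p \<equiv> frechet_derivative (snd d \<circ> f \<circ> chart_inv c) (at (snd c p))"

lemma coord_deriv_linear:
  "smooth_map M N f \<Longrightarrow> c \<in> charts_at M p \<Longrightarrow> d \<in> charts_at N (f p) \<Longrightarrow> linear (coord_deriv c d f p)"
  by (rule linear_frechet_derivative[OF coordinate_map_differentiable])

lemma coord_tvec_apply:
  "d \<in> charts_at M p \<Longrightarrow> coord_tvec M p c e d = coord_deriv c d id p e"
  by (simp add: coord_tvec_def)

lemma coord_tvec_outside: "d \<notin> charts_at M p \<Longrightarrow> coord_tvec M p c e d = 0"
  by (simp add: coord_tvec_def)

lemma coord_deriv_transition:
  assumes M: "smooth_manifold M" and "b \<in> charts_at M p" "c \<in> charts_at M p" "d \<in> charts_at M p"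
  shows "coord_deriv c d id p (coord_deriv b c id p v) = coord_deriv b d id p v"
  using coordinate_map_chain[OF M M smooth_map_id[OF M] smooth_map_id[OF M], of b p c d v] assms by simp

lemma coord_tvec_in_tangent_space:
  assumes M: "smooth_manifold M" and c: "c \<in> charts_at M p"
  shows "coord_tvec M p c e \<in> tangent_space M p"
  unfolding tangent_space_def mem_Collect_eq
proof (intro conjI allI impI ballI)
  fix d d' assume "d \<in> charts_at M p" "d' \<in> charts_at M p"
  then show "coord_tvec M p c e d' = frechet_derivative (snd d' \<circ> chart_inv d) (at (snd d p)) (coord_tvec M p c e d)"
    using coord_deriv_transition[OF M c, of d d' e] by (simp add: coord_tvec_apply)
qed (rule coord_tvec_outside)

text \<open>A tangent vector is determined by its coordinates in any one chart.\<close>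

lemma coord_tvec_coord:
  assumes "v \<in> tangent_space M p" "c \<in> charts_at M p"
  shows "coord_tvec M p c (v c) = v"
proof
  fix d
  show "coord_tvec M p c (v c) d = v d"
  proof (cases "d \<in> charts_at M p")
    case True
    then have "v d = frechet_derivative (snd d \<circ> chart_inv c) (at (snd c p)) (v c)"
      using assms unfolding tangent_space_def by blast
    then show ?thesis using True by (simp only: coord_tvec_def if_True)
  next
    case False
    then have "v d = 0" using assms(1) unfolding tangent_space_def by blast
    then show ?thesis using coord_tvec_outside[OF False, of c "v c"] by simp
  qed
qed

lemma coord_tvec_change:
  assumes M: "smooth_manifold M" and c: "c \<in> charts_at M p" and d: "d \<in> charts_at M p"
  shows "coord_tvec M p d (coord_deriv c d id p e) = coord_tvec M p c e"
  using coord_tvec_coord[OF coord_tvec_in_tangent_space[OF M c] d, of e] by (simp only: coord_tvec_apply[OF d])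

lemma coord_tvec_linear:
  assumes M: "smooth_manifold M" and c: "c \<in> charts_at M p"
  shows "coord_tvec M p c (a *\<^sub>R v + b *\<^sub>R w) = (\<lambda>d. a *\<^sub>R coord_tvec M p c v d + b *\<^sub>R coord_tvec M p c w d)"
proof
  fix d
  show "coord_tvec M p c (a *\<^sub>R v + b *\<^sub>R w) d = a *\<^sub>R coord_tvec M p c v d + b *\<^sub>R coord_tvec M p c w d"
  proof (cases "d \<in> charts_at M p")
    case True
    have "linear (coord_deriv c d id p)"
      using coord_deriv_linear[OF smooth_map_id[OF M] c] True by simp
    then show ?thesis by (simp only: coord_tvec_apply[OF True] linear_add linear_scale)
  qed (simp add: coord_tvec_outside)
qed

text \<open>The tangent map is defined through a chosen chart; this computes it in arbitrary charts of source and
  target.\<close>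

lemma tangent_map_coord_tvec:
  assumes M: "smooth_manifold M" and N: "smooth_manifold N" and f: "smooth_map M N f"
    and c: "c \<in> charts_at M p" and d: "d \<in> charts_at N (f p)"
  shows "tangent_map M N f p (coord_tvec M p c e) = coord_tvec N (f p) d (coord_deriv c d f p e)"
proof
  fix d'
  define b where "b = chart_at M p"
  have b: "b \<in> charts_at M p"
    unfolding b_def by (rule chart_at_in_charts_at[OF M charts_at_topspace[OF M c]])
  show "tangent_map M N f p (coord_tvec M p c e) d' = coord_tvec N (f p) d (coord_deriv c d f p e) d'"
  proof (cases "d' \<in> charts_at N (f p)")
    case True
    have "tangent_map M N f p (coord_tvec M p c e) d' = coord_deriv b d' f p (coord_deriv c b id p e)"
      using True by (simp add: tangent_map_def b_def[symmetric] coord_tvec_apply[OF b] Let_def)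
    also have "\<dots> = coord_deriv c d' f p e"
      using coordinate_map_chain[OF M M smooth_map_id[OF M] f c, of b d' e] b True by simp
    also have "\<dots> = coord_deriv d d' id (f p) (coord_deriv c d f p e)"
      using coordinate_map_chain[OF M N f smooth_map_id[OF N] c d, of d' e] True by simp
    finally show ?thesis by (simp only: coord_tvec_apply[OF True])
  qed (simp add: tangent_map_def coord_tvec_outside)
qed

lemma tangent_map_in_tangent_space:
  assumes M: "smooth_manifold M" and N: "smooth_manifold N" and f: "smooth_map M N f"
    and p: "p \<in> topspace (mtop M)" and v: "v \<in> tangent_space M p"
  shows "tangent_map M N f p v \<in> tangent_space N (f p)"
proof -
  have c: "chart_at M p \<in> charts_at M p" by (rule chart_at_in_charts_at[OF M p])
  have d: "chart_at N (f p) \<in> charts_at N (f p)"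
    by (rule chart_at_in_charts_at[OF N smooth_map_topspace[OF f p]])
  show ?thesis
    using tangent_map_coord_tvec[OF M N f c d, of "v (chart_at M p)"] coord_tvec_in_tangent_space[OF N d]
    unfolding coord_tvec_coord[OF v c] by simp
qed

lemma tangent_map_compose:
  assumes M: "smooth_manifold M" and N: "smooth_manifold N" and P: "smooth_manifold P"
    and f: "smooth_map M N f" and g: "smooth_map N P g"
    and p: "p \<in> topspace (mtop M)" and v: "v \<in> tangent_space M p"
  shows "tangent_map N P g (f p) (tangent_map M N f p v) = tangent_map M P (g \<circ> f) p v"
proof -
  define c where "c = chart_at M p"
  define d where "d = chart_at N (f p)"
  define e where "e = chart_at P (g (f p))"
  have fp: "f p \<in> topspace (mtop N)" by (rule smooth_map_topspace[OF f p])
  have c: "c \<in> charts_at M p" unfolding c_def by (rule chart_at_in_charts_at[OF M p])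
  have d: "d \<in> charts_at N (f p)" unfolding d_def by (rule chart_at_in_charts_at[OF N fp])
  have e: "e \<in> charts_at P (g (f p))"
    unfolding e_def by (rule chart_at_in_charts_at[OF P smooth_map_topspace[OF g fp]])
  have e': "e \<in> charts_at P ((g \<circ> f) p)" using e by simp
  have v': "v = coord_tvec M p c (v c)" by (rule coord_tvec_coord[OF v c, symmetric])
  have "tangent_map N P g (f p) (tangent_map M N f p (coord_tvec M p c (v c))) =
     coord_tvec P (g (f p)) e (coord_deriv d e g (f p) (coord_deriv c d f p (v c)))"
    by (simp only: tangent_map_coord_tvec[OF M N f c d] tangent_map_coord_tvec[OF N P g d e])
  also have "\<dots> = tangent_map M P (g \<circ> f) p (coord_tvec M p c (v c))"
    using tangent_map_coord_tvec[OF M P smooth_map_compose[OF M N P f g] c e', of "v c"]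
    by (simp only: coordinate_map_chain[OF M N f g c d e] comp_apply[of g f p])
  finally show ?thesis using v' by simp
qed


section \<open>Forms as compatible families of local forms\<close>

text \<open>An inhomogeneous form, described by its coordinate representations. Unlike the carrier of the de Rham algebra
  it may have components in infinitely many degrees, and all degrees are treated at once.\<close>

definition smooth_form :: "('a, 'e::real_inner) manifold \<Rightarrow> ('a, 'e) form \<Rightarrow> bool" where
  "smooth_form M \<omega> \<longleftrightarrow>
     (\<forall>p vs. \<omega> p vs \<noteq> 0 \<longrightarrow> p \<in> topspace (mtop M) \<and> set vs \<subseteq> tangent_space M p) \<and>
     (\<forall>c\<in>atlas M. local_form (snd c ` fst c) (local_rep M c \<omega>))"

lemma smooth_formD:
  assumes "smooth_form M \<omega>"
  shows "\<omega> p vs \<noteq> 0 \<Longrightarrow> p \<in> topspace (mtop M) \<and> set vs \<subseteq> tangent_space M p"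
    "c \<in> atlas M \<Longrightarrow> local_form (snd c ` fst c) (local_rep M c \<omega>)"
  using assms unfolding smooth_form_def by blast+

lemma form_eq_local_rep:
  assumes M: "smooth_manifold M" and c: "c \<in> charts_at M p" and vs: "set vs \<subseteq> tangent_space M p"
  shows "\<omega> p vs = local_rep M c \<omega> (snd c p) (map (\<lambda>v. v c) vs)"
proof -
  have "map (\<lambda>v. coord_tvec M p c (v c)) vs = vs"
    using vs coord_tvec_coord[OF _ c] by (intro map_idI) auto
  then show ?thesis
    using chart_inv_left[OF M charts_atD[OF c]] by (simp add: local_rep_def o_def)
qed

text \<open>A form is determined by its coordinate representations, because every tangent vector is a coordinate vector
  in every chart around its base point. Identities between forms are thereby reduced to open sets.\<close>

lemma form_eqI:
  assumes M: "smooth_manifold M"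
    and "\<And>p vs. \<alpha> p vs \<noteq> 0 \<Longrightarrow> p \<in> topspace (mtop M) \<and> set vs \<subseteq> tangent_space M p"
    and "\<And>p vs. \<beta> p vs \<noteq> 0 \<Longrightarrow> p \<in> topspace (mtop M) \<and> set vs \<subseteq> tangent_space M p"
    and eq: "\<And>c x us. c \<in> atlas M \<Longrightarrow> x \<in> snd c ` fst c \<Longrightarrow> local_rep M c \<alpha> x us = local_rep M c \<beta> x us"
  shows "\<alpha> = \<beta>"
proof (intro ext)
  fix p vs
  show "\<alpha> p vs = \<beta> p vs"
  proof (cases "p \<in> topspace (mtop M) \<and> set vs \<subseteq> tangent_space M p")
    case True
    then have c: "chart_at M p \<in> charts_at M p" using chart_at_in_charts_at[OF M] by blast
    show ?thesis
      using True charts_atD[OF c] eq[of "chart_at M p" "snd (chart_at M p) p"]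
      by (simp add: form_eq_local_rep[OF M c, of vs \<alpha>] form_eq_local_rep[OF M c, of vs \<beta>])
  next
    case False
    then show ?thesis using assms(2)[of p vs] assms(3)[of p vs] by (metis (no_types))
  qed
qed

text \<open>The coordinate map is a linear isomorphism onto the tangent space, so multilinearity and antisymmetry can be
  tested on coordinate vectors.\<close>

lemma alternating_multilinear_if_coordinates:
  assumes M: "smooth_manifold M" and c: "c \<in> charts_at M p"
    and lin: "multilinear (\<lambda>us. \<alpha> (map (coord_tvec M p c) us))"
    and alt: "antisymmetric (\<lambda>us. \<alpha> (map (coord_tvec M p c) us))"
  shows "alternating_multilinear (tangent_space M p) k \<alpha>"
proof -
  let ?T = "tangent_space M p" and ?e = "coord_tvec M p c"
  have eq: "\<alpha> vs = \<alpha> (map ?e (map (\<lambda>v. v c) vs))" if "set vs \<subseteq> ?T" for vs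
  proof -
    have "map (\<lambda>v. ?e (v c)) vs = vs"
      using that coord_tvec_coord[OF _ c] by (intro map_idI) auto
    then show ?thesis by (simp add: o_def)
  qed
  have T: "(\<lambda>d. a *\<^sub>R u d + b *\<^sub>R w d) \<in> ?T" if "u \<in> ?T" "w \<in> ?T" for a b u w
    using coord_tvec_in_tangent_space[OF M c, of "a *\<^sub>R u c + b *\<^sub>R w c"]
    by (simp only: coord_tvec_linear[OF M c] coord_tvec_coord[OF that(1) c] coord_tvec_coord[OF that(2) c])
  show ?thesis
    unfolding alternating_multilinear_def
  proof (intro conjI allI impI; elim conjE)
    fix vs i u w and a b :: real
    assume *: "length vs = k" "set vs \<subseteq> ?T" "i < k" "u \<in> ?T" "w \<in> ?T"
    let ?us = "map (\<lambda>v. v c) vs"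
    have upd: "\<alpha> (vs[i := v]) = \<alpha> (map ?e (?us[i := v c]))" if "v \<in> ?T" for v
    proof -
      have "set (vs[i := v]) \<subseteq> ?T" using *(2) that set_update_subset_insert[of vs i v] by blast
      from eq[OF this] show ?thesis by (simp add: map_update)
    qed
    have L: "linear (\<lambda>v. \<alpha> (map ?e (?us[i := v])))"
      by (rule multilinear_update[OF lin]) (use * in simp)
    have "\<alpha> (map ?e (?us[i := a *\<^sub>R u c + b *\<^sub>R w c])) =
        a * \<alpha> (map ?e (?us[i := u c])) + b * \<alpha> (map ?e (?us[i := w c]))"
      using linear_add[OF L, of "a *\<^sub>R u c" "b *\<^sub>R w c"] linear_scale[OF L, of a "u c"]
        linear_scale[OF L, of b "w c"] by simp
    then show "\<alpha> (vs[i := (\<lambda>c. a *\<^sub>R u c + b *\<^sub>R w c)]) = a * \<alpha> (vs[i := u]) + b * \<alpha> (vs[i := w])"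
      using upd[OF T[OF *(4,5), of a b]] upd[OF *(4)] upd[OF *(5)] by (simp only:)
  next
    fix vs i j assume *: "length vs = k" "set vs \<subseteq> ?T" "i < j" "j < k" "vs ! i = vs ! j"
    then show "\<alpha> vs = 0"
      using antisymmetric_repeat[OF alt, of i "map (\<lambda>v. v c) vs" j] eq[OF *(2)] by simp
  qed
qed

lemma alternating_multilinear_coordinates:
  assumes M: "smooth_manifold M" and c: "c \<in> charts_at M p"
    and \<alpha>: "\<And>k. alternating_multilinear (tangent_space M p) k \<alpha>"
  shows "multilinear (\<lambda>us. \<alpha> (map (coord_tvec M p c) us))"
    "antisymmetric (\<lambda>us. \<alpha> (map (coord_tvec M p c) us))"
proof -
  let ?T = "tangent_space M p" and ?e = "coord_tvec M p c"
  have T: "set (map ?e us) \<subseteq> ?T" for us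
    using coord_tvec_in_tangent_space[OF M c] by auto
  have lin: "\<alpha> (map ?e (us @ (a *\<^sub>R v + b *\<^sub>R w) # ws)) = a * \<alpha> (map ?e (us @ v # ws)) + b * \<alpha> (map ?e (us @ w # ws))"
    for us v w ws a b
  proof -
    \<comment> \<open>The entry 0 is a placeholder for the slot that is varied.\<close>
    let ?vs = "map ?e (us @ 0 # ws)"
    have upd: "?vs[length us := x] = map ?e us @ x # map ?e ws" for x by (simp add: list_update_append)
    have "\<alpha> (?vs[length us := (\<lambda>d. a *\<^sub>R ?e v d + b *\<^sub>R ?e w d)]) =
       a * \<alpha> (?vs[length us := ?e v]) + b * \<alpha> (?vs[length us := ?e w])"
      using \<alpha>[of "length ?vs"] T[of "us @ 0 # ws"] coord_tvec_in_tangent_space[OF M c]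
      unfolding alternating_multilinear_def by (auto simp del: map_append)
    then show ?thesis
      unfolding upd by (simp only: map_append list.map coord_tvec_linear[OF M c])
  qed
  show lin': "multilinear (\<lambda>us. \<alpha> (map ?e us))"
    unfolding multilinear_def
  proof (intro allI linearI)
    fix us ws :: "'b list" and v w c
    show "\<alpha> (map ?e (us @ (v + w) # ws)) = \<alpha> (map ?e (us @ v # ws)) + \<alpha> (map ?e (us @ w # ws))"
      using lin[of us 1 v 1 w ws] by (simp only: scaleR_one mult_1)
    show "\<alpha> (map ?e (us @ (c *\<^sub>R v) # ws)) = c *\<^sub>R \<alpha> (map ?e (us @ v # ws))"
      using lin[of us c v 0 v ws] by (simp only: scaleR_zero_left add_0_right mult_zero_left real_scaleR_def)
  qed
  show "antisymmetric (\<lambda>us. \<alpha> (map ?e us))"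
  proof (rule antisymmetric_if_alternating[OF lin'])
    fix us v ws xs
    let ?vs = "map ?e (us @ v # ws @ v # xs)"
    have "length us < length us + Suc (length ws) \<and> length us + Suc (length ws) < length ?vs \<and>
      ?vs ! length us = ?vs ! (length us + Suc (length ws))"
      by (simp add: nth_append)
    then show "\<alpha> ?vs = 0"
      using \<alpha>[of "length ?vs"] T[of "us @ v # ws @ v # xs"] unfolding alternating_multilinear_def by blast
  qed
qed

lemma local_form_cong:
  assumes "open S" "\<And>x us. x \<in> S \<Longrightarrow> a x us = b x us" "local_form S a"
  shows "local_form S b"
proof -
  have "a x = b x" if "x \<in> S" for x using assms(2)[OF that] by blast
  then show ?thesis
    using assms(3) smooth_on_cong[OF assms(1), of "\<lambda>x. a x _" "\<lambda>x. b x _"] assms(2)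
    unfolding local_form_def by auto
qed

text \<open>For a homogeneous form, being alternating and multilinear at all points is the same as being so in all
  coordinate representations.\<close>

lemma forms_iff:
  assumes M: "smooth_manifold M"
  shows "\<omega> \<in> forms M k \<longleftrightarrow> smooth_form M \<omega> \<and> (\<forall>p. homogeneous k (\<omega> p))"
proof
  assume \<omega>: "\<omega> \<in> forms M k"
  then have hom: "homogeneous k (\<omega> p)" for p
    unfolding forms_def homogeneous_def by blast
  have "local_form (snd c ` fst c) (local_rep M c \<omega>)" if c: "c \<in> atlas M" for c
    unfolding local_form_def
  proof (intro conjI ballI allI)
    fix us show "smooth_on (snd c ` fst c) (\<lambda>x. local_rep M c \<omega> x us)"
      using \<omega> c unfolding forms_def by blast
  next
    fix x assume x: "x \<in> snd c ` fst c"
    let ?p = "chart_inv c x"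
    have p: "?p \<in> topspace (mtop M)" and cp: "c \<in> charts_at M ?p"
      using chart_inv_in[OF x] atlas_open(3)[OF M c] c by (auto simp: charts_at_def)
    have "alternating_multilinear (tangent_space M ?p) l (\<omega> ?p)" for l
    proof (cases "l = k")
      case True
      then show ?thesis using \<omega> p unfolding forms_def by blast
    next
      case False
      then have "\<omega> ?p vs = 0" if "length vs = l" for vs
        using hom[of ?p] that unfolding homogeneous_def by blast
      then show ?thesis unfolding alternating_multilinear_def by simp
    qed
    from alternating_multilinear_coordinates[OF M cp this]
    show "multilinear (local_rep M c \<omega> x)" "antisymmetric (local_rep M c \<omega> x)"
      unfolding local_rep_def by simp_all
  qed
  with hom show "smooth_form M \<omega> \<and> (\<forall>p. homogeneous k (\<omega> p))"
    using \<omega> unfolding smooth_form_def forms_def by blast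
next
  assume *: "smooth_form M \<omega> \<and> (\<forall>p. homogeneous k (\<omega> p))"
  have "alternating_multilinear (tangent_space M p) k (\<omega> p)" if p: "p \<in> topspace (mtop M)" for p
  proof -
    define c where "c = chart_at M p"
    have c: "c \<in> charts_at M p" unfolding c_def by (rule chart_at_in_charts_at[OF M p])
    have "local_rep M c \<omega> (snd c p) = (\<lambda>us. \<omega> p (map (coord_tvec M p c) us))"
      using chart_inv_left[OF M charts_atD[OF c]] by (simp add: local_rep_def fun_eq_iff)
    moreover have "local_form (snd c ` fst c) (local_rep M c \<omega>)"
      by (rule smooth_formD(2)[OF conjunct1[OF *] charts_atD(1)[OF c]])
    moreover have "snd c p \<in> snd c ` fst c"
      by (rule imageI[OF charts_atD(2)[OF c]])
    ultimately show ?thesis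
      using local_formD(1,2)[of "snd c ` fst c" "local_rep M c \<omega>" "snd c p"]
      by (intro alternating_multilinear_if_coordinates[OF M c]) simp_all
  qed
  moreover have "smooth_on (snd c ` fst c) (\<lambda>x. local_rep M c \<omega> x us)" if "c \<in> atlas M" for c us
    using local_formD(3)[OF smooth_formD(2)[OF _ that]] * by blast
  ultimately show "\<omega> \<in> forms M k"
    using * unfolding forms_def smooth_form_def homogeneous_def by blast
qed

text \<open>The defining conditions only compare lists of the same length, so they can be checked degree by degree.\<close>

lemma smooth_form_degree_part:
  assumes M: "smooth_manifold M"
  shows "smooth_form M \<omega> \<longleftrightarrow> (\<forall>k. degree_part k \<omega> \<in> forms M k)"
proof
  assume \<omega>: "smooth_form M \<omega>"
  have "local_form (snd c ` fst c) (local_rep M c (degree_part k \<omega>))" if c: "c \<in> atlas M" for c k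
  proof -
    have eq: "local_rep M c (degree_part k \<omega>) x us = (if length us = k then local_rep M c \<omega> x us else 0)" for x us
      by (simp add: local_rep_def degree_part_def)
    have a: "local_form (snd c ` fst c) (local_rep M c \<omega>)" by (rule smooth_formD(2)[OF \<omega> c])
    show ?thesis
      unfolding local_form_def
    proof (intro conjI ballI allI)
      fix x assume x: "x \<in> snd c ` fst c"
      show "multilinear (local_rep M c (degree_part k \<omega>) x)"
        unfolding multilinear_def
      proof (intro allI)
        fix us ws
        have "linear (\<lambda>v. local_rep M c \<omega> x (us @ v # ws))"
          using local_formD(1)[OF a x] unfolding multilinear_def by blast
        then show "linear (\<lambda>v. local_rep M c (degree_part k \<omega>) x (us @ v # ws))"
          unfolding eq by (cases "length (us @ undefined # ws) = k") (auto simp: linear_iff)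
      qed
      show "antisymmetric (local_rep M c (degree_part k \<omega>) x)"
        using local_formD(2)[OF a x] unfolding antisymmetric_def eq by simp
    next
      fix us
      show "smooth_on (snd c ` fst c) (\<lambda>x. local_rep M c (degree_part k \<omega>) x us)"
        using local_formD(3)[OF a] smooth_on_const[of _ 0] unfolding eq by (cases "length us = k") simp_all
    qed
  qed
  then have "smooth_form M (degree_part k \<omega>)" for k
    using smooth_formD(1)[OF \<omega>] unfolding smooth_form_def by (simp add: degree_part_def)
  then show "\<forall>k. degree_part k \<omega> \<in> forms M k"
    unfolding forms_iff[OF M] by (simp add: homogeneous_def degree_part_def)
next
  assume "\<forall>k. degree_part k \<omega> \<in> forms M k"
  then have part: "smooth_form M (degree_part k \<omega>)" for k
    unfolding forms_iff[OF M] by blast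
  have eq: "local_rep M c \<omega> x us = local_rep M c (degree_part (length us) \<omega>) x us" for c x us
    by (simp add: local_rep_def degree_part_def)
  have "local_form (snd c ` fst c) (local_rep M c \<omega>)" if c: "c \<in> atlas M" for c
  proof -
    have a: "local_form (snd c ` fst c) (local_rep M c (degree_part k \<omega>))" for k
      by (rule smooth_formD(2)[OF part c])
    show ?thesis
      unfolding local_form_def
    proof (intro conjI ballI allI)
      fix x assume x: "x \<in> snd c ` fst c"
      show "multilinear (local_rep M c \<omega> x)"
        unfolding multilinear_def
      proof (intro allI)
        fix us ws
        have "linear (\<lambda>v. local_rep M c (degree_part (length us + Suc (length ws)) \<omega>) x (us @ v # ws))"
          using local_formD(1)[OF a x] unfolding multilinear_def by blast
        then show "linear (\<lambda>v. local_rep M c \<omega> x (us @ v # ws))"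
          unfolding eq[of c x "us @ _ # ws"] by simp
      qed
      show "antisymmetric (local_rep M c \<omega> x)"
        unfolding antisymmetric_def
      proof (intro allI impI)
        fix \<sigma> and us :: "'b list" assume "\<sigma> permutes {..<length us}"
        then show "local_rep M c \<omega> x (permute_list \<sigma> us) = of_int (sign \<sigma>) * local_rep M c \<omega> x us"
          using local_formD(2)[OF a x] unfolding antisymmetric_def eq[of c x us] eq[of c x "permute_list \<sigma> us"] by simp
      qed
    next
      fix us
      show "smooth_on (snd c ` fst c) (\<lambda>x. local_rep M c \<omega> x us)"
        using local_formD(3)[OF a] unfolding eq[of c _ us] by blast
    qed
  qed
  moreover have "p \<in> topspace (mtop M) \<and> set vs \<subseteq> tangent_space M p" if "\<omega> p vs \<noteq> 0" for p vs
    using smooth_formD(1)[OF part[of "length vs"], of p vs] that by (simp add: degree_part_def)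
  ultimately show "smooth_form M \<omega>" unfolding smooth_form_def by blast
qed

section \<open>Coordinate representations of the operations on forms\<close>

lemma local_rep_add:
  "local_rep M c (\<lambda>p vs. \<alpha> p vs + \<beta> p vs) = (\<lambda>x us. local_rep M c \<alpha> x us + local_rep M c \<beta> x us)"
  by (simp add: local_rep_def fun_eq_iff)

lemma local_rep_cmult: "local_rep M c (\<lambda>p vs. r * \<alpha> p vs) = (\<lambda>x us. r * local_rep M c \<alpha> x us)"
  by (simp add: local_rep_def fun_eq_iff)

lemma local_rep_zero: "local_rep M c (\<lambda>p vs. 0) = (\<lambda>x us. 0)"
  by (simp add: local_rep_def fun_eq_iff)

lemma local_rep_wedge:
  "local_rep M c (wedge \<alpha> \<beta>) = (\<lambda>x. ext_prod (local_rep M c \<alpha> x) (local_rep M c \<beta> x))"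
proof (intro ext)
  fix x us
  show "local_rep M c (wedge \<alpha> \<beta>) x us = ext_prod (local_rep M c \<alpha> x) (local_rep M c \<beta> x) us"
    using ext_prod_map[of "\<alpha> (chart_inv c x)" "coord_tvec M (chart_inv c x) c" "\<beta> (chart_inv c x)" us]
    by (simp add: local_rep_def[abs_def] wedge_eq_ext_prod)
qed

abbreviation unit_form :: "('a, 'e::real_inner) manifold \<Rightarrow> ('a, 'e) form" where
  "unit_form M \<equiv> (\<lambda>p vs. if p \<in> topspace (mtop M) \<and> vs = [] then 1 else 0)"

lemma local_rep_unit:
  assumes "smooth_manifold M" "c \<in> atlas M" "x \<in> snd c ` fst c"
  shows "local_rep M c (unit_form M) x = ext_unit"
  using chart_inv_in[OF assms(3)] atlas_open(3)[OF assms(1,2)]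
  by (auto simp: local_rep_def ext_unit_def fun_eq_iff)

text \<open>Compatibility of the coordinate representations of one form: they are pulled back into each other by the
  changes of coordinates.\<close>

lemma local_rep_change:
  assumes M: "smooth_manifold M" and c: "c \<in> atlas M" and d: "d \<in> atlas M" and x: "x \<in> snd c ` (fst c \<inter> fst d)"
  shows "local_rep M c \<omega> x us = local_pull (snd d \<circ> chart_inv c) (local_rep M d \<omega>) x us"
proof -
  obtain p where p: "p \<in> fst c" "p \<in> fst d" "x = snd c p" using x by auto
  have inv: "chart_inv c x = p" "chart_inv d (snd d p) = p"
    using chart_inv_left[OF M c] chart_inv_left[OF M d] p by auto
  have "coord_tvec M p d (frechet_derivative (snd d \<circ> chart_inv c) (at x) u) = coord_tvec M p c u" for u
    using coord_tvec_change[OF M charts_atI[OF c p(1)] charts_atI[OF d p(2)], of u] p(3) by simp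
  then show ?thesis
    by (simp add: local_rep_def local_pull_def inv o_def)
qed

lemma ext_deriv_eq_local_d:
  assumes "p \<in> topspace (mtop M)" "set vs \<subseteq> tangent_space M p"
  shows "ext_deriv M \<omega> p vs =
    local_d (local_rep M (chart_at M p) \<omega>) (snd (chart_at M p) p) (map (\<lambda>v. v (chart_at M p)) vs)"
  using assms by (simp add: ext_deriv_def local_d_def Let_def)

text \<open>The exterior derivative at a point is defined through a chosen chart there, which varies from point to point.
  Naturality under the change to \<open>c\<close> shows that \<open>c\<close> computes the same value at all points of its domain.\<close>

lemma local_rep_ext_deriv:
  assumes M: "smooth_manifold M" and \<omega>: "smooth_form M \<omega>" and c: "c \<in> atlas M" and x: "x \<in> snd c ` fst c"
  shows "local_rep M c (ext_deriv M \<omega>) x = local_d (local_rep M c \<omega>) x"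
proof
  fix us
  define q where "q = chart_inv c x"
  define d where "d = chart_at M q"
  have q: "q \<in> fst c" "snd c q = x"
    unfolding q_def using chart_inv_in[OF x] chart_inv_right[OF x] by auto
  then have qM: "q \<in> topspace (mtop M)" using atlas_open(3)[OF M c] by blast
  have cq: "c \<in> charts_at M q" by (rule charts_atI[OF c q(1)])
  have dq: "d \<in> charts_at M q" unfolding d_def by (rule chart_at_in_charts_at[OF M qM])
  let ?\<phi> = "snd d \<circ> chart_inv c" and ?S = "snd c ` (fst c \<inter> fst d)"
  have S: "open ?S"
    by (rule chart_image_open[OF M c atlas_open(1)[OF M charts_atD(1)[OF dq]]])
  have xS: "x \<in> ?S" using q charts_atD(2)[OF dq] by auto
  have "?\<phi> ` ?S \<subseteq> snd d ` fst d"
    using chart_inv_left[OF M c] by auto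
  note nat = local_d_local_pull[OF smooth_manifold_fin_dim[OF M] S xS
      atlas_open(2)[OF M charts_atD(1)[OF dq]] atlas_transition[OF M c charts_atD(1)[OF dq]] this
      smooth_formD(2)[OF \<omega> charts_atD(1)[OF dq]]]
  have sub: "set (map (coord_tvec M q c) us) \<subseteq> tangent_space M q"
    using coord_tvec_in_tangent_space[OF M cq] by auto
  have "local_rep M c (ext_deriv M \<omega>) x us = ext_deriv M \<omega> q (map (coord_tvec M q c) us)"
    by (simp add: local_rep_def q_def)
  also have "\<dots> = local_d (local_rep M d \<omega>) (snd d q) (map (\<lambda>v. v d) (map (coord_tvec M q c) us))"
    unfolding ext_deriv_eq_local_d[OF qM sub] d_def[symmetric] ..
  also have "\<dots> = local_pull ?\<phi> (local_d (local_rep M d \<omega>)) x us"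
    using coord_tvec_apply[OF dq, of c] q by (simp add: local_pull_def o_def q_def)
  also have "\<dots> = local_d (local_pull ?\<phi> (local_rep M d \<omega>)) x us"
    by (simp only: nat)
  also have "local_d (local_pull ?\<phi> (local_rep M d \<omega>)) x = local_d (local_rep M c \<omega>) x"
    by (rule local_d_cong_open[OF S xS _, symmetric])
       (use local_form_subset[OF smooth_formD(2)[OF \<omega> c], of ?S] local_rep_change[OF M c charts_atD(1)[OF dq]] in auto)
  finally show "local_rep M c (ext_deriv M \<omega>) x us = local_d (local_rep M c \<omega>) x us" .
qed

lemma local_rep_pullback:
  assumes M: "smooth_manifold M" and N: "smooth_manifold N" and f: "smooth_map M N f"
    and c: "c \<in> atlas M" and d: "d \<in> atlas N" and x: "x \<in> snd c ` (fst c \<inter> f -` fst d)"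
  shows "local_rep M c (pullback M N f \<omega>) x us = local_pull (snd d \<circ> f \<circ> chart_inv c) (local_rep N d \<omega>) x us"
proof -
  obtain p where p: "p \<in> fst c" "f p \<in> fst d" "x = snd c p" using x by auto
  have inv: "chart_inv c x = p" "chart_inv d (snd d (f p)) = f p"
    using chart_inv_left[OF M c] chart_inv_left[OF N d] p by auto
  have pM: "p \<in> topspace (mtop M)" using atlas_open(3)[OF M c] p by blast
  have cp: "c \<in> charts_at M p" and dp: "d \<in> charts_at N (f p)" using c d p by (auto simp: charts_at_def)
  have sub: "set (map (coord_tvec M p c) us) \<subseteq> tangent_space M p"
    using coord_tvec_in_tangent_space[OF M cp] by auto
  have "local_rep M c (pullback M N f \<omega>) x us = \<omega> (f p) (map (tangent_map M N f p) (map (coord_tvec M p c) us))"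
    using pM sub by (simp add: local_rep_def pullback_def inv)
  also have "map (tangent_map M N f p) (map (coord_tvec M p c) us) =
      map (coord_tvec N (f p) d) (map (coord_deriv c d f p) us)"
    by (simp add: tangent_map_coord_tvec[OF M N f cp dp])
  also have "\<omega> (f p) \<dots> = local_pull (snd d \<circ> f \<circ> chart_inv c) (local_rep N d \<omega>) x us"
    by (simp add: local_rep_def local_pull_def inv p(3)[symmetric])
  finally show ?thesis .
qed

section \<open>Operations on smooth forms\<close>

lemma smooth_formI:
  assumes "\<And>p vs. \<omega> p vs \<noteq> 0 \<Longrightarrow> p \<in> topspace (mtop M) \<and> set vs \<subseteq> tangent_space M p"
    and "\<And>c. c \<in> atlas M \<Longrightarrow> local_form (snd c ` fst c) (local_rep M c \<omega>)"
  shows "smooth_form M \<omega>"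
  using assms unfolding smooth_form_def by blast

lemma smooth_form_zero: "smooth_form M (\<lambda>p vs. 0)"
  by (rule smooth_formI) (simp_all add: local_rep_zero local_form_zero)

lemma smooth_form_add:
  assumes "smooth_manifold M" "smooth_form M \<alpha>" "smooth_form M \<beta>"
  shows "smooth_form M (\<lambda>p vs. \<alpha> p vs + \<beta> p vs)"
proof (rule smooth_formI)
  fix p vs assume "\<alpha> p vs + \<beta> p vs \<noteq> 0"
  then have "\<alpha> p vs \<noteq> 0 \<or> \<beta> p vs \<noteq> 0" by auto
  then show "p \<in> topspace (mtop M) \<and> set vs \<subseteq> tangent_space M p"
    using smooth_formD(1)[OF assms(2), of p vs] smooth_formD(1)[OF assms(3), of p vs] by argo
next
  fix c assume c: "c \<in> atlas M"
  show "local_form (snd c ` fst c) (local_rep M c (\<lambda>p vs. \<alpha> p vs + \<beta> p vs))"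
    unfolding local_rep_add
    by (rule local_form_add[OF atlas_open(2)[OF assms(1) c] smooth_formD(2)[OF assms(2) c] smooth_formD(2)[OF assms(3) c]])
qed

lemma smooth_form_cmult:
  assumes "smooth_manifold M" "smooth_form M \<alpha>"
  shows "smooth_form M (\<lambda>p vs. r * \<alpha> p vs)"
proof (rule smooth_formI)
  fix p vs assume "r * \<alpha> p vs \<noteq> 0"
  then have "\<alpha> p vs \<noteq> 0" by auto
  then show "p \<in> topspace (mtop M) \<and> set vs \<subseteq> tangent_space M p"
    by (rule smooth_formD(1)[OF assms(2)])
next
  fix c assume c: "c \<in> atlas M"
  show "local_form (snd c ` fst c) (local_rep M c (\<lambda>p vs. r * \<alpha> p vs))"
    unfolding local_rep_cmult
    by (rule local_form_cmult[OF atlas_open(2)[OF assms(1) c] smooth_formD(2)[OF assms(2) c]])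
qed

lemma smooth_form_wedge:
  assumes M: "smooth_manifold M" and \<alpha>: "smooth_form M \<alpha>" and \<beta>: "smooth_form M \<beta>"
  shows "smooth_form M (wedge \<alpha> \<beta>)"
proof (rule smooth_formI)
  fix p vs assume "wedge \<alpha> \<beta> p vs \<noteq> 0"
  then obtain k \<sigma> where \<sigma>: "\<sigma> permutes {..<length vs}"
    and ne: "\<alpha> p (take k (permute_list \<sigma> vs)) \<noteq> 0" "\<beta> p (drop k (permute_list \<sigma> vs)) \<noteq> 0"
    using ext_prod_nonzero[of "\<alpha> p" "\<beta> p" vs] unfolding wedge_eq_ext_prod by blast
  have "set vs = set (take k (permute_list \<sigma> vs) @ drop k (permute_list \<sigma> vs))"
    using \<sigma> by (simp only: append_take_drop_id set_permute_list)
  then show "p \<in> topspace (mtop M) \<and> set vs \<subseteq> tangent_space M p"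
    using smooth_formD(1)[OF \<alpha> ne(1)] smooth_formD(1)[OF \<beta> ne(2)] unfolding set_append by blast
next
  fix c assume c: "c \<in> atlas M"
  show "local_form (snd c ` fst c) (local_rep M c (wedge \<alpha> \<beta>))"
    unfolding local_rep_wedge
    by (rule local_form_ext_prod[OF atlas_open(2)[OF M c] smooth_formD(2)[OF \<alpha> c] smooth_formD(2)[OF \<beta> c]])
qed

lemma smooth_form_unit:
  assumes M: "smooth_manifold M"
  shows "smooth_form M (unit_form M)"
proof (rule smooth_formI)
  fix c assume c: "c \<in> atlas M"
  show "local_form (snd c ` fst c) (local_rep M c (unit_form M))"
    by (rule local_form_cong[OF atlas_open(2)[OF M c] _ local_form_unit]) (simp only: local_rep_unit[OF M c])
qed (auto split: if_splits)

lemma smooth_form_ext_deriv: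
  assumes M: "smooth_manifold M" and \<omega>: "smooth_form M \<omega>"
  shows "smooth_form M (ext_deriv M \<omega>)"
proof (rule smooth_formI)
  fix p vs assume "ext_deriv M \<omega> p vs \<noteq> 0"
  then show "p \<in> topspace (mtop M) \<and> set vs \<subseteq> tangent_space M p"
    by (rule contrapos_np) (simp only: ext_deriv_def if_False)
next
  fix c assume c: "c \<in> atlas M"
  show "local_form (snd c ` fst c) (local_rep M c (ext_deriv M \<omega>))"
    by (rule local_form_cong[OF atlas_open(2)[OF M c] _
          local_form_local_d[OF atlas_open(2)[OF M c] smooth_formD(2)[OF \<omega> c]]])
       (simp only: local_rep_ext_deriv[OF M \<omega> c])
qed

lemma local_form_local:
  assumes "\<And>x. x \<in> S \<Longrightarrow> \<exists>T. open T \<and> x \<in> T \<and> local_form T a"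
  shows "local_form S a"
  unfolding local_form_def
proof (intro conjI ballI allI)
  fix x assume "x \<in> S"
  then show "multilinear (a x)" "antisymmetric (a x)"
    using assms local_formD(1,2) by blast+
next
  fix us
  show "smooth_on S (\<lambda>x. a x us)"
  proof (rule smooth_on_local)
    fix x assume "x \<in> S"
    with assms obtain T where "open T" "x \<in> T" "local_form T a" by blast
    then show "\<exists>T. open T \<and> x \<in> T \<and> smooth_on T (\<lambda>x. a x us)" using local_formD(3)[of T a us] by blast
  qed
qed

text \<open>Smoothness is local: near each point the coordinate representation is a pullback from one chart of \<open>N\<close>.\<close>

lemma smooth_form_pullback:
  assumes M: "smooth_manifold M" and N: "smooth_manifold N" and f: "smooth_map M N f" and \<omega>: "smooth_form N \<omega>"
  shows "smooth_form M (pullback M N f \<omega>)"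
proof (rule smooth_formI)
  fix p vs assume "pullback M N f \<omega> p vs \<noteq> 0"
  then show "p \<in> topspace (mtop M) \<and> set vs \<subseteq> tangent_space M p"
    by (rule contrapos_np) (simp only: pullback_def if_False)
next
  fix c assume c: "c \<in> atlas M"
  show "local_form (snd c ` fst c) (local_rep M c (pullback M N f \<omega>))"
  proof (rule local_form_local)
    fix x assume "x \<in> snd c ` fst c"
    then obtain p where p: "p \<in> fst c" "x = snd c p" by auto
    define d where "d = chart_at N (f p)"
    have "f p \<in> topspace (mtop N)"
      using smooth_map_topspace[OF f] atlas_open(3)[OF M c] p by blast
    then have d: "d \<in> atlas N" "f p \<in> fst d"
      using chart_at_in_charts_at[OF N] unfolding d_def by (simp_all add: charts_at_def)
    let ?S = "snd c ` (fst c \<inter> f -` fst d)"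
    have S: "open ?S"
      by (rule preimage_image_open[OF M c smooth_mapD(1)[OF f] atlas_open(1)[OF N d(1)]])
    have "(snd d \<circ> f \<circ> chart_inv c) ` ?S \<subseteq> snd d ` fst d"
      using chart_inv_left[OF M c] by auto
    then have "local_form ?S (local_pull (snd d \<circ> f \<circ> chart_inv c) (local_rep N d \<omega>))"
      by (rule local_form_local_pull[OF smooth_manifold_fin_dim[OF N] S smooth_mapD(2)[OF f c d(1)] _
            smooth_formD(2)[OF \<omega> d(1)]])
    then have "local_form ?S (local_rep M c (pullback M N f \<omega>))"
      by (rule local_form_cong[OF S, rotated]) (rule local_rep_pullback[OF M N f c d(1), symmetric])
    moreover have "x \<in> ?S" using p d by auto
    ultimately show "\<exists>T. open T \<and> x \<in> T \<and> local_form T (local_rep M c (pullback M N f \<omega>))"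
      using S by blast
  qed
qed

lemma smooth_form_eqI:
  assumes "smooth_manifold M" "smooth_form M \<alpha>" "smooth_form M \<beta>"
    and "\<And>c x us. c \<in> atlas M \<Longrightarrow> x \<in> snd c ` fst c \<Longrightarrow> local_rep M c \<alpha> x us = local_rep M c \<beta> x us"
  shows "\<alpha> = \<beta>"
  by (rule form_eqI[OF assms(1) smooth_formD(1)[OF assms(2)] smooth_formD(1)[OF assms(3)] assms(4)])

lemma local_d_add:
  assumes "local_form S a" "local_form S b" "x \<in> S"
  shows "local_d (\<lambda>x us. a x us + b x us) x us = local_d a x us + local_d b x us"
  by (simp add: local_d_def frechet_derivative_add[OF local_form_differentiable[OF assms(1,3)]
        local_form_differentiable[OF assms(2,3)]] sum.distrib distrib_left)

lemma local_d_cmult: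
  assumes "local_form S a" "x \<in> S"
  shows "local_d (\<lambda>x us. r * a x us) x us = r * local_d a x us"
  by (simp add: local_d_def frechet_derivative_cmult[OF local_form_differentiable[OF assms]]
        sum_distrib_left mult.left_commute)

lemma ext_deriv_add:
  assumes M: "smooth_manifold M" and \<alpha>: "smooth_form M \<alpha>" and \<beta>: "smooth_form M \<beta>"
  shows "ext_deriv M (\<lambda>p vs. \<alpha> p vs + \<beta> p vs) = (\<lambda>p vs. ext_deriv M \<alpha> p vs + ext_deriv M \<beta> p vs)"
proof (rule smooth_form_eqI[OF M])
  fix c x us assume c: "c \<in> atlas M" and x: "x \<in> snd c ` fst c"
  show "local_rep M c (ext_deriv M (\<lambda>p vs. \<alpha> p vs + \<beta> p vs)) x us =
      local_rep M c (\<lambda>p vs. ext_deriv M \<alpha> p vs + ext_deriv M \<beta> p vs) x us"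
    by (simp only: local_rep_ext_deriv[OF M smooth_form_add[OF M \<alpha> \<beta>] c x] local_rep_add
        local_rep_ext_deriv[OF M \<alpha> c x] local_rep_ext_deriv[OF M \<beta> c x]
        local_d_add[OF smooth_formD(2)[OF \<alpha> c] smooth_formD(2)[OF \<beta> c] x])
qed (intro smooth_form_ext_deriv smooth_form_add M \<alpha> \<beta>)+

lemma ext_deriv_cmult:
  assumes M: "smooth_manifold M" and \<alpha>: "smooth_form M \<alpha>"
  shows "ext_deriv M (\<lambda>p vs. r * \<alpha> p vs) = (\<lambda>p vs. r * ext_deriv M \<alpha> p vs)"
proof (rule smooth_form_eqI[OF M])
  fix c x us assume c: "c \<in> atlas M" and x: "x \<in> snd c ` fst c"
  show "local_rep M c (ext_deriv M (\<lambda>p vs. r * \<alpha> p vs)) x us = local_rep M c (\<lambda>p vs. r * ext_deriv M \<alpha> p vs) x us"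
    by (simp only: local_rep_ext_deriv[OF M smooth_form_cmult[OF M \<alpha>] c x] local_rep_cmult
        local_rep_ext_deriv[OF M \<alpha> c x] local_d_cmult[OF smooth_formD(2)[OF \<alpha> c] x])
qed (intro smooth_form_ext_deriv smooth_form_cmult M \<alpha>)+

text \<open>The coordinate representation of \<open>d\<omega>\<close> agrees with the local exterior derivative on the whole domain of the
  chart, so it may be differentiated once more.\<close>

lemma ext_deriv_ext_deriv:
  assumes M: "smooth_manifold M" and \<alpha>: "smooth_form M \<alpha>"
  shows "ext_deriv M (ext_deriv M \<alpha>) = (\<lambda>p vs. 0)"
proof (rule smooth_form_eqI[OF M _ smooth_form_zero])
  fix c x us assume c: "c \<in> atlas M" and x: "x \<in> snd c ` fst c"
  have d: "smooth_form M (ext_deriv M \<alpha>)" by (rule smooth_form_ext_deriv[OF M \<alpha>])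
  have S: "open (snd c ` fst c)" by (rule atlas_open(2)[OF M c])
  have "local_rep M c (ext_deriv M (ext_deriv M \<alpha>)) x us = local_d (local_rep M c (ext_deriv M \<alpha>)) x us"
    by (simp only: local_rep_ext_deriv[OF M d c x])
  also have "local_d (local_rep M c (ext_deriv M \<alpha>)) x = local_d (local_d (local_rep M c \<alpha>)) x"
    by (rule local_d_cong_open[OF S x smooth_formD(2)[OF d c]]) (simp only: local_rep_ext_deriv[OF M \<alpha> c])
  also have "local_d (local_d (local_rep M c \<alpha>)) x us = 0"
    by (rule local_d_local_d[OF S x smooth_formD(2)[OF \<alpha> c]])
  finally show "local_rep M c (ext_deriv M (ext_deriv M \<alpha>)) x us = local_rep M c (\<lambda>p vs. 0) x us"
    by (simp only: local_rep_zero)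
qed (intro smooth_form_ext_deriv M \<alpha>)

lemma homogeneous_local_rep: "(\<And>p. homogeneous k (\<alpha> p)) \<Longrightarrow> homogeneous k (local_rep M c \<alpha> x)"
  by (simp add: homogeneous_def local_rep_def)

lemma ext_deriv_wedge:
  assumes M: "smooth_manifold M" and \<alpha>: "smooth_form M \<alpha>" and \<beta>: "smooth_form M \<beta>" and k: "\<And>p. homogeneous k (\<alpha> p)"
  shows "ext_deriv M (wedge \<alpha> \<beta>) =
    (\<lambda>p vs. wedge (ext_deriv M \<alpha>) \<beta> p vs + (-1) ^ k * wedge \<alpha> (ext_deriv M \<beta>) p vs)"
proof (rule smooth_form_eqI[OF M])
  fix c x us assume c: "c \<in> atlas M" and x: "x \<in> snd c ` fst c"
  show "local_rep M c (ext_deriv M (wedge \<alpha> \<beta>)) x us =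
     local_rep M c (\<lambda>p vs. wedge (ext_deriv M \<alpha>) \<beta> p vs + (-1) ^ k * wedge \<alpha> (ext_deriv M \<beta>) p vs) x us"
    by (simp only: local_rep_ext_deriv[OF M smooth_form_wedge[OF M \<alpha> \<beta>] c x] local_rep_add local_rep_cmult
        local_rep_wedge local_rep_ext_deriv[OF M \<alpha> c x] local_rep_ext_deriv[OF M \<beta> c x]
        local_d_ext_prod[OF atlas_open(2)[OF M c] x smooth_formD(2)[OF \<alpha> c] smooth_formD(2)[OF \<beta> c]
          homogeneous_local_rep[of k \<alpha>, OF k]])
qed (intro smooth_form_ext_deriv smooth_form_wedge smooth_form_add smooth_form_cmult M \<alpha> \<beta>)+

lemma wedge_assoc: "wedge (wedge \<alpha> \<beta>) \<gamma> = wedge \<alpha> (wedge \<beta> \<gamma>)"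
  by (rule ext) (simp only: wedge_eq_ext_prod ext_prod_assoc)

lemma wedge_unit:
  assumes M: "smooth_manifold M" and \<alpha>: "smooth_form M \<alpha>"
  shows "wedge (unit_form M) \<alpha> = \<alpha>" "wedge \<alpha> (unit_form M) = \<alpha>"
proof -
  have anti: "antisymmetric (local_rep M c \<alpha> x)" if "c \<in> atlas M" "x \<in> snd c ` fst c" for c x
    by (rule local_formD(2)[OF smooth_formD(2)[OF \<alpha> that(1)] that(2)])
  show "wedge (unit_form M) \<alpha> = \<alpha>"
    by (rule smooth_form_eqI[OF M smooth_form_wedge[OF M smooth_form_unit[OF M] \<alpha>] \<alpha>])
       (simp only: local_rep_wedge local_rep_unit[OF M] ext_prod_unit_left[OF anti])
  show "wedge \<alpha> (unit_form M) = \<alpha>"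
    by (rule smooth_form_eqI[OF M smooth_form_wedge[OF M \<alpha> smooth_form_unit[OF M]] \<alpha>])
       (simp only: local_rep_wedge local_rep_unit[OF M] ext_prod_unit_right[OF anti])
qed

lemma wedge_add_left: "wedge (\<lambda>p vs. \<alpha> p vs + \<beta> p vs) \<gamma> = (\<lambda>p vs. wedge \<alpha> \<gamma> p vs + wedge \<beta> \<gamma> p vs)"
  by (simp add: fun_eq_iff wedge_eq_ext_prod ext_prod_add_left)

lemma wedge_add_right: "wedge \<gamma> (\<lambda>p vs. \<alpha> p vs + \<beta> p vs) = (\<lambda>p vs. wedge \<gamma> \<alpha> p vs + wedge \<gamma> \<beta> p vs)"
  by (simp add: fun_eq_iff wedge_eq_ext_prod ext_prod_add_right)

lemma wedge_cmult_left: "wedge (\<lambda>p vs. r * \<alpha> p vs) \<beta> = (\<lambda>p vs. r * wedge \<alpha> \<beta> p vs)"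
  by (simp add: fun_eq_iff wedge_eq_ext_prod ext_prod_cmult_left)

lemma wedge_cmult_right: "wedge \<alpha> (\<lambda>p vs. r * \<beta> p vs) = (\<lambda>p vs. r * wedge \<alpha> \<beta> p vs)"
  by (simp add: fun_eq_iff wedge_eq_ext_prod ext_prod_cmult_right)

lemma wedge_commute:
  assumes "\<And>p. homogeneous k (\<alpha> p)" "\<And>p. homogeneous l (\<beta> p)"
  shows "wedge \<alpha> \<beta> = (\<lambda>p vs. (-1) ^ (k * l) * wedge \<beta> \<alpha> p vs)"
proof (intro ext)
  fix p vs
  show "wedge \<alpha> \<beta> p vs = (-1) ^ (k * l) * wedge \<beta> \<alpha> p vs"
    unfolding wedge_eq_ext_prod by (rule ext_prod_commute[OF assms])
qed

text \<open>All signs are powers of \<open>(-1)\<^sup>k\<close>. This makes \<open>\<tau>\<^sup>p\<close> central.\<close>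

lemma wedge_commute_even:
  assumes "\<And>p. homogeneous k (\<alpha> p)" "even k"
  shows "wedge \<alpha> \<beta> = wedge \<beta> \<alpha>"
proof (intro ext)
  fix p vs
  show "wedge \<alpha> \<beta> p vs = wedge \<beta> \<alpha> p vs"
    unfolding wedge_eq_ext_prod using ext_prod_commute_homogeneous[OF assms(1), of p "\<beta> p" vs] assms(2) by simp
qed

lemma wedge_signed: "wedge (signed \<alpha>) (signed \<beta>) = signed (wedge \<alpha> \<beta>)"
proof (intro ext)
  fix p :: 'a and vs :: "('a, 'b) tvec list"
  have "of_int (sign \<sigma>) * signed \<alpha> p (take k (permute_list \<sigma> vs)) * signed \<beta> p (drop k (permute_list \<sigma> vs)) =
     (-1) ^ length vs * (of_int (sign \<sigma>) * \<alpha> p (take k (permute_list \<sigma> vs)) * \<beta> p (drop k (permute_list \<sigma> vs)))"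
    if "k \<le> length vs" for k \<sigma>
  proof -
    have "(-1) ^ length vs = (-1::real) ^ k * (-1) ^ (length vs - k)"
      using that by (simp flip: power_add)
    then show ?thesis using that by (simp add: signed_def min_def mult_ac)
  qed
  then have "wedge (signed \<alpha>) (signed \<beta>) p vs = (\<Sum>k\<le>length vs. (\<Sum>\<sigma> | \<sigma> permutes {..<length vs}.
      (-1) ^ length vs * (of_int (sign \<sigma>) * \<alpha> p (take k (permute_list \<sigma> vs)) * \<beta> p (drop k (permute_list \<sigma> vs))))
     / (fact k * fact (length vs - k)))"
    unfolding wedge_def by (intro sum.cong arg_cong2[where f = "(/)"] refl) simp
  also have "\<dots> = signed (wedge \<alpha> \<beta>) p vs"
    unfolding signed_def wedge_def by (simp only: sum_distrib_left times_divide_eq_right)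
  finally show "wedge (signed \<alpha>) (signed \<beta>) p vs = signed (wedge \<alpha> \<beta>) p vs" .
qed

section \<open>The de Rham algebra\<close>

text \<open>The degree is an integer, as in the grading of the algebra. In negative degrees this leaves only the zero
  form, so that no case distinctions are needed for the degree \<open>k - 2p + 1\<close> of the second component of the
  cone.\<close>

definition of_degree :: "int \<Rightarrow> ('a, 'e) form \<Rightarrow> bool" where
  "of_degree k \<omega> \<longleftrightarrow> (\<forall>p vs. \<omega> p vs \<noteq> 0 \<longrightarrow> int (length vs) = k)"

text \<open>Finiteness of the set of degrees, in a form that passes easily to products and derivatives.\<close>

definition bounded_degree :: "('a, 'e) form \<Rightarrow> bool" where
  "bounded_degree \<omega> \<longleftrightarrow> (\<exists>n. \<forall>p vs. \<omega> p vs \<noteq> 0 \<longrightarrow> length vs < n)"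

lemma finite_degrees_iff: "finite {k. degree_part k \<omega> \<noteq> (\<lambda>p vs. 0)} \<longleftrightarrow> bounded_degree \<omega>"
proof -
  have "(\<forall>k. degree_part k \<omega> \<noteq> (\<lambda>p vs. 0) \<longrightarrow> k < n) \<longleftrightarrow> (\<forall>p vs. \<omega> p vs \<noteq> 0 \<longrightarrow> length vs < n)" for n
    by (auto simp: degree_part_def fun_eq_iff)
  then show ?thesis
    unfolding bounded_degree_def finite_nat_set_iff_bounded by simp
qed

lemma de_rham_carrier:
  "smooth_manifold M \<Longrightarrow> \<omega> \<in> carrier (de_rham M) \<longleftrightarrow> smooth_form M \<omega> \<and> bounded_degree \<omega>"
  by (simp add: de_rham_def finite_degrees_iff smooth_form_degree_part)

lemma of_degreeD: "of_degree k \<omega> \<Longrightarrow> int (length vs) \<noteq> k \<Longrightarrow> \<omega> p vs = 0"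
  unfolding of_degree_def by blast

lemma of_degree_nat: "of_degree (int n) \<omega> \<longleftrightarrow> (\<forall>p. homogeneous n (\<omega> p))"
  by (auto simp: of_degree_def homogeneous_def)

lemma of_degree_neg: "k < 0 \<Longrightarrow> of_degree k \<omega> \<longleftrightarrow> \<omega> = (\<lambda>p vs. 0)"
  by (auto simp: of_degree_def fun_eq_iff)

lemma of_degree_cases:
  assumes "of_degree k \<omega>"
  obtains "\<omega> = (\<lambda>p vs. 0)" | n where "k = int n" "\<And>p. homogeneous n (\<omega> p)"
proof (cases "k < 0")
  case True
  then show ?thesis using that(1) assms of_degree_neg by blast
next
  case False
  then obtain n where "k = int n" using nonneg_int_cases[of k] by auto
  then show ?thesis using that(2)[of n] assms of_degree_nat[of n \<omega>] by simp
qed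

lemma de_rham_grade:
  assumes "smooth_manifold M"
  shows "\<omega> \<in> grade (de_rham M) k \<longleftrightarrow> smooth_form M \<omega> \<and> of_degree k \<omega>"
proof (cases "k < 0")
  case True
  then show ?thesis by (auto simp: de_rham_def of_degree_neg smooth_form_zero)
next
  case False
  then obtain n where "k = int n" using nonneg_int_cases[of k] by auto
  then show ?thesis by (simp add: de_rham_def forms_iff[OF assms] of_degree_nat)
qed

lemma de_rham_ops:
  "\<alpha> \<otimes>\<^bsub>de_rham M\<^esub> \<beta> = wedge \<alpha> \<beta>"
  "\<one>\<^bsub>de_rham M\<^esub> = unit_form M"
  "\<zero>\<^bsub>de_rham M\<^esub> = (\<lambda>p vs. 0)"
  "\<alpha> \<oplus>\<^bsub>de_rham M\<^esub> \<beta> = (\<lambda>p vs. \<alpha> p vs + \<beta> p vs)"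
  "r \<odot>\<^bsub>de_rham M\<^esub> \<alpha> = (\<lambda>p vs. r * \<alpha> p vs)"
  "dif (de_rham M) \<alpha> = ext_deriv M \<alpha>"
  by (simp_all add: de_rham_def)

lemma bounded_of_degree: "of_degree k \<omega> \<Longrightarrow> bounded_degree \<omega>"
  unfolding of_degree_def bounded_degree_def by (intro exI[of _ "Suc (nat k)"]) force

lemma bounded_zero: "bounded_degree (\<lambda>p vs. 0)"
  by (simp add: bounded_degree_def)

lemma bounded_cmult: "bounded_degree \<alpha> \<Longrightarrow> bounded_degree (\<lambda>p vs. r * \<alpha> p vs)"
  unfolding bounded_degree_def by auto

lemma bounded_add:
  assumes "bounded_degree \<alpha>" "bounded_degree \<beta>"
  shows "bounded_degree (\<lambda>p vs. \<alpha> p vs + \<beta> p vs)"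
proof -
  obtain m n where *: "\<And>p vs. \<alpha> p vs \<noteq> 0 \<Longrightarrow> length vs < m" "\<And>p vs. \<beta> p vs \<noteq> 0 \<Longrightarrow> length vs < n"
    using assms unfolding bounded_degree_def by blast
  have "length vs < max m n" if "\<alpha> p vs + \<beta> p vs \<noteq> 0" for p vs
  proof (cases "\<alpha> p vs = 0")
    case True
    then have "length vs < n" using *(2)[of p vs] that by simp
    then show ?thesis by simp
  next
    case False
    then have "length vs < m" by (rule *(1))
    then show ?thesis by simp
  qed
  then show ?thesis unfolding bounded_degree_def by blast
qed

lemma wedge_nonzero:
  assumes "wedge \<alpha> \<beta> p vs \<noteq> 0"
  shows "\<exists>us ws. length vs = length us + length ws \<and> \<alpha> p us \<noteq> 0 \<and> \<beta> p ws \<noteq> 0"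
proof -
  obtain k \<sigma> where "k \<le> length vs" "\<alpha> p (take k (permute_list \<sigma> vs)) \<noteq> 0" "\<beta> p (drop k (permute_list \<sigma> vs)) \<noteq> 0"
    using ext_prod_nonzero[of "\<alpha> p" "\<beta> p" vs] assms unfolding wedge_eq_ext_prod by blast
  then show ?thesis
    by (intro exI[of _ "take k (permute_list \<sigma> vs)"] exI[of _ "drop k (permute_list \<sigma> vs)"]) simp
qed

lemma bounded_wedge:
  assumes "bounded_degree \<alpha>" "bounded_degree \<beta>"
  shows "bounded_degree (wedge \<alpha> \<beta>)"
proof -
  obtain m n where *: "\<And>p vs. \<alpha> p vs \<noteq> 0 \<Longrightarrow> length vs < m" "\<And>p vs. \<beta> p vs \<noteq> 0 \<Longrightarrow> length vs < n"
    using assms unfolding bounded_degree_def by blast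
  have "length vs < m + n" if ne: "wedge \<alpha> \<beta> p vs \<noteq> 0" for p vs
  proof -
    obtain us ws where "length vs = length us + length ws" "\<alpha> p us \<noteq> 0" "\<beta> p ws \<noteq> 0"
      using wedge_nonzero[OF ne] by blast
    then show ?thesis using *(1)[of p us] *(2)[of p ws] by simp
  qed
  then show ?thesis unfolding bounded_degree_def by blast
qed

lemma of_degree_wedge:
  assumes "of_degree k \<alpha>" "of_degree l \<beta>"
  shows "of_degree (k + l) (wedge \<alpha> \<beta>)"
  unfolding of_degree_def
proof (intro allI impI)
  fix p vs assume ne: "wedge \<alpha> \<beta> p vs \<noteq> 0"
  obtain us ws where "length vs = length us + length ws" "\<alpha> p us \<noteq> 0" "\<beta> p ws \<noteq> 0"
    using wedge_nonzero[OF ne] by blast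
  moreover from this have "int (length us) = k" "int (length ws) = l"
    using assms unfolding of_degree_def by blast+
  ultimately show "int (length vs) = k + l" by simp
qed

text \<open>The exterior derivative on lists of length \<open>n + 1\<close> involves the form on lists of length \<open>n\<close> only.\<close>

lemma ext_deriv_zero_if_zero_below:
  assumes "\<And>p ws. Suc (length ws) = length vs \<Longrightarrow> \<omega> p ws = 0"
  shows "ext_deriv M \<omega> p vs = 0"
proof -
  have "local_rep M c \<omega> x (take i es @ drop (Suc i) es) = 0" if "i < length vs" "length es = length vs" for c x i es
    unfolding local_rep_def using that by (intro assms) auto
  then show ?thesis unfolding ext_deriv_def by (simp add: Let_def)
qed

lemma ext_deriv_nonzero:
  assumes "ext_deriv M \<omega> p vs \<noteq> 0"
  shows "\<exists>q ws. Suc (length ws) = length vs \<and> \<omega> q ws \<noteq> 0"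
proof (rule ccontr)
  assume "\<not> ?thesis"
  then have "ext_deriv M \<omega> p vs = 0" by (intro ext_deriv_zero_if_zero_below) blast
  with assms show False by simp
qed

lemma of_degree_ext_deriv:
  assumes "of_degree k \<omega>"
  shows "of_degree (k + 1) (ext_deriv M \<omega>)"
  unfolding of_degree_def
proof (intro allI impI)
  fix p vs assume ne: "ext_deriv M \<omega> p vs \<noteq> 0"
  obtain q ws where "Suc (length ws) = length vs" "\<omega> q ws \<noteq> 0" using ext_deriv_nonzero[OF ne] by blast
  moreover from this have "int (length ws) = k" using assms unfolding of_degree_def by blast
  ultimately show "int (length vs) = k + 1" by simp
qed

lemma of_degree_zero: "of_degree k (\<lambda>p vs. 0)"
  by (simp add: of_degree_def)

lemma of_degree_add:
  assumes "of_degree k \<alpha>" "of_degree k \<beta>"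
  shows "of_degree k (\<lambda>p vs. \<alpha> p vs + \<beta> p vs)"
  unfolding of_degree_def
proof (intro allI impI)
  fix p vs assume "\<alpha> p vs + \<beta> p vs \<noteq> 0"
  then have "\<alpha> p vs \<noteq> 0 \<or> \<beta> p vs \<noteq> 0" by auto
  then show "int (length vs) = k" using assms unfolding of_degree_def by blast
qed

lemma of_degree_cmult: "of_degree k \<alpha> \<Longrightarrow> of_degree k (\<lambda>p vs. r * \<alpha> p vs)"
  unfolding of_degree_def by auto

lemma of_degree_unit: "of_degree 0 (unit_form M)"
  by (simp add: of_degree_def)

lemma wedge_zero: "wedge (\<lambda>p vs. 0) \<beta> = (\<lambda>p vs. 0)" "wedge \<alpha> (\<lambda>p vs. 0) = (\<lambda>p vs. 0)"
  using wedge_cmult_left[of 0 "\<lambda>p vs. 0" \<beta>] wedge_cmult_right[of \<alpha> 0 "\<lambda>p vs. 0"] by simp_all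

lemma ext_deriv_zero: "ext_deriv M (\<lambda>p vs. 0) = (\<lambda>p vs. 0)"
  by (intro ext ext_deriv_zero_if_zero_below) simp

lemma ext_deriv_wedge_of_degree:
  assumes M: "smooth_manifold M" and \<alpha>: "smooth_form M \<alpha>" and \<beta>: "smooth_form M \<beta>" and k: "of_degree k \<alpha>"
  shows "ext_deriv M (wedge \<alpha> \<beta>) =
    (\<lambda>p vs. wedge (ext_deriv M \<alpha>) \<beta> p vs + (-1) powi k * wedge \<alpha> (ext_deriv M \<beta>) p vs)"
  using k
proof (cases rule: of_degree_cases)
  case 1
  then show ?thesis by (simp add: wedge_zero ext_deriv_zero)
next
  case (2 n)
  then show ?thesis using ext_deriv_wedge[OF M \<alpha> \<beta> 2(2)] by simp
qed

lemma wedge_commute_of_degree: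
  assumes k: "of_degree k \<alpha>" and l: "of_degree l \<beta>"
  shows "wedge \<alpha> \<beta> = (\<lambda>p vs. (-1) powi (k * l) * wedge \<beta> \<alpha> p vs)"
  using k
proof (cases rule: of_degree_cases)
  case 1
  then show ?thesis by (simp add: wedge_zero)
next
  case (2 m)
  show ?thesis
    using l
  proof (cases rule: of_degree_cases)
    case 1
    then show ?thesis by (simp add: wedge_zero)
  next
    case (2 n)
    then have "(-1) powi (k * l) = (-1::real) ^ (m * n)"
      using \<open>k = int m\<close> by (simp flip: of_nat_mult)
    then show ?thesis using wedge_commute[of m \<alpha> n \<beta>] 2 \<open>\<And>p. homogeneous m (\<alpha> p)\<close> by simp
  qed
qed

lemma signed_of_degree:
  assumes "of_degree k \<alpha>"
  shows "signed \<alpha> = (\<lambda>p vs. (-1) powi k * \<alpha> p vs)"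
proof (intro ext)
  fix p vs
  show "signed \<alpha> p vs = (-1) powi k * \<alpha> p vs"
  proof (cases "\<alpha> p vs = 0")
    case False
    then have "k = int (length vs)" using assms unfolding of_degree_def by simp
    then show ?thesis by (simp add: signed_def)
  qed (simp add: signed_def)
qed

definition component :: "int \<Rightarrow> ('a, 'e) form \<Rightarrow> ('a, 'e) form" where
  "component k \<omega> = (\<lambda>p vs. if int (length vs) = k then \<omega> p vs else 0)"

lemma of_degree_component: "of_degree k (component k \<omega>)"
  by (simp add: of_degree_def component_def)

lemma smooth_form_component:
  assumes M: "smooth_manifold M" and \<omega>: "smooth_form M \<omega>"
  shows "smooth_form M (component k \<omega>)"
proof (cases "k < 0")
  case True
  then have "component k \<omega> = (\<lambda>p vs. 0)" by (auto simp: component_def fun_eq_iff)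
  then show ?thesis by (simp only: smooth_form_zero)
next
  case False
  then obtain n where "k = int n" using nonneg_int_cases[of k] by auto
  then have "component k \<omega> = degree_part n \<omega>" by (simp add: component_def degree_part_def fun_eq_iff)
  then show ?thesis using \<omega> smooth_form_degree_part[OF M, of \<omega>] forms_iff[OF M] by simp
qed

lemma finite_component:
  assumes "bounded_degree \<omega>"
  shows "finite {k. component k \<omega> \<noteq> (\<lambda>p vs. 0)}"
proof -
  obtain n where n: "\<And>p vs. \<omega> p vs \<noteq> 0 \<Longrightarrow> length vs < n"
    using assms unfolding bounded_degree_def by blast
  have "{k. component k \<omega> \<noteq> (\<lambda>p vs. 0)} \<subseteq> {0..int n}"
  proof
    fix k assume "k \<in> {k. component k \<omega> \<noteq> (\<lambda>p vs. 0)}"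
    then obtain p vs where "component k \<omega> p vs \<noteq> 0" by (auto simp: fun_eq_iff)
    then have "int (length vs) = k" "\<omega> p vs \<noteq> 0" by (auto simp: component_def split: if_splits)
    then show "k \<in> {0..int n}" using n[of p vs] by auto
  qed
  then show ?thesis by (rule finite_subset) simp
qed

text \<open>At a list of given length only one summand survives. The shift \<open>s\<close> accommodates the second component of the
  cone, where it is \<open>2p - 1\<close>.\<close>

lemma sum_of_degree:
  assumes "\<And>k. of_degree (k - s) (x k)" "finite S" "{k. x k \<noteq> (\<lambda>p vs. 0)} \<subseteq> S"
  shows "(\<Sum>k\<in>S. x k p vs) = x (int (length vs) + s) p vs"
proof -
  have "x k p vs = (if k = int (length vs) + s then x k p vs else 0)" for k
    using of_degreeD[OF assms(1)[of k], of vs p] by auto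
  then have "(\<Sum>k\<in>S. x k p vs) = (\<Sum>k\<in>S. if k = int (length vs) + s then x k p vs else 0)"
    by (rule sum.cong[OF refl])
  also have "\<dots> = (if int (length vs) + s \<in> S then x (int (length vs) + s) p vs else 0)"
    using assms(2) by simp
  also have "\<dots> = x (int (length vs) + s) p vs"
  proof (cases "int (length vs) + s \<in> S")
    case False
    then have "x (int (length vs) + s) = (\<lambda>p vs. 0)" using assms(3) by blast
    then show ?thesis by simp
  qed simp
  finally show ?thesis .
qed

text \<open>Over a ring with unit, closure under additive inverses follows from closure under scalars.\<close>

lemma submodule_if_closed:
  assumes "Module.module real_ring A" "H \<subseteq> carrier A" "\<zero>\<^bsub>A\<^esub> \<in> H"
    and "\<And>a b. a \<in> H \<Longrightarrow> b \<in> H \<Longrightarrow> a \<oplus>\<^bsub>A\<^esub> b \<in> H"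
    and smult: "\<And>r a. a \<in> H \<Longrightarrow> r \<odot>\<^bsub>A\<^esub> a \<in> H"
  shows "submodule H real_ring A"
proof -
  interpret A: Module.module real_ring A by fact
  show ?thesis
  proof (rule A.submoduleI)
    fix a assume a: "a \<in> H"
    then have "\<ominus>\<^bsub>A\<^esub> a = (\<ominus>\<^bsub>real_ring\<^esub> \<one>\<^bsub>real_ring\<^esub>) \<odot>\<^bsub>A\<^esub> a"
      using A.smult_l_minus[of "\<one>\<^bsub>real_ring\<^esub>" a] assms(2) A.smult_one by auto
    then show "\<ominus>\<^bsub>A\<^esub> a \<in> H" using smult[OF a] by simp
  qed (use assms in auto)
qed

lemma real_ring_simps:
  "carrier real_ring = UNIV" "x \<otimes>\<^bsub>real_ring\<^esub> y = x * y" "x \<oplus>\<^bsub>real_ring\<^esub> y = x + y" "\<one>\<^bsub>real_ring\<^esub> = 1"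
  by (simp_all add: ring_of_type_algebra_def)

lemma abelian_group_de_rham:
  assumes M: "smooth_manifold M"
  shows "abelian_group (de_rham M)"
proof (rule abelian_groupI)
  fix \<alpha> assume "\<alpha> \<in> carrier (de_rham M)"
  then show "\<exists>\<beta>\<in>carrier (de_rham M). \<beta> \<oplus>\<^bsub>de_rham M\<^esub> \<alpha> = \<zero>\<^bsub>de_rham M\<^esub>"
    by (intro bexI[of _ "\<lambda>p vs. (-1) * \<alpha> p vs"])
       (simp_all add: de_rham_carrier[OF M] de_rham_ops smooth_form_cmult[OF M, of \<alpha> "-1", simplified]
         bounded_cmult[of \<alpha> "-1", simplified])
qed (simp_all add: de_rham_carrier[OF M] de_rham_ops smooth_form_add[OF M] bounded_add smooth_form_zero
      bounded_zero add_ac)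

lemma module_de_rham:
  assumes M: "smooth_manifold M"
  shows "Module.module real_ring (de_rham M)"
  by (rule moduleI[OF cring_from_type_algebra abelian_group_de_rham[OF M]])
     (simp_all add: de_rham_carrier[OF M] de_rham_ops smooth_form_cmult[OF M] bounded_cmult real_ring_simps
       algebra_simps)

lemma finsum_de_rham:
  assumes M: "smooth_manifold M" and "finite S" "\<And>k. k \<in> S \<Longrightarrow> x k \<in> carrier (de_rham M)"
  shows "finsum (de_rham M) x S = (\<lambda>p vs. \<Sum>k\<in>S. x k p vs)"
proof -
  interpret abelian_group "de_rham M" by (rule abelian_group_de_rham[OF M])
  show ?thesis
    using assms(2,3)
  proof (induction S rule: finite_induct)
    case (insert k S)
    have "finsum (de_rham M) x (insert k S) = x k \<oplus>\<^bsub>de_rham M\<^esub> finsum (de_rham M) x S"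
      by (rule finsum_insert) (use insert in auto)
    then show ?case using insert by (simp add: de_rham_ops)
  qed (simp add: de_rham_ops)
qed

text \<open>The decomposition into homogeneous components is unique because the component of degree \<open>k\<close> is the
  restriction of the form to lists of length \<open>k\<close>.\<close>

lemma cochain_complex_de_rham:
  assumes M: "smooth_manifold M"
  shows "cochain_complex (de_rham M)"
proof (rule cochain_complex.intro)
  let ?\<Omega> = "de_rham M"
  show "Module.module real_ring ?\<Omega>" by (rule module_de_rham[OF M])
  show "submodule (grade ?\<Omega> k) real_ring ?\<Omega>" for k
    by (rule submodule_if_closed[OF module_de_rham[OF M]])
       (auto simp: de_rham_grade[OF M] de_rham_carrier[OF M] de_rham_ops bounded_of_degree smooth_form_zero of_degree_zero
         smooth_form_add[OF M] of_degree_add smooth_form_cmult[OF M] of_degree_cmult)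
  show "\<exists>!x. (\<forall>k. x k \<in> grade ?\<Omega> k) \<and> finite {k. x k \<noteq> \<zero>\<^bsub>?\<Omega>\<^esub>} \<and>
      \<omega> = finsum ?\<Omega> x {k. x k \<noteq> \<zero>\<^bsub>?\<Omega>\<^esub>}" if "\<omega> \<in> carrier ?\<Omega>" for \<omega>
  proof (rule ex1I[of _ "\<lambda>k. component k \<omega>"])
    have \<omega>: "smooth_form M \<omega>" "bounded_degree \<omega>" using that by (simp_all add: de_rham_carrier[OF M])
    have "component k \<omega> \<in> carrier ?\<Omega>" for k
      using smooth_form_component[OF M \<omega>(1)] bounded_of_degree[OF of_degree_component]
      by (simp add: de_rham_carrier[OF M])
    then have "finsum ?\<Omega> (\<lambda>k. component k \<omega>) {k. component k \<omega> \<noteq> (\<lambda>p vs. 0)} =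
        (\<lambda>p vs. \<Sum>k\<in>{k. component k \<omega> \<noteq> (\<lambda>p vs. 0)}. component k \<omega> p vs)"
      by (intro finsum_de_rham[OF M finite_component[OF \<omega>(2)]])
    also have "\<dots> = \<omega>"
    proof (intro ext)
      fix p vs
      have "(\<Sum>k\<in>{k. component k \<omega> \<noteq> (\<lambda>p vs. 0)}. component k \<omega> p vs) = component (int (length vs) + 0) \<omega> p vs"
        by (rule sum_of_degree) (simp_all only: diff_0_right of_degree_component finite_component[OF \<omega>(2)] subset_refl)
      then show "(\<Sum>k\<in>{k. component k \<omega> \<noteq> (\<lambda>p vs. 0)}. component k \<omega> p vs) = \<omega> p vs"
        by (simp add: component_def)
    qed
    finally show "(\<forall>k. component k \<omega> \<in> grade ?\<Omega> k) \<and> finite {k. component k \<omega> \<noteq> \<zero>\<^bsub>?\<Omega>\<^esub>} \<and>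
      \<omega> = finsum ?\<Omega> (\<lambda>k. component k \<omega>) {k. component k \<omega> \<noteq> \<zero>\<^bsub>?\<Omega>\<^esub>}"
      by (simp add: de_rham_grade[OF M] de_rham_ops smooth_form_component[OF M \<omega>(1)] of_degree_component
          finite_component[OF \<omega>(2)])
  next
    fix x assume x: "(\<forall>k. x k \<in> grade ?\<Omega> k) \<and> finite {k. x k \<noteq> \<zero>\<^bsub>?\<Omega>\<^esub>} \<and>
      \<omega> = finsum ?\<Omega> x {k. x k \<noteq> \<zero>\<^bsub>?\<Omega>\<^esub>}"
    let ?S = "{k. x k \<noteq> (\<lambda>p vs. 0)}"
    have xk: "smooth_form M (x k)" "of_degree k (x k)" for k
      using x by (auto simp: de_rham_grade[OF M])
    have fin: "finite ?S" using x by (simp add: de_rham_ops)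
    have "\<omega> = (\<lambda>p vs. \<Sum>k\<in>?S. x k p vs)"
      using x finsum_de_rham[OF M fin, of x]
      by (simp add: de_rham_ops de_rham_carrier[OF M] xk(1) bounded_of_degree[OF xk(2)])
    then have "\<omega> p vs = x (int (length vs)) p vs" for p vs
      using sum_of_degree[of 0 x ?S p vs] xk(2) fin by simp
    then have "x k p vs = component k \<omega> p vs" for k p vs
      using of_degreeD[OF xk(2)[of k], of vs p] by (auto simp: component_def)
    then show "x = (\<lambda>k. component k \<omega>)" by blast
  qed
qed (auto simp: de_rham_grade[OF M] de_rham_carrier[OF M] de_rham_ops ext_deriv_add[OF M] ext_deriv_cmult[OF M]
      ext_deriv_ext_deriv[OF M] smooth_form_ext_deriv[OF M] of_degree_ext_deriv)

lemma ring_de_rham: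
  assumes M: "smooth_manifold M"
  shows "Ring.ring (de_rham M)"
proof (rule ringI[OF abelian_group_de_rham[OF M]])
  show "monoid (de_rham M)"
    by (rule monoidI)
       (simp_all only: de_rham_carrier[OF M] de_rham_ops smooth_form_wedge[OF M] bounded_wedge wedge_assoc wedge_unit[OF M]
         smooth_form_unit[OF M] bounded_of_degree[OF of_degree_unit])
qed (simp_all only: de_rham_ops wedge_add_left wedge_add_right)

lemma cdga_de_rham:
  assumes M: "smooth_manifold M"
  shows "cdga (de_rham M)"
proof (rule cdga.intro)
  fix \<alpha> \<beta> :: "('a, 'b) form" and k l :: int
  let ?\<Omega> = "de_rham M"
  assume "\<alpha> \<in> grade ?\<Omega> k" "\<beta> \<in> grade ?\<Omega> l"
  then show "\<alpha> \<otimes>\<^bsub>?\<Omega>\<^esub> \<beta> = ((-1) powi (k * l)) \<odot>\<^bsub>?\<Omega>\<^esub> (\<beta> \<otimes>\<^bsub>?\<Omega>\<^esub> \<alpha>)"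
    using wedge_commute_of_degree[of k \<alpha> l \<beta>] by (simp only: de_rham_grade[OF M] de_rham_ops)
next
  fix \<alpha> \<beta> :: "('a, 'b) form" and k :: int
  let ?\<Omega> = "de_rham M"
  assume "\<alpha> \<in> grade ?\<Omega> k" "\<beta> \<in> carrier ?\<Omega>"
  then show "dif ?\<Omega> (\<alpha> \<otimes>\<^bsub>?\<Omega>\<^esub> \<beta>) =
      (dif ?\<Omega> \<alpha> \<otimes>\<^bsub>?\<Omega>\<^esub> \<beta>) \<oplus>\<^bsub>?\<Omega>\<^esub> ((-1) powi k) \<odot>\<^bsub>?\<Omega>\<^esub> (\<alpha> \<otimes>\<^bsub>?\<Omega>\<^esub> dif ?\<Omega> \<beta>)"
    using ext_deriv_wedge_of_degree[OF M, of \<alpha> \<beta> k]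
    by (simp only: de_rham_grade[OF M] de_rham_carrier[OF M] de_rham_ops)
qed (simp_all only: cochain_complex_de_rham[OF M] ring_de_rham[OF M] de_rham_grade[OF M] de_rham_ops wedge_cmult_left
      wedge_cmult_right smooth_form_unit[OF M] of_degree_unit smooth_form_wedge[OF M] of_degree_wedge)

section \<open>The mapping cone algebra\<close>

lemma cone_ops:
  "(\<alpha>, \<alpha>') \<otimes>\<^bsub>cone_algebra M \<tau> p\<^esub> (\<beta>, \<beta>') =
     (wedge \<alpha> \<beta>, \<lambda>q vs. wedge \<alpha>' \<beta> q vs + wedge (signed \<alpha>) \<beta>' q vs)"
  "\<one>\<^bsub>cone_algebra M \<tau> p\<^esub> = (unit_form M, \<lambda>q vs. 0)"
  "\<zero>\<^bsub>cone_algebra M \<tau> p\<^esub> = (\<lambda>q vs. 0, \<lambda>q vs. 0)"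
  "(\<alpha>, \<alpha>') \<oplus>\<^bsub>cone_algebra M \<tau> p\<^esub> (\<beta>, \<beta>') = (\<lambda>q vs. \<alpha> q vs + \<beta> q vs, \<lambda>q vs. \<alpha>' q vs + \<beta>' q vs)"
  "r \<odot>\<^bsub>cone_algebra M \<tau> p\<^esub> (\<alpha>, \<alpha>') = (\<lambda>q vs. r * \<alpha> q vs, \<lambda>q vs. r * \<alpha>' q vs)"
  "dif (cone_algebra M \<tau> p) (\<alpha>, \<alpha>') =
     (\<lambda>q vs. ext_deriv M \<alpha> q vs + wedge (\<tau> [^]\<^bsub>de_rham M\<^esub> p) \<alpha>' q vs, \<lambda>q vs. (-1) * ext_deriv M \<alpha>' q vs)"
  by (simp_all add: cone_algebra_def Let_def de_rham_ops)

lemma cone_carrier: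
  "smooth_manifold M \<Longrightarrow> (\<alpha>, \<alpha>') \<in> carrier (cone_algebra M \<tau> p) \<longleftrightarrow>
     (smooth_form M \<alpha> \<and> bounded_degree \<alpha>) \<and> (smooth_form M \<alpha>' \<and> bounded_degree \<alpha>')"
  by (simp add: cone_algebra_def Let_def de_rham_carrier)

lemma cone_grade:
  "smooth_manifold M \<Longrightarrow> (\<alpha>, \<alpha>') \<in> grade (cone_algebra M \<tau> p) k \<longleftrightarrow>
     (smooth_form M \<alpha> \<and> of_degree k \<alpha>) \<and> (smooth_form M \<alpha>' \<and> of_degree (k - 2 * int p + 1) \<alpha>')"
  by (simp add: cone_algebra_def Let_def de_rham_grade)

lemma smooth_form_signed:
  assumes M: "smooth_manifold M" and \<alpha>: "smooth_form M \<alpha>"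
  shows "smooth_form M (signed \<alpha>)"
proof -
  have "degree_part k (signed \<alpha>) \<in> forms M k" for k
  proof -
    have *: "smooth_form M (degree_part k \<alpha>)"
      using \<alpha> smooth_form_degree_part[OF M, of \<alpha>] forms_iff[OF M] by blast
    have "degree_part k (signed \<alpha>) = (\<lambda>q vs. (-1) ^ k * degree_part k \<alpha> q vs)"
      by (auto simp: degree_part_def signed_def fun_eq_iff)
    then have "smooth_form M (degree_part k (signed \<alpha>))"
      using smooth_form_cmult[OF M *] by simp
    then show ?thesis unfolding forms_iff[OF M] by (simp add: homogeneous_def degree_part_def)
  qed
  then show ?thesis using smooth_form_degree_part[OF M] by blast
qed

lemma bounded_signed: "bounded_degree \<alpha> \<Longrightarrow> bounded_degree (signed \<alpha>)"
  by (simp add: bounded_degree_def signed_def)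

lemma signed_add: "signed (\<lambda>q vs. \<alpha> q vs + \<beta> q vs) = (\<lambda>q vs. signed \<alpha> q vs + signed \<beta> q vs)"
  by (simp add: signed_def distrib_left)

lemma signed_cmult: "signed (\<lambda>q vs. r * \<alpha> q vs) = (\<lambda>q vs. r * signed \<alpha> q vs)"
  by (simp add: signed_def mult.left_commute)

lemma signed_unit: "signed (unit_form M) = unit_form M"
  by (auto simp: signed_def fun_eq_iff)

text \<open>The Leibniz rule for \<open>1 \<and> 1 = 1\<close> gives \<open>d1 = d1 + d1\<close>.\<close>

lemma ext_deriv_unit:
  assumes M: "smooth_manifold M"
  shows "ext_deriv M (unit_form M) = (\<lambda>q vs. 0)"
proof -
  note u = smooth_form_unit[OF M]
  have "ext_deriv M (unit_form M) = (\<lambda>q vs. ext_deriv M (unit_form M) q vs + (-1) powi 0 * ext_deriv M (unit_form M) q vs)"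
    using ext_deriv_wedge_of_degree[OF M u u of_degree_unit]
    by (simp only: wedge_unit[OF M u] wedge_unit[OF M smooth_form_ext_deriv[OF M u]])
  from fun_cong[OF fun_cong[OF this]] have "ext_deriv M (unit_form M) q vs = 0" for q vs
    unfolding power_int_0_right mult_1 by (rule add_cancel_right_right[THEN iffD1])
  then show ?thesis by blast
qed

lemma closed_power:
  assumes M: "smooth_manifold M" and \<tau>: "smooth_form M \<tau>" "of_degree 2 \<tau>" "ext_deriv M \<tau> = (\<lambda>q vs. 0)"
  shows "smooth_form M (\<tau> [^]\<^bsub>de_rham M\<^esub> p)" "of_degree (2 * int p) (\<tau> [^]\<^bsub>de_rham M\<^esub> p)"
    "ext_deriv M (\<tau> [^]\<^bsub>de_rham M\<^esub> p) = (\<lambda>q vs. 0)"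
proof -
  interpret ring "de_rham M" by (rule ring_de_rham[OF M])
  have "smooth_form M (\<tau> [^]\<^bsub>de_rham M\<^esub> p) \<and> of_degree (2 * int p) (\<tau> [^]\<^bsub>de_rham M\<^esub> p) \<and>
    ext_deriv M (\<tau> [^]\<^bsub>de_rham M\<^esub> p) = (\<lambda>q vs. 0)"
  proof (induction p)
    case 0
    show ?case using smooth_form_unit[OF M] of_degree_unit ext_deriv_unit[OF M] by (simp add: de_rham_ops)
  next
    case (Suc p)
    let ?t = "\<tau> [^]\<^bsub>de_rham M\<^esub> p"
    have t: "smooth_form M ?t" "of_degree (2 * int p) ?t" "ext_deriv M ?t = (\<lambda>q vs. 0)"
      using Suc.IH by blast+
    have pow: "\<tau> [^]\<^bsub>de_rham M\<^esub> Suc p = wedge ?t \<tau>" by (simp add: de_rham_ops)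
    have deg: "2 * int (Suc p) = 2 * int p + 2" by simp
    show ?case
      unfolding pow deg ext_deriv_wedge_of_degree[OF M t(1) \<tau>(1) t(2)] t(3) \<tau>(3) wedge_zero
      using smooth_form_wedge[OF M t(1) \<tau>(1)] of_degree_wedge[OF t(2) \<tau>(2)] by simp
  qed
  then show "smooth_form M (\<tau> [^]\<^bsub>de_rham M\<^esub> p)" "of_degree (2 * int p) (\<tau> [^]\<^bsub>de_rham M\<^esub> p)"
    "ext_deriv M (\<tau> [^]\<^bsub>de_rham M\<^esub> p) = (\<lambda>q vs. 0)" by blast+
qed

text \<open>All sign identities of the cone depend on the parities of the degrees only.\<close>

lemma minus_one_powi: "(-1::real) powi k = (if even k then 1 else -1)"
  using power_int_minus_left[of "1::real" k] by simp

context
  fixes M :: "('a, 'e::real_inner) manifold" and \<tau> :: "('a, 'e) form" and p :: nat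
  assumes M: "smooth_manifold M" and \<tau>: "smooth_form M \<tau>" "of_degree 2 \<tau>" "ext_deriv M \<tau> = (\<lambda>q vs. 0)"
begin

lemma abelian_group_cone: "abelian_group (cone_algebra M \<tau> p)"
proof (rule abelian_groupI)
  fix a assume a: "a \<in> carrier (cone_algebra M \<tau> p)"
  obtain \<alpha> \<alpha>' where eq: "a = (\<alpha>, \<alpha>')" by (cases a)
  have *: "smooth_form M \<alpha>" "bounded_degree \<alpha>" "smooth_form M \<alpha>'" "bounded_degree \<alpha>'"
    using a unfolding eq cone_carrier[OF M] by auto
  have "(\<lambda>q vs. (-1) * \<alpha> q vs, \<lambda>q vs. (-1) * \<alpha>' q vs) \<in> carrier (cone_algebra M \<tau> p)"
    unfolding cone_carrier[OF M] by (intro conjI smooth_form_cmult[OF M] bounded_cmult *)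
  then show "\<exists>b\<in>carrier (cone_algebra M \<tau> p). b \<oplus>\<^bsub>cone_algebra M \<tau> p\<^esub> a = \<zero>\<^bsub>cone_algebra M \<tau> p\<^esub>"
    by (rule bexI[rotated]) (simp add: eq cone_ops)
qed (auto simp: cone_carrier[OF M] cone_ops smooth_form_add[OF M] bounded_add smooth_form_zero
      bounded_zero add_ac)

lemma module_cone: "Module.module real_ring (cone_algebra M \<tau> p)"
  by (rule moduleI[OF cring_from_type_algebra abelian_group_cone])
     (auto simp: cone_carrier[OF M] cone_ops smooth_form_cmult[OF M] bounded_cmult real_ring_simps
       algebra_simps)

lemma finsum_cone:
  assumes "finite S" "\<And>k. k \<in> S \<Longrightarrow> x k \<in> carrier (cone_algebra M \<tau> p)"
  shows "finsum (cone_algebra M \<tau> p) x S = (\<lambda>q vs. \<Sum>k\<in>S. fst (x k) q vs, \<lambda>q vs. \<Sum>k\<in>S. snd (x k) q vs)"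
proof -
  interpret abelian_group "cone_algebra M \<tau> p" by (rule abelian_group_cone)
  show ?thesis
    using assms
  proof (induction S rule: finite_induct)
    case (insert k S)
    have "finsum (cone_algebra M \<tau> p) x (insert k S) =
        (fst (x k), snd (x k)) \<oplus>\<^bsub>cone_algebra M \<tau> p\<^esub> finsum (cone_algebra M \<tau> p) x S"
      unfolding prod.collapse by (rule finsum_insert) (use insert in auto)
    also have "\<dots> = (fst (x k), snd (x k)) \<oplus>\<^bsub>cone_algebra M \<tau> p\<^esub>
        (\<lambda>q vs. \<Sum>k\<in>S. fst (x k) q vs, \<lambda>q vs. \<Sum>k\<in>S. snd (x k) q vs)"
      using insert by simp
    finally show ?case unfolding cone_ops by (simp add: insert.hyps)
  qed (simp add: cone_ops)
qed

text \<open>The two components are decomposed separately, the second one with its degrees shifted by \<open>2p - 1\<close>.\<close>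

lemma cone_direct_sum:
  assumes a: "a \<in> carrier (cone_algebra M \<tau> p)"
  shows "\<exists>!x. (\<forall>k. x k \<in> grade (cone_algebra M \<tau> p) k) \<and> finite {k. x k \<noteq> \<zero>\<^bsub>cone_algebra M \<tau> p\<^esub>} \<and>
      a = finsum (cone_algebra M \<tau> p) x {k. x k \<noteq> \<zero>\<^bsub>cone_algebra M \<tau> p\<^esub>}"
proof -
  let ?C = "cone_algebra M \<tau> p"
  define s where "s = 2 * int p - 1"
  have s: "k - 2 * int p + 1 = k - s" for k by (simp add: s_def)
  obtain \<alpha> \<alpha>' where eq: "a = (\<alpha>, \<alpha>')" by (cases a)
  have \<alpha>: "smooth_form M \<alpha>" "bounded_degree \<alpha>" "smooth_form M \<alpha>'" "bounded_degree \<alpha>'"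
    using a unfolding eq cone_carrier[OF M] by auto
  have sum: "finsum ?C x {k. x k \<noteq> \<zero>\<^bsub>?C\<^esub>} =
      (\<lambda>q vs. fst (x (int (length vs))) q vs, \<lambda>q vs. snd (x (int (length vs) + s)) q vs)"
    if x: "\<And>k. x k \<in> grade ?C k" and fin: "finite {k. x k \<noteq> \<zero>\<^bsub>?C\<^esub>}" for x
  proof -
    have x': "smooth_form M (fst (x k))" "of_degree k (fst (x k))"
      "smooth_form M (snd (x k))" "of_degree (k - s) (snd (x k))" for k
      using x[of k] by (cases "x k"; simp add: cone_grade[OF M] s)+
    have "x k \<in> carrier ?C" for k
      using x'[of k] bounded_of_degree by (cases "x k") (auto simp: cone_carrier[OF M])
    then have "finsum ?C x {k. x k \<noteq> \<zero>\<^bsub>?C\<^esub>} = (\<lambda>q vs. \<Sum>k\<in>{k. x k \<noteq> \<zero>\<^bsub>?C\<^esub>}. fst (x k) q vs,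
        \<lambda>q vs. \<Sum>k\<in>{k. x k \<noteq> \<zero>\<^bsub>?C\<^esub>}. snd (x k) q vs)"
      by (intro finsum_cone fin)
    moreover have "(\<Sum>k\<in>{k. x k \<noteq> \<zero>\<^bsub>?C\<^esub>}. fst (x k) q vs) = fst (x (int (length vs) + 0)) q vs" for q vs
      by (rule sum_of_degree) (use x'(2) fin in \<open>auto simp: cone_ops\<close>)
    moreover have "(\<Sum>k\<in>{k. x k \<noteq> \<zero>\<^bsub>?C\<^esub>}. snd (x k) q vs) = snd (x (int (length vs) + s)) q vs" for q vs
      by (rule sum_of_degree) (use x'(4) fin in \<open>auto simp: cone_ops\<close>)
    ultimately show ?thesis by simp
  qed
  define y where "y k = (component k \<alpha>, component (k - s) \<alpha>')" for k
  have y: "y k \<in> grade ?C k" for k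
    by (simp add: y_def cone_grade[OF M] s smooth_form_component[OF M] \<alpha> of_degree_component)
  have fin: "finite {k. y k \<noteq> \<zero>\<^bsub>?C\<^esub>}"
  proof (rule finite_subset)
    show "{k. y k \<noteq> \<zero>\<^bsub>?C\<^esub>} \<subseteq> {k. component k \<alpha> \<noteq> (\<lambda>q vs. 0)} \<union>
        (\<lambda>k. k + s) ` {k. component k \<alpha>' \<noteq> (\<lambda>q vs. 0)}"
    proof
      fix k assume "k \<in> {k. y k \<noteq> \<zero>\<^bsub>?C\<^esub>}"
      then have "component k \<alpha> \<noteq> (\<lambda>q vs. 0) \<or> component (k - s) \<alpha>' \<noteq> (\<lambda>q vs. 0)"
        by (simp add: y_def cone_ops)
      moreover have "k = (k - s) + s" by simp
      ultimately show "k \<in> {k. component k \<alpha> \<noteq> (\<lambda>q vs. 0)} \<union>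
        (\<lambda>k. k + s) ` {k. component k \<alpha>' \<noteq> (\<lambda>q vs. 0)}" by blast
    qed
  qed (intro finite_UnI finite_imageI finite_component \<alpha>)
  show ?thesis
  proof (rule ex1I[of _ y])
    have "a = finsum ?C y {k. y k \<noteq> \<zero>\<^bsub>?C\<^esub>}"
      unfolding sum[OF y fin] eq by (simp add: y_def component_def)
    with y fin show "(\<forall>k. y k \<in> grade ?C k) \<and> finite {k. y k \<noteq> \<zero>\<^bsub>?C\<^esub>} \<and> a = finsum ?C y {k. y k \<noteq> \<zero>\<^bsub>?C\<^esub>}"
      by blast
  next
    fix x assume x: "(\<forall>k. x k \<in> grade ?C k) \<and> finite {k. x k \<noteq> \<zero>\<^bsub>?C\<^esub>} \<and> a = finsum ?C x {k. x k \<noteq> \<zero>\<^bsub>?C\<^esub>}"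
    then have "(\<alpha>, \<alpha>') = (\<lambda>q vs. fst (x (int (length vs))) q vs, \<lambda>q vs. snd (x (int (length vs) + s)) q vs)"
      using sum[of x] eq by simp
    then have \<alpha>x: "\<alpha> q vs = fst (x (int (length vs))) q vs" "\<alpha>' q vs = snd (x (int (length vs) + s)) q vs" for q vs
      by simp_all
    show "x = y"
    proof
      fix k
      have d: "of_degree k (fst (x k))" "of_degree (k - s) (snd (x k))"
        using x by (cases "x k"; metis cone_grade[OF M] s fst_conv snd_conv)+
      have "fst (x k) q vs = component k \<alpha> q vs" "snd (x k) q vs = component (k - s) \<alpha>' q vs" for q vs
        using of_degreeD[OF d(1), of vs q] of_degreeD[OF d(2), of vs q] by (auto simp: component_def \<alpha>x)
      then have "fst (x k) = component k \<alpha>" "snd (x k) = component (k - s) \<alpha>'" by blast+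
      then show "x k = y k" unfolding y_def by (metis prod.collapse)
    qed
  qed
qed

abbreviation (input) power_form :: "('a, 'e) form" where
  "power_form \<equiv> \<tau> [^]\<^bsub>de_rham M\<^esub> p"

lemmas power_form = closed_power[OF M \<tau>, of p]

lemma power_form_commute: "wedge power_form \<alpha> = wedge \<alpha> power_form"
proof -
  have "of_degree (int (2 * p)) power_form" using power_form(2) by simp
  then have "homogeneous (2 * p) (power_form q)" for q unfolding of_degree_nat by blast
  then show ?thesis by (rule wedge_commute_even) simp
qed

text \<open>This and \<open>d \<circ> d = 0\<close> give the square of the differential of the cone: the two terms
  \<open>\<tau>\<^sup>p \<and> d\<xi>\<close> occur with opposite signs.\<close>

lemma ext_deriv_power_form_wedge:
  assumes "smooth_form M \<alpha>"
  shows "ext_deriv M (wedge power_form \<alpha>) = wedge power_form (ext_deriv M \<alpha>)"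
  unfolding ext_deriv_wedge_of_degree[OF M power_form(1) assms power_form(2)] power_form(3) wedge_zero
  by (simp add: minus_one_powi)

lemma cochain_complex_cone: "cochain_complex (cone_algebra M \<tau> p)"
proof (rule cochain_complex.intro)
  let ?C = "cone_algebra M \<tau> p"
  show "Module.module real_ring ?C" by (rule module_cone)
  show "submodule (grade ?C k) real_ring ?C" for k
    by (rule submodule_if_closed[OF module_cone])
       (auto simp: cone_grade[OF M] cone_carrier[OF M] cone_ops bounded_of_degree smooth_form_zero of_degree_zero
         smooth_form_add[OF M] of_degree_add smooth_form_cmult[OF M] of_degree_cmult)
  fix a b :: "('a, 'e) form \<times> ('a, 'e) form" and r :: real and k :: int
  obtain \<alpha> \<alpha>' \<beta> \<beta>' where eq: "a = (\<alpha>, \<alpha>')" "b = (\<beta>, \<beta>')" by (cases a; cases b)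
  {
    assume "a \<in> carrier ?C"
    then show "\<exists>!x. (\<forall>k. x k \<in> grade ?C k) \<and> finite {k. x k \<noteq> \<zero>\<^bsub>?C\<^esub>} \<and> a = finsum ?C x {k. x k \<noteq> \<zero>\<^bsub>?C\<^esub>}"
      by (rule cone_direct_sum)
  }
  {
    assume "a \<in> carrier ?C" "b \<in> carrier ?C"
    then show "dif ?C (a \<oplus>\<^bsub>?C\<^esub> b) = dif ?C a \<oplus>\<^bsub>?C\<^esub> dif ?C b"
      unfolding eq cone_carrier[OF M] by (simp add: cone_ops ext_deriv_add[OF M] wedge_add_right add_ac)
  }
  {
    assume "a \<in> carrier ?C"
    then show "dif ?C (r \<odot>\<^bsub>?C\<^esub> a) = r \<odot>\<^bsub>?C\<^esub> dif ?C a"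
      unfolding eq cone_carrier[OF M] by (simp add: cone_ops ext_deriv_cmult[OF M] wedge_cmult_right distrib_left)
  }
  {
    assume "a \<in> grade ?C k"
    then have *: "smooth_form M \<alpha>" "of_degree k \<alpha>" "smooth_form M \<alpha>'" "of_degree (k - 2 * int p + 1) \<alpha>'"
      unfolding eq cone_grade[OF M] by auto
    have d1: "of_degree (k + 1) (wedge power_form \<alpha>')"
      using of_degree_wedge[OF power_form(2) *(4)] by (simp add: algebra_simps)
    have d2: "of_degree (k + 1 - 2 * int p + 1) (ext_deriv M \<alpha>')"
      using of_degree_ext_deriv[OF *(4)] by (simp add: algebra_simps)
    show "dif ?C a \<in> grade ?C (k + 1)"
      unfolding eq cone_ops cone_grade[OF M]
      by (intro conjI smooth_form_add[OF M] smooth_form_cmult[OF M] of_degree_add of_degree_cmult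
          smooth_form_ext_deriv[OF M] smooth_form_wedge[OF M] d1 d2 of_degree_ext_deriv[OF *(2)] * power_form(1))
  }
  {
    assume "a \<in> carrier ?C"
    then have *: "smooth_form M \<alpha>" "smooth_form M \<alpha>'" unfolding eq cone_carrier[OF M] by auto
    note sf = smooth_form_ext_deriv[OF M *(1)] smooth_form_ext_deriv[OF M *(2)] smooth_form_wedge[OF M power_form(1) *(2)]
    show "dif ?C (dif ?C a) = \<zero>\<^bsub>?C\<^esub>"
      unfolding eq cone_ops ext_deriv_add[OF M sf(1,3)] ext_deriv_cmult[OF M sf(2)] ext_deriv_ext_deriv[OF M *(1)]
        ext_deriv_ext_deriv[OF M *(2)] ext_deriv_power_form_wedge[OF *(2)] wedge_cmult_right
      by simp
  }
qed

lemma ring_cone: "Ring.ring (cone_algebra M \<tau> p)"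
proof (rule ringI[OF abelian_group_cone])
  let ?C = "cone_algebra M \<tau> p"
  show "monoid ?C"
  proof (rule monoidI)
    fix a b c :: "('a, 'e) form \<times> ('a, 'e) form"
    obtain \<alpha> \<alpha>' \<beta> \<beta>' \<gamma> \<gamma>' where eq: "a = (\<alpha>, \<alpha>')" "b = (\<beta>, \<beta>')" "c = (\<gamma>, \<gamma>')" by (cases a; cases b; cases c)
    {
      assume "a \<in> carrier ?C" "b \<in> carrier ?C"
      then show "a \<otimes>\<^bsub>?C\<^esub> b \<in> carrier ?C"
        unfolding eq cone_ops cone_carrier[OF M]
        by (intro conjI smooth_form_wedge[OF M] smooth_form_add[OF M] smooth_form_signed[OF M] bounded_wedge
            bounded_add bounded_signed) auto
    }
    show "a \<otimes>\<^bsub>?C\<^esub> b \<otimes>\<^bsub>?C\<^esub> c = a \<otimes>\<^bsub>?C\<^esub> (b \<otimes>\<^bsub>?C\<^esub> c)"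
      unfolding eq cone_ops by (simp only: wedge_assoc wedge_add_left wedge_add_right wedge_signed[symmetric] add.assoc)
    {
      assume "a \<in> carrier ?C"
      then have *: "smooth_form M \<alpha>" "smooth_form M \<alpha>'" unfolding eq cone_carrier[OF M] by auto
      show "\<one>\<^bsub>?C\<^esub> \<otimes>\<^bsub>?C\<^esub> a = a" "a \<otimes>\<^bsub>?C\<^esub> \<one>\<^bsub>?C\<^esub> = a"
        unfolding eq cone_ops signed_unit wedge_unit[OF M *(1)] wedge_unit[OF M *(2)] wedge_zero by simp_all
    }
  qed (unfold cone_ops cone_carrier[OF M], intro conjI smooth_form_unit[OF M] smooth_form_zero bounded_zero
        bounded_of_degree[OF of_degree_unit])
next
  fix a b c :: "('a, 'e) form \<times> ('a, 'e) form"
  let ?C = "cone_algebra M \<tau> p"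
  obtain \<alpha> \<alpha>' \<beta> \<beta>' \<gamma> \<gamma>' where eq: "a = (\<alpha>, \<alpha>')" "b = (\<beta>, \<beta>')" "c = (\<gamma>, \<gamma>')" by (cases a; cases b; cases c)
  show "(a \<oplus>\<^bsub>?C\<^esub> b) \<otimes>\<^bsub>?C\<^esub> c = a \<otimes>\<^bsub>?C\<^esub> c \<oplus>\<^bsub>?C\<^esub> b \<otimes>\<^bsub>?C\<^esub> c"
    "c \<otimes>\<^bsub>?C\<^esub> (a \<oplus>\<^bsub>?C\<^esub> b) = c \<otimes>\<^bsub>?C\<^esub> a \<oplus>\<^bsub>?C\<^esub> c \<otimes>\<^bsub>?C\<^esub> b"
    unfolding eq cone_ops by (simp_all only: wedge_add_left wedge_add_right signed_add add_ac)
qed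

text \<open>On homogeneous elements all products are products of forms up to sign. The sign rules for \<open>\<theta>\<close> hold because
  the degree of \<open>\<theta>\<close> is odd, that is, the degrees of the two components of a homogeneous element have opposite parity,
  and because \<open>\<tau>\<^sup>p\<close> can be moved past any form.\<close>

lemma cdga_cone: "cdga (cone_algebra M \<tau> p)"
proof (rule cdga.intro)
  let ?C = "cone_algebra M \<tau> p"
  show "cochain_complex ?C" by (rule cochain_complex_cone)
  show "Ring.ring ?C" by (rule ring_cone)
  show "\<one>\<^bsub>?C\<^esub> \<in> grade ?C 0"
    unfolding cone_ops cone_grade[OF M] by (intro conjI smooth_form_unit[OF M] of_degree_unit smooth_form_zero of_degree_zero)
  fix a b :: "('a, 'e) form \<times> ('a, 'e) form" and r :: real and k l :: int
  obtain \<alpha> \<alpha>' \<beta> \<beta>' where eq: "a = (\<alpha>, \<alpha>')" "b = (\<beta>, \<beta>')" by (cases a; cases b)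
  show "(r \<odot>\<^bsub>?C\<^esub> a) \<otimes>\<^bsub>?C\<^esub> b = r \<odot>\<^bsub>?C\<^esub> (a \<otimes>\<^bsub>?C\<^esub> b)" "a \<otimes>\<^bsub>?C\<^esub> (r \<odot>\<^bsub>?C\<^esub> b) = r \<odot>\<^bsub>?C\<^esub> (a \<otimes>\<^bsub>?C\<^esub> b)"
    unfolding eq cone_ops by (simp_all only: wedge_cmult_left wedge_cmult_right signed_cmult distrib_left)
  define k' where "k' = k - 2 * int p + 1"
  define l' where "l' = l - 2 * int p + 1"
  have even': "even k' \<longleftrightarrow> odd k" "even l' \<longleftrightarrow> odd l" unfolding k'_def l'_def by simp_all
  {
    assume "a \<in> grade ?C k" "b \<in> grade ?C l"
    then have a: "smooth_form M \<alpha>" "of_degree k \<alpha>" "smooth_form M \<alpha>'" "of_degree k' \<alpha>'"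
      and b: "smooth_form M \<beta>" "of_degree l \<beta>" "smooth_form M \<beta>'" "of_degree l' \<beta>'"
      unfolding eq cone_grade[OF M] k'_def l'_def by auto
    have sa: "signed \<alpha> = (\<lambda>q vs. (-1) powi k * \<alpha> q vs)" and sb: "signed \<beta> = (\<lambda>q vs. (-1) powi l * \<beta> q vs)"
      by (rule signed_of_degree[OF a(2)], rule signed_of_degree[OF b(2)])
    have "of_degree (k + l') (wedge \<alpha> \<beta>')" "of_degree (k' + l) (wedge \<alpha>' \<beta>)"
      by (rule of_degree_wedge[OF a(2) b(4)], rule of_degree_wedge[OF a(4) b(2)])
    moreover have "k + l' = k + l - 2 * int p + 1" "k' + l = k + l - 2 * int p + 1" by (simp_all add: k'_def l'_def)
    ultimately have d: "of_degree (k + l - 2 * int p + 1) (wedge \<alpha> \<beta>')" "of_degree (k + l - 2 * int p + 1) (wedge \<alpha>' \<beta>)"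
      by simp_all
    show "a \<otimes>\<^bsub>?C\<^esub> b \<in> grade ?C (k + l)"
      unfolding eq cone_ops cone_grade[OF M] sa wedge_cmult_left
      by (intro conjI smooth_form_add[OF M] smooth_form_cmult[OF M] smooth_form_wedge[OF M] of_degree_add of_degree_cmult
          of_degree_wedge[OF a(2) b(2)] d a b)
    have comm: "wedge \<alpha> \<beta> = (\<lambda>q vs. (-1) powi (k * l) * wedge \<beta> \<alpha> q vs)"
      "wedge \<alpha>' \<beta> = (\<lambda>q vs. (-1) powi (k' * l) * wedge \<beta> \<alpha>' q vs)"
      "wedge \<alpha> \<beta>' = (\<lambda>q vs. (-1) powi (k * l') * wedge \<beta>' \<alpha> q vs)"
      by (rule wedge_commute_of_degree; fact a b)+
    show "a \<otimes>\<^bsub>?C\<^esub> b = ((-1) powi (k * l)) \<odot>\<^bsub>?C\<^esub> (b \<otimes>\<^bsub>?C\<^esub> a)"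
      unfolding eq cone_ops sa sb wedge_cmult_left comm
      by (auto simp: minus_one_powi even' fun_eq_iff)
  }
  {
    assume "a \<in> grade ?C k" "b \<in> carrier ?C"
    then have a: "smooth_form M \<alpha>" "of_degree k \<alpha>" "smooth_form M \<alpha>'" "of_degree k' \<alpha>'"
      and b: "smooth_form M \<beta>" "smooth_form M \<beta>'"
      unfolding eq cone_grade[OF M] cone_carrier[OF M] k'_def by auto
    have sa: "signed \<alpha> = (\<lambda>q vs. (-1) powi k * \<alpha> q vs)"
      by (rule signed_of_degree[OF a(2)])
    have sda: "signed (ext_deriv M \<alpha>) = (\<lambda>q vs. (-1) powi (k + 1) * ext_deriv M \<alpha> q vs)"
      by (rule signed_of_degree[OF of_degree_ext_deriv[OF a(2)]])
    have "of_degree (2 * int p + k') (wedge power_form \<alpha>')" by (rule of_degree_wedge[OF power_form(2) a(4)])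
    moreover have "2 * int p + k' = k + 1" by (simp add: k'_def)
    ultimately have sta: "signed (wedge power_form \<alpha>') = (\<lambda>q vs. (-1) powi (k + 1) * wedge power_form \<alpha>' q vs)"
      by (intro signed_of_degree) simp
    \<comment> \<open>A normal form in which \<open>\<tau>\<^sup>p\<close> stands in front of the last factor.\<close>
    have swap: "wedge power_form (wedge \<gamma> \<delta>) = wedge \<gamma> (wedge power_form \<delta>)" for \<gamma> \<delta>
      by (simp only: wedge_assoc[symmetric] power_form_commute[of \<gamma>])
    have "ext_deriv M (\<lambda>q vs. wedge \<alpha>' \<beta> q vs + (-1) powi k * wedge \<alpha> \<beta>' q vs) =
       (\<lambda>q vs. ext_deriv M (wedge \<alpha>' \<beta>) q vs + (-1) powi k * ext_deriv M (wedge \<alpha> \<beta>') q vs)"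
      using ext_deriv_add[OF M smooth_form_wedge[OF M a(3) b(1)]
          smooth_form_cmult[OF M smooth_form_wedge[OF M a(1) b(2)], of "(-1) powi k"]]
        ext_deriv_cmult[OF M smooth_form_wedge[OF M a(1) b(2)], of "(-1) powi k"] by simp
    note d = this ext_deriv_wedge_of_degree[OF M a(1) b(1) a(2)] ext_deriv_wedge_of_degree[OF M a(1) b(2) a(2)]
      ext_deriv_wedge_of_degree[OF M a(3) b(1) a(4)]
    show "dif ?C (a \<otimes>\<^bsub>?C\<^esub> b) = (dif ?C a \<otimes>\<^bsub>?C\<^esub> b) \<oplus>\<^bsub>?C\<^esub> ((-1) powi k) \<odot>\<^bsub>?C\<^esub> (a \<otimes>\<^bsub>?C\<^esub> dif ?C b)"
      unfolding eq cone_ops sa sda sta signed_add wedge_cmult_left wedge_cmult_right wedge_add_left wedge_add_right d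
        wedge_assoc swap
      by (auto simp: minus_one_powi even' fun_eq_iff)
  }
qed

end

section \<open>Pullback\<close>

lemma pullback_add:
  "pullback M N f (\<lambda>q vs. \<alpha> q vs + \<beta> q vs) = (\<lambda>q vs. pullback M N f \<alpha> q vs + pullback M N f \<beta> q vs)"
  by (simp add: pullback_def fun_eq_iff)

lemma pullback_cmult: "pullback M N f (\<lambda>q vs. r * \<alpha> q vs) = (\<lambda>q vs. r * pullback M N f \<alpha> q vs)"
  by (simp add: pullback_def fun_eq_iff)

lemma pullback_zero: "pullback M N f (\<lambda>q vs. 0) = (\<lambda>q vs. 0)"
  by (simp add: pullback_def fun_eq_iff)

lemma pullback_signed: "pullback M N f (signed \<alpha>) = signed (pullback M N f \<alpha>)"
  by (simp add: pullback_def signed_def fun_eq_iff)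

lemma pullback_unit:
  assumes f: "smooth_map M N f"
  shows "pullback M N f (unit_form N) = unit_form M"
proof (intro ext)
  fix q vs
  show "pullback M N f (unit_form N) q vs = unit_form M q vs"
    using smooth_map_topspace[OF f, of q] by (simp add: pullback_def)
qed

lemma of_degree_pullback:
  assumes "of_degree k \<alpha>"
  shows "of_degree k (pullback M N f \<alpha>)"
  unfolding of_degree_def
proof (intro allI impI)
  fix q vs assume "pullback M N f \<alpha> q vs \<noteq> 0"
  then have "\<alpha> (f q) (map (tangent_map M N f q) vs) \<noteq> 0" by (simp add: pullback_def split: if_splits)
  with assms have "int (length (map (tangent_map M N f q) vs)) = k" unfolding of_degree_def by blast
  then show "int (length vs) = k" by simp
qed

lemma bounded_pullback:
  assumes "bounded_degree \<alpha>"
  shows "bounded_degree (pullback M N f \<alpha>)"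
proof -
  obtain n where n: "\<And>q vs. \<alpha> q vs \<noteq> 0 \<Longrightarrow> length vs < n"
    using assms unfolding bounded_degree_def by blast
  have "length vs < n" if "pullback M N f \<alpha> q vs \<noteq> 0" for q vs
  proof -
    have "\<alpha> (f q) (map (tangent_map M N f q) vs) \<noteq> 0" using that by (simp add: pullback_def split: if_splits)
    from n[OF this] show ?thesis by simp
  qed
  then show ?thesis unfolding bounded_degree_def by blast
qed

text \<open>Only points have to be considered at which the image lies in a chart of the target, and every point is of
  this kind for a suitable chart.\<close>

lemma pullback_local_rep_eqI:
  assumes M: "smooth_manifold M" and N: "smooth_manifold N" and f: "smooth_map M N f"
    and \<alpha>: "smooth_form M \<alpha>" and \<beta>: "smooth_form M \<beta>"
    and eq: "\<And>c d x us. c \<in> atlas M \<Longrightarrow> d \<in> atlas N \<Longrightarrow> x \<in> snd c ` (fst c \<inter> f -` fst d) \<Longrightarrow>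
      local_rep M c \<alpha> x us = local_rep M c \<beta> x us"
  shows "\<alpha> = \<beta>"
proof (rule smooth_form_eqI[OF M \<alpha> \<beta>])
  fix c x us assume c: "c \<in> atlas M" and x: "x \<in> snd c ` fst c"
  then obtain q where q: "q \<in> fst c" "x = snd c q" by auto
  have "f q \<in> topspace (mtop N)"
    using smooth_map_topspace[OF f] atlas_open(3)[OF M c] q by blast
  from chart_at_in_charts_at[OF N this] have d: "chart_at N (f q) \<in> atlas N" "f q \<in> fst (chart_at N (f q))"
    by (simp_all add: charts_at_def)
  show "local_rep M c \<alpha> x us = local_rep M c \<beta> x us"
    by (rule eq[OF c d(1)]) (use q d in auto)
qed

lemma local_pull_ext_prod:
  "local_pull F (\<lambda>y. ext_prod (a y) (b y)) x us = ext_prod (local_pull F a x) (local_pull F b x) us"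
  unfolding local_pull_def by (rule ext_prod_map[symmetric])

lemma pullback_wedge:
  assumes M: "smooth_manifold M" and N: "smooth_manifold N" and f: "smooth_map M N f"
    and \<alpha>: "smooth_form N \<alpha>" and \<beta>: "smooth_form N \<beta>"
  shows "pullback M N f (wedge \<alpha> \<beta>) = wedge (pullback M N f \<alpha>) (pullback M N f \<beta>)"
proof (rule pullback_local_rep_eqI[OF M N f])
  fix c d x us assume *: "c \<in> atlas M" "d \<in> atlas N" "x \<in> snd c ` (fst c \<inter> f -` fst d)"
  note rep = local_rep_pullback[OF M N f *]
  have "local_rep M c (pullback M N f \<gamma>) x = local_pull (snd d \<circ> f \<circ> chart_inv c) (local_rep N d \<gamma>) x" for \<gamma>
    by (rule ext) (rule rep)
  then show "local_rep M c (pullback M N f (wedge \<alpha> \<beta>)) x us =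
      local_rep M c (wedge (pullback M N f \<alpha>) (pullback M N f \<beta>)) x us"
    by (simp only: local_rep_wedge local_pull_ext_prod)
qed (intro smooth_form_pullback[OF M N f] smooth_form_wedge M N \<alpha> \<beta>)+

text \<open>Naturality of the local exterior derivative for the coordinate expression of \<open>f\<close>.\<close>

lemma pullback_ext_deriv:
  assumes M: "smooth_manifold M" and N: "smooth_manifold N" and f: "smooth_map M N f"
    and \<alpha>: "smooth_form N \<alpha>"
  shows "pullback M N f (ext_deriv N \<alpha>) = ext_deriv M (pullback M N f \<alpha>)"
proof (rule pullback_local_rep_eqI[OF M N f])
  fix c d x us assume c: "c \<in> atlas M" and d: "d \<in> atlas N" and x: "x \<in> snd c ` (fst c \<inter> f -` fst d)"
  let ?F = "snd d \<circ> f \<circ> chart_inv c" and ?S = "snd c ` (fst c \<inter> f -` fst d)"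
  have S: "open ?S"
    by (rule preimage_image_open[OF M c smooth_mapD(1)[OF f] atlas_open(1)[OF N d]])
  have FS: "?F ` ?S \<subseteq> snd d ` fst d"
    using chart_inv_left[OF M c] by auto
  have x': "x \<in> snd c ` fst c" using x by auto
  have Fx: "?F x \<in> snd d ` fst d" by (rule subsetD[OF FS imageI[OF x]])
  have pa: "smooth_form M (pullback M N f \<alpha>)" by (rule smooth_form_pullback[OF M N f \<alpha>])
  have "local_rep M c (pullback M N f (ext_deriv N \<alpha>)) x us = local_pull ?F (local_rep N d (ext_deriv N \<alpha>)) x us"
    by (rule local_rep_pullback[OF M N f c d x])
  also have "\<dots> = local_pull ?F (local_d (local_rep N d \<alpha>)) x us"
    unfolding local_pull_def by (simp only: local_rep_ext_deriv[OF N \<alpha> d Fx])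
  also have "\<dots> = local_d (local_pull ?F (local_rep N d \<alpha>)) x us"
    by (simp only: local_d_local_pull[OF smooth_manifold_fin_dim[OF N] S x atlas_open(2)[OF N d]
          smooth_mapD(2)[OF f c d] FS smooth_formD(2)[OF \<alpha> d]])
  also have "local_d (local_pull ?F (local_rep N d \<alpha>)) x = local_d (local_rep M c (pullback M N f \<alpha>)) x"
    by (rule local_d_cong_open[OF S x, symmetric], rule local_form_subset[OF smooth_formD(2)[OF pa c]])
       (auto intro: local_rep_pullback[OF M N f c d])
  also have "\<dots> = local_rep M c (ext_deriv M (pullback M N f \<alpha>)) x"
    by (rule local_rep_ext_deriv[OF M pa c x', symmetric])
  finally show "local_rep M c (pullback M N f (ext_deriv N \<alpha>)) x us =
      local_rep M c (ext_deriv M (pullback M N f \<alpha>)) x us" .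
qed (intro smooth_form_pullback[OF M N f] smooth_form_ext_deriv M N \<alpha>)+

lemma pullback_compose:
  assumes M: "smooth_manifold M" and N: "smooth_manifold N" and P: "smooth_manifold P"
    and f: "smooth_map M N f" and g: "smooth_map N P g"
  shows "pullback M N f (pullback N P g \<alpha>) = pullback M P (g \<circ> f) \<alpha>"
proof (intro ext)
  fix q vs
  show "pullback M N f (pullback N P g \<alpha>) q vs = pullback M P (g \<circ> f) \<alpha> q vs"
  proof (cases "q \<in> topspace (mtop M) \<and> set vs \<subseteq> tangent_space M q")
    case True
    then have q: "q \<in> topspace (mtop M)" and vs: "set vs \<subseteq> tangent_space M q" by auto
    have "f q \<in> topspace (mtop N)" by (rule smooth_map_topspace[OF f q])
    moreover have "set (map (tangent_map M N f q) vs) \<subseteq> tangent_space N (f q)"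
      using tangent_map_in_tangent_space[OF M N f q] vs by auto
    moreover have "map (tangent_map N P g (f q)) (map (tangent_map M N f q) vs) = map (tangent_map M P (g \<circ> f) q) vs"
      using tangent_map_compose[OF M N P f g q] vs by auto
    ultimately show ?thesis using q vs by (simp add: pullback_def del: map_map)
  next
    case False
    then show ?thesis by (auto simp: pullback_def)
  qed
qed

lemma cdga_map_pullback:
  assumes M: "smooth_manifold M" and N: "smooth_manifold N" and f: "smooth_map M N f"
  shows "cdga_map (de_rham N) (de_rham M) (pullback M N f)"
proof (rule cdga_map.intro)
  show "cdga (de_rham N)" "cdga (de_rham M)" by (rule cdga_de_rham[OF N], rule cdga_de_rham[OF M])
  show "pullback M N f \<in> ring_hom (de_rham N) (de_rham M)"
    by (rule ring_hom_memI)
       (simp_all only: de_rham_carrier[OF M] de_rham_carrier[OF N] de_rham_ops smooth_form_pullback[OF M N f]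
         bounded_pullback pullback_wedge[OF M N f] pullback_add pullback_unit[OF f])
qed (simp_all only: de_rham_carrier[OF N] de_rham_grade[OF M] de_rham_grade[OF N] de_rham_ops pullback_cmult
      smooth_form_pullback[OF M N f] of_degree_pullback pullback_ext_deriv[OF M N f])

lemma pullback_power:
  assumes M: "smooth_manifold M" and N: "smooth_manifold N" and f: "smooth_map M N f"
    and \<tau>: "smooth_form N \<tau>" "of_degree 2 \<tau>" "ext_deriv N \<tau> = (\<lambda>q vs. 0)"
  shows "pullback M N f (\<tau> [^]\<^bsub>de_rham N\<^esub> (p::nat)) = pullback M N f \<tau> [^]\<^bsub>de_rham M\<^esub> p"
proof -
  interpret M: ring "de_rham M" by (rule ring_de_rham[OF M])
  interpret N: ring "de_rham N" by (rule ring_de_rham[OF N])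
  show ?thesis
  proof (induction p)
    case 0
    show ?case using pullback_unit[OF f] by (simp add: de_rham_ops)
  next
    case (Suc p)
    then show ?case
      using pullback_wedge[OF M N f closed_power(1)[OF N \<tau>] \<tau>(1)] by (simp add: de_rham_ops)
  qed
qed

text \<open>These are the properties of \<open>\<tau>\<close> from which the cone is constructed, so the target of the induced map is a
  cdga as well.\<close>

lemma closed_two_form_pullback:
  assumes M: "smooth_manifold M" and N: "smooth_manifold N" and f: "smooth_map M N f"
    and \<tau>: "smooth_form N \<tau>" "of_degree 2 \<tau>" "ext_deriv N \<tau> = (\<lambda>q vs. 0)"
  shows "smooth_form M (pullback M N f \<tau>)" "of_degree 2 (pullback M N f \<tau>)"
    "ext_deriv M (pullback M N f \<tau>) = (\<lambda>q vs. 0)"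
  by (rule smooth_form_pullback[OF M N f \<tau>(1)], rule of_degree_pullback[OF \<tau>(2)],
      simp only: pullback_ext_deriv[OF M N f \<tau>(1), symmetric] \<tau>(3) pullback_zero)

lemma cone_pullback_Pair:
  "cone_pullback M N f (\<alpha>, \<alpha>') = (pullback M N f \<alpha>, pullback M N f \<alpha>')"
  by (simp add: cone_pullback_def)

lemma cdga_map_cone_pullback:
  assumes M: "smooth_manifold M" and N: "smooth_manifold N" and f: "smooth_map M N f"
    and \<tau>: "smooth_form N \<tau>" "of_degree 2 \<tau>" "ext_deriv N \<tau> = (\<lambda>q vs. 0)"
  shows "cdga_map (cone_algebra N \<tau> p) (cone_algebra M (pullback M N f \<tau>) p) (cone_pullback M N f)"
proof (rule cdga_map.intro)
  let ?A = "cone_algebra N \<tau> p" and ?B = "cone_algebra M (pullback M N f \<tau>) p" and ?F = "cone_pullback M N f"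
  note sf = smooth_form_pullback[OF M N f]
  show "cdga ?A" by (rule cdga_cone[OF N \<tau>])
  show "cdga ?B" by (rule cdga_cone[OF M closed_two_form_pullback[OF M N f \<tau>]])
  show "?F \<in> ring_hom ?A ?B"
  proof (rule ring_hom_memI)
    fix a b :: "('c, 'd) form \<times> ('c, 'd) form"
    obtain \<alpha> \<alpha>' \<beta> \<beta>' where eq: "a = (\<alpha>, \<alpha>')" "b = (\<beta>, \<beta>')" by (cases a; cases b)
    show "?F a \<in> carrier ?B" if "a \<in> carrier ?A"
      using that unfolding eq cone_pullback_Pair cone_carrier[OF M] cone_carrier[OF N]
      by (simp add: sf bounded_pullback)
    show "?F (a \<oplus>\<^bsub>?A\<^esub> b) = ?F a \<oplus>\<^bsub>?B\<^esub> ?F b"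
      unfolding eq cone_ops cone_pullback_Pair pullback_add ..
    show "?F (a \<otimes>\<^bsub>?A\<^esub> b) = ?F a \<otimes>\<^bsub>?B\<^esub> ?F b" if "a \<in> carrier ?A" "b \<in> carrier ?A"
      using that smooth_form_signed[OF N, of \<alpha>] unfolding eq cone_ops cone_pullback_Pair pullback_add cone_carrier[OF N]
      by (simp add: pullback_wedge[OF M N f] pullback_signed)
  next
    show "?F \<one>\<^bsub>?A\<^esub> = \<one>\<^bsub>?B\<^esub>"
      unfolding cone_ops cone_pullback_Pair pullback_zero pullback_unit[OF f] ..
  qed
  fix a :: "('c, 'd) form \<times> ('c, 'd) form" and r :: real and k :: int
  obtain \<alpha> \<alpha>' where eq: "a = (\<alpha>, \<alpha>')" by (cases a)
  show "?F (r \<odot>\<^bsub>?A\<^esub> a) = r \<odot>\<^bsub>?B\<^esub> ?F a"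
    unfolding eq cone_ops cone_pullback_Pair pullback_cmult ..
  show "?F a \<in> grade ?B k" if "a \<in> grade ?A k"
    using that unfolding eq cone_pullback_Pair cone_grade[OF M] cone_grade[OF N] by (simp add: sf of_degree_pullback)
  show "?F (dif ?A a) = dif ?B (?F a)" if "a \<in> carrier ?A"
    using that unfolding eq cone_ops cone_pullback_Pair pullback_add pullback_cmult cone_carrier[OF N]
    by (simp add: pullback_ext_deriv[OF M N f] pullback_wedge[OF M N f] closed_power(1)[OF N \<tau>] pullback_power[OF M N f \<tau>]
        flip: pullback_cmult[of _ _ _ "-1", simplified])
qed

section \<open>Bimodules induced by maps of algebras\<close>

text \<open>The bimodule laws are the laws of the algebra \<open>B\<close>, with \<open>f\<close> multiplicative, linear and compatible with
  degrees and differentials.\<close>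

lemma dg_bimodule_cdga_map:
  assumes "cdga_map A B f"
  shows "dg_bimodule A B (\<lambda>a x. f a \<otimes>\<^bsub>B\<^esub> x) (\<lambda>x a. x \<otimes>\<^bsub>B\<^esub> f a)"
proof -
  interpret f: cdga_map A B f by fact
  interpret A: cdga A by (rule f.source)
  interpret B: cdga B by (rule f.target)
  interpret B: ring B by (rule B.is_ring)
  interpret A: ring A by (rule A.is_ring)
  interpret BC: cochain_complex B by (rule B.is_complex)
  interpret AC: cochain_complex A by (rule A.is_complex)
  have closed: "f a \<in> carrier B" if "a \<in> carrier A" for a
    by (rule ring_hom_closed[OF f.is_ring_hom that])
  have gradeA: "a \<in> carrier A" if "a \<in> grade A k" for a k
    using submodule.axioms(1)[OF AC.grade_submodule[of k]] that subgroup.subset[of "grade A k" "add_monoid A"] by auto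
  show ?thesis
  proof (rule dg_bimodule.intro)
    show "cdga A" "cochain_complex B" by (rule f.source, rule B.is_complex)
    show "dif B (f a \<otimes>\<^bsub>B\<^esub> x) = f (dif A a) \<otimes>\<^bsub>B\<^esub> x \<oplus>\<^bsub>B\<^esub> (- 1) powi k \<odot>\<^bsub>B\<^esub> (f a \<otimes>\<^bsub>B\<^esub> dif B x)"
      if "a \<in> grade A k" "x \<in> carrier B" for a k x
      using B.Leibniz[OF f.map_grade[OF that(1)] that(2)] by (simp only: f.map_dif[OF gradeA[OF that(1)]])
    show "dif B (x \<otimes>\<^bsub>B\<^esub> f a) = dif B x \<otimes>\<^bsub>B\<^esub> f a \<oplus>\<^bsub>B\<^esub> (- 1) powi l \<odot>\<^bsub>B\<^esub> (x \<otimes>\<^bsub>B\<^esub> f (dif A a))"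
      if "x \<in> grade B l" "a \<in> carrier A" for a l x
      using B.Leibniz[OF that(1) closed[OF that(2)]] by (simp only: f.map_dif[OF that(2)])
  qed (simp_all add: closed f.map_grade B.mult_grade ring_hom_add[OF f.is_ring_hom] ring_hom_mult[OF f.is_ring_hom]
        ring_hom_one[OF f.is_ring_hom] f.map_smult B.l_distr B.r_distr B.m_assoc B.smult_mult_left B.smult_mult_right)
qed

section \<open>Products of manifolds\<close>

lemma second_countable_prod_topology:
  assumes "second_countable S" "second_countable T"
  shows "second_countable (prod_topology S T)"
proof -
  obtain \<A> where A: "countable \<A>" "\<forall>V\<in>\<A>. openin S V"
    "\<forall>U x. openin S U \<and> x \<in> U \<longrightarrow> (\<exists>V\<in>\<A>. x \<in> V \<and> V \<subseteq> U)"
    using assms(1) unfolding second_countable_def by (elim exE conjE)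
  obtain \<B> where B: "countable \<B>" "\<forall>V\<in>\<B>. openin T V"
    "\<forall>U x. openin T U \<and> x \<in> U \<longrightarrow> (\<exists>V\<in>\<B>. x \<in> V \<and> V \<subseteq> U)"
    using assms(2) unfolding second_countable_def by (elim exE conjE)
  let ?C = "(\<lambda>(V, W). V \<times> W) ` (\<A> \<times> \<B>)"
  have nbhd: "\<exists>V\<in>?C. z \<in> V \<and> V \<subseteq> U" if U: "openin (prod_topology S T) U" and z: "z \<in> U" for U z
  proof -
    obtain x y where xy: "z = (x, y)" by (cases z)
    obtain V W where "openin S V" "openin T W" "x \<in> V" "y \<in> W" and VW: "V \<times> W \<subseteq> U"
      using U[unfolded openin_prod_topology_alt, rule_format, of x y] z xy by auto
    obtain V' where V': "V' \<in> \<A>" "x \<in> V'" "V' \<subseteq> V" using A(3) \<open>openin S V\<close> \<open>x \<in> V\<close> by blast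
    obtain W' where W': "W' \<in> \<B>" "y \<in> W'" "W' \<subseteq> W" using B(3) \<open>openin T W\<close> \<open>y \<in> W\<close> by blast
    have "V' \<times> W' \<in> ?C"
      using imageI[of "(V', W')" "\<A> \<times> \<B>" "\<lambda>(V, W). V \<times> W"] V'(1) W'(1) by simp
    moreover have "z \<in> V' \<times> W'" using V'(2) W'(2) xy by simp
    moreover have "V' \<times> W' \<subseteq> U" using Sigma_mono[OF V'(3) W'(3)] VW by (rule subset_trans)
    ultimately show ?thesis by (intro bexI[of _ "V' \<times> W'"] conjI)
  qed
  have "countable ?C" using A(1) B(1) by simp
  moreover have "openin (prod_topology S T) V" if "V \<in> ?C" for V
    using that A(2) B(2) by (auto simp: openin_prod_Times_iff)
  ultimately show ?thesis
    unfolding second_countable_def by (intro exI[of _ ?C] conjI ballI allI impI) (simp_all only: nbhd)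
qed

lemma homeomorphic_map_map_prod:
  assumes "homeomorphic_map S S' f" "homeomorphic_map T T' g"
  shows "homeomorphic_map (prod_topology S T) (prod_topology S' T') (map_prod f g)"
proof -
  obtain f' g' where "homeomorphic_maps S S' f f'" "homeomorphic_maps T T' g g'"
    using assms unfolding homeomorphic_map_maps by blast
  then have "homeomorphic_maps (prod_topology S T) (prod_topology S' T') (\<lambda>(x, y). (f x, g y)) (\<lambda>(x, y). (f' x, g' y))"
    unfolding homeomorphic_maps_prod by blast
  then show ?thesis
    unfolding homeomorphic_map_maps map_prod_def by blast
qed

lemma inv_into_map_prod:
  assumes "inj_on f A" "inj_on g B" "z \<in> (f ` A) \<times> (g ` B)"
  shows "inv_into (A \<times> B) (map_prod f g) z = (inv_into A f (fst z), inv_into B g (snd z))"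
proof -
  obtain a b where ab: "a \<in> A" "b \<in> B" "z = map_prod f g (a, b)" using assms(3) by auto
  have "inj_on (map_prod f g) (A \<times> B)" using assms(1,2) by (rule map_prod_inj_on)
  then have "inv_into (A \<times> B) (map_prod f g) z = (a, b)"
    unfolding ab(3) by (rule inv_into_f_f) (use ab in simp)
  then show ?thesis using ab assms(1,2) by simp
qed

lemma fin_dim_prod:
  assumes "fin_dim TYPE('e::real_inner)" "fin_dim TYPE('f::real_inner)"
  shows "fin_dim TYPE('e \<times> 'f)"
proof -
  obtain A :: "'e set" and B :: "'f set" where A: "finite A" "span A = UNIV" and B: "finite B" "span B = UNIV"
    using assms unfolding fin_dim_def by blast
  let ?C = "(\<lambda>x. (x, 0)) ` A \<union> (\<lambda>y. (0, y)) ` B :: ('e \<times> 'f) set"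
  have lin: "linear (\<lambda>x::'e. (x, 0::'f))" "linear (\<lambda>y::'f. (0::'e, y))"
    by (rule linearI; simp)+
  have "z \<in> span ?C" for z :: "'e \<times> 'f"
  proof -
    have "(fst z, 0) \<in> span ((\<lambda>x. (x, 0::'f)) ` A)"
      unfolding linear_span_image[OF lin(1)] A(2) by auto
    then have 1: "(fst z, 0) \<in> span ?C"
      by (rule subsetD[OF span_mono[OF Un_upper1]])
    have "(0, snd z) \<in> span ((\<lambda>y. (0::'e, y)) ` B)"
      unfolding linear_span_image[OF lin(2)] B(2) by auto
    then have "(0, snd z) \<in> span ?C"
      by (rule subsetD[OF span_mono[OF Un_upper2]])
    with 1 have "(fst z, 0) + (0, snd z) \<in> span ?C" by (rule span_add)
    then show ?thesis by simp
  qed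
  then show ?thesis unfolding fin_dim_def using A(1) B(1) by (intro exI[of _ ?C]) auto
qed

lemma smooth_on_map_prod:
  fixes F :: "'e::real_inner \<Rightarrow> 'g::real_inner" and G :: "'f::real_inner \<Rightarrow> 'h::real_inner"
  assumes fin: "fin_dim TYPE('e)" "fin_dim TYPE('f)" and "open S" "open T" "smooth_on S F" "smooth_on T G"
  shows "smooth_on (S \<times> T) (\<lambda>z. (F (fst z), G (snd z)))"
proof -
  have ST: "open (S \<times> T)" using assms(3,4) by (rule open_Times)
  show ?thesis
    by (intro smooth_on_Pair ST smooth_on_compose[OF fin(1) ST smooth_on_bounded_linear[OF bounded_linear_fst] assms(5)]
        smooth_on_compose[OF fin(2) ST smooth_on_bounded_linear[OF bounded_linear_snd] assms(6)]) auto
qed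

lemma prod_manifold_simps:
  "mtop (prod_manifold M N) = prod_topology (mtop M) (mtop N)"
  "c \<in> atlas (prod_manifold M N) \<longleftrightarrow>
     (\<exists>a\<in>atlas M. \<exists>b\<in>atlas N. c = (fst a \<times> fst b, map_prod (snd a) (snd b)))"
  unfolding prod_manifold_def manifold.select_convs mem_Collect_eq by (rule refl, blast)

text \<open>The coordinate changes of product charts are products of coordinate changes.\<close>

lemma smooth_manifold_prod:
  fixes M :: "('a, 'e::real_inner) manifold" and N :: "('b, 'f::real_inner) manifold"
  assumes M: "smooth_manifold M" and N: "smooth_manifold N"
  shows "smooth_manifold (prod_manifold M N)"
  unfolding smooth_manifold_def
proof (intro conjI ballI)
  let ?P = "prod_manifold M N"
  show "\<exists>B::('e \<times> 'f) set. finite B \<and> span B = UNIV"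
    using fin_dim_prod[OF smooth_manifold_fin_dim[OF M] smooth_manifold_fin_dim[OF N]] unfolding fin_dim_def .
  show "Hausdorff_space (mtop ?P)"
    using M N by (simp add: prod_manifold_simps Hausdorff_space_prod_topology smooth_manifold_def)
  show "second_countable (mtop ?P)"
    using M N by (simp add: prod_manifold_simps second_countable_prod_topology smooth_manifold_def)
  have "(\<Union>a\<in>atlas M. fst a) = topspace (mtop M)" "(\<Union>b\<in>atlas N. fst b) = topspace (mtop N)"
    using M N by (simp_all add: smooth_manifold_def)
  then have "topspace (mtop ?P) = (\<Union>a\<in>atlas M. fst a) \<times> (\<Union>b\<in>atlas N. fst b)"
    by (simp add: prod_manifold_simps(1))
  also have "\<dots> = (\<Union>c\<in>atlas ?P. fst c)"
  proof (intro Set.set_eqI iffI)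
    fix z assume "z \<in> (\<Union>a\<in>atlas M. fst a) \<times> (\<Union>b\<in>atlas N. fst b)"
    then obtain a b where "a \<in> atlas M" "b \<in> atlas N" and z: "z \<in> fst a \<times> fst b" by blast
    then have "(fst a \<times> fst b, map_prod (snd a) (snd b)) \<in> atlas ?P"
      unfolding prod_manifold_simps(2) by blast
    from UN_I[OF this, of z fst] z show "z \<in> (\<Union>c\<in>atlas ?P. fst c)" by simp
  next
    fix z assume "z \<in> (\<Union>c\<in>atlas ?P. fst c)"
    then obtain c where "c \<in> atlas ?P" and z: "z \<in> fst c" by blast
    then obtain a b where "a \<in> atlas M" "b \<in> atlas N" "c = (fst a \<times> fst b, map_prod (snd a) (snd b))"
      unfolding prod_manifold_simps(2) by blast
    with z show "z \<in> (\<Union>a\<in>atlas M. fst a) \<times> (\<Union>b\<in>atlas N. fst b)" by auto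
  qed
  finally show "(\<Union>c\<in>atlas ?P. fst c) = topspace (mtop ?P)" by (rule sym)
next
  fix c assume "c \<in> atlas (prod_manifold M N)"
  then obtain a b where a: "a \<in> atlas M" and b: "b \<in> atlas N" and c: "c = (fst a \<times> fst b, map_prod (snd a) (snd b))"
    unfolding prod_manifold_simps by blast
  have im: "snd c ` fst c = (snd a ` fst a) \<times> (snd b ` fst b)" unfolding c by auto
  show "openin (mtop (prod_manifold M N)) (fst c)"
    using atlas_open(1)[OF M a] atlas_open(1)[OF N b] by (simp add: c prod_manifold_simps openin_prod_Times_iff)
  show "open (snd c ` fst c)"
    unfolding im by (rule open_Times[OF atlas_open(2)[OF M a] atlas_open(2)[OF N b]])
  show "homeomorphic_map (subtopology (mtop (prod_manifold M N)) (fst c)) (top_of_set (snd c ` fst c)) (snd c)"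
    using homeomorphic_map_map_prod[OF atlas_open(4)[OF M a] atlas_open(4)[OF N b]]
    unfolding im by (simp add: c prod_manifold_simps subtopology_Times)
next
  fix c c' assume "c \<in> atlas (prod_manifold M N)" "c' \<in> atlas (prod_manifold M N)"
  then obtain a b a' b' where a: "a \<in> atlas M" "a' \<in> atlas M" and b: "b \<in> atlas N" "b' \<in> atlas N"
    and c: "c = (fst a \<times> fst b, map_prod (snd a) (snd b))" "c' = (fst a' \<times> fst b', map_prod (snd a') (snd b'))"
    unfolding prod_manifold_simps by blast
  let ?S = "snd a ` (fst a \<inter> fst a')" and ?T = "snd b ` (fst b \<inter> fst b')"
  have im: "snd c ` (fst c \<inter> fst c') = ?S \<times> ?T" unfolding c by auto
  have S: "open ?S" "open ?T"
    by (rule chart_image_open[OF M a(1) atlas_open(1)[OF M a(2)]], rule chart_image_open[OF N b(1) atlas_open(1)[OF N b(2)]])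
  have "smooth_on (?S \<times> ?T) (\<lambda>z. ((snd a' \<circ> chart_inv a) (fst z), (snd b' \<circ> chart_inv b) (snd z)))"
    by (rule smooth_on_map_prod[OF smooth_manifold_fin_dim[OF M] smooth_manifold_fin_dim[OF N] S
          atlas_transition[OF M a] atlas_transition[OF N b]])
  then show "smooth_on (snd c ` (fst c \<inter> fst c')) (snd c' \<circ> chart_inv c)"
    unfolding im
  proof (rule smooth_on_cong[OF open_Times[OF S], rotated])
    fix z assume "z \<in> ?S \<times> ?T"
    then have "z \<in> (snd a ` fst a) \<times> (snd b ` fst b)" by auto
    from inv_into_map_prod[OF chart_inj[OF M a(1)] chart_inj[OF N b(1)] this]
    show "((snd a' \<circ> chart_inv a) (fst z), (snd b' \<circ> chart_inv b) (snd z)) = (snd c' \<circ> chart_inv c) z"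
      by (simp add: c)
  qed
qed

text \<open>In a product chart the coordinate expression of a projection is a coordinate change composed with a linear
  projection.\<close>

lemma smooth_map_projections:
  fixes M :: "('a, 'e::real_inner) manifold" and N :: "('b, 'f::real_inner) manifold"
  assumes M: "smooth_manifold M" and N: "smooth_manifold N"
  shows "smooth_map (prod_manifold M N) M fst" "smooth_map (prod_manifold M N) N snd"
proof -
  let ?P = "prod_manifold M N"
  have "smooth_on (snd c ` (fst c \<inter> fst -` fst a')) (snd a' \<circ> fst \<circ> chart_inv c)"
    if "c \<in> atlas ?P" and a': "a' \<in> atlas M" for c a'
  proof -
    obtain a b where a: "a \<in> atlas M" and b: "b \<in> atlas N" and c: "c = (fst a \<times> fst b, map_prod (snd a) (snd b))"
      using \<open>c \<in> atlas ?P\<close> unfolding prod_manifold_simps by blast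
    let ?S = "snd a ` (fst a \<inter> fst a')" and ?T = "snd b ` fst b"
    have im: "snd c ` (fst c \<inter> fst -` fst a') = ?S \<times> ?T" unfolding c by (auto simp: image_iff)
    have ST: "open (?S \<times> ?T)"
      by (rule open_Times[OF chart_image_open[OF M a atlas_open(1)[OF M a']] atlas_open(2)[OF N b]])
    have "smooth_on (?S \<times> ?T) (\<lambda>z. (snd a' \<circ> chart_inv a) (fst z))"
      by (rule smooth_on_compose[OF smooth_manifold_fin_dim[OF M] ST smooth_on_bounded_linear[OF bounded_linear_fst]
            atlas_transition[OF M a a']]) auto
    then show ?thesis
      unfolding im
    proof (rule smooth_on_cong[OF ST, rotated])
      fix z assume "z \<in> ?S \<times> ?T"
      then have "z \<in> (snd a ` fst a) \<times> (snd b ` fst b)" by auto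
      from inv_into_map_prod[OF chart_inj[OF M a] chart_inj[OF N b] this]
      show "(snd a' \<circ> chart_inv a) (fst z) = (snd a' \<circ> fst \<circ> chart_inv c) z" by (simp add: c)
    qed
  qed
  then show "smooth_map ?P M fst"
    unfolding smooth_map_def by (simp add: prod_manifold_simps(1) continuous_map_fst)
  have "smooth_on (snd c ` (fst c \<inter> snd -` fst b')) (snd b' \<circ> snd \<circ> chart_inv c)"
    if "c \<in> atlas ?P" and b': "b' \<in> atlas N" for c b'
  proof -
    obtain a b where a: "a \<in> atlas M" and b: "b \<in> atlas N" and c: "c = (fst a \<times> fst b, map_prod (snd a) (snd b))"
      using \<open>c \<in> atlas ?P\<close> unfolding prod_manifold_simps by blast
    let ?S = "snd a ` fst a" and ?T = "snd b ` (fst b \<inter> fst b')"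
    have im: "snd c ` (fst c \<inter> snd -` fst b') = ?S \<times> ?T" unfolding c by (auto simp: image_iff)
    have ST: "open (?S \<times> ?T)"
      by (rule open_Times[OF atlas_open(2)[OF M a] chart_image_open[OF N b atlas_open(1)[OF N b']]])
    have "smooth_on (?S \<times> ?T) (\<lambda>z. (snd b' \<circ> chart_inv b) (snd z))"
      by (rule smooth_on_compose[OF smooth_manifold_fin_dim[OF N] ST smooth_on_bounded_linear[OF bounded_linear_snd]
            atlas_transition[OF N b b']]) auto
    then show ?thesis
      unfolding im
    proof (rule smooth_on_cong[OF ST, rotated])
      fix z assume "z \<in> ?S \<times> ?T"
      then have "z \<in> (snd a ` fst a) \<times> (snd b ` fst b)" by auto
      from inv_into_map_prod[OF chart_inj[OF M a] chart_inj[OF N b] this]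
      show "(snd b' \<circ> chart_inv b) (snd z) = (snd b' \<circ> snd \<circ> chart_inv c) z" by (simp add: c)
    qed
  qed
  then show "smooth_map ?P N snd"
    unfolding smooth_map_def by (simp add: prod_manifold_simps(1) continuous_map_snd)
qed

section \<open>The correspondence of cone algebras\<close>

lemma symplecticD:
  assumes "symplectic_manifold M \<omega>"
  shows "smooth_manifold M" "smooth_form M \<omega>" "of_degree 2 \<omega>" "ext_deriv M \<omega> = (\<lambda>q vs. 0)"
proof -
  show M: "smooth_manifold M" using assms by (simp add: symplectic_manifold_def)
  have "\<omega> \<in> forms M 2" using assms by (simp add: symplectic_manifold_def)
  then have "smooth_form M \<omega> \<and> of_degree (int 2) \<omega>"
    unfolding forms_iff[OF M] of_degree_nat .
  then show "smooth_form M \<omega>" "of_degree 2 \<omega>" by simp_all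
  show "ext_deriv M \<omega> = (\<lambda>q vs. 0)" using assms by (simp add: symplectic_manifold_def de_rham_ops)
qed

theorem proposition6p22:
  fixes M1 :: "('a, 'e::real_inner) manifold" and \<omega>1 :: "('a, 'e) form"
    and M2 :: "('b, 'f::real_inner) manifold" and \<omega>2 :: "('b, 'f) form"
    and L :: "('c, 'g::real_inner) manifold" and \<omega> :: "('c, 'g) form"
    and j :: "'c \<Rightarrow> 'a \<times> 'b" and p :: nat
  assumes "symplectic_manifold M1 \<omega>1"
    and "symplectic_manifold M2 \<omega>2"
    and "smooth_manifold L"
    and "immersion L (prod_manifold M1 M2) j"
    and "\<omega> = pullback L (prod_manifold M1 M2) j (pullback (prod_manifold M1 M2) M1 fst \<omega>1)"
    and "\<omega> = pullback L (prod_manifold M1 M2) j (pullback (prod_manifold M1 M2) M2 snd \<omega>2)"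
    and "p \<ge> 1"
  shows "let f1 = fst \<circ> j; f2 = snd \<circ> j;
             C1 = cone_algebra M1 \<omega>1 p; C2 = cone_algebra M2 \<omega>2 p; CL = cone_algebra L \<omega> p;
             F1 = cone_pullback L M1 f1; F2 = cone_pullback L M2 f2
         in smooth_map L M1 f1 \<and> smooth_map L M2 f2 \<and>
            cdga_map (de_rham M1) (de_rham L) (pullback L M1 f1) \<and>
            cdga_map (de_rham M2) (de_rham L) (pullback L M2 f2) \<and>
            cdga_map C1 CL F1 \<and> cdga_map C2 CL F2 \<and>
            dg_bimodule C1 CL (\<lambda>a x. F1 a \<otimes>\<^bsub>CL\<^esub> x) (\<lambda>x a. x \<otimes>\<^bsub>CL\<^esub> F1 a) \<and>
            dg_bimodule C2 CL (\<lambda>a x. F2 a \<otimes>\<^bsub>CL\<^esub> x) (\<lambda>x a. x \<otimes>\<^bsub>CL\<^esub> F2 a)"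
proof -
  note M1 = symplecticD[OF assms(1)] and M2 = symplecticD[OF assms(2)] and L = assms(3)
  let ?P = "prod_manifold M1 M2"
  have P: "smooth_manifold ?P" by (rule smooth_manifold_prod[OF M1(1) M2(1)])
  have j: "smooth_map L ?P j" using assms(4) by (simp add: immersion_def)
  have f1: "smooth_map L M1 (fst \<circ> j)"
    by (rule smooth_map_compose[OF L P M1(1) j smooth_map_projections(1)[OF M1(1) M2(1)]])
  have f2: "smooth_map L M2 (snd \<circ> j)"
    by (rule smooth_map_compose[OF L P M2(1) j smooth_map_projections(2)[OF M1(1) M2(1)]])
  have \<omega>1: "\<omega> = pullback L M1 (fst \<circ> j) \<omega>1"
    unfolding assms(5) by (rule pullback_compose[OF L P M1(1) j smooth_map_projections(1)[OF M1(1) M2(1)]])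
  have \<omega>2: "\<omega> = pullback L M2 (snd \<circ> j) \<omega>2"
    unfolding assms(6) by (rule pullback_compose[OF L P M2(1) j smooth_map_projections(2)[OF M1(1) M2(1)]])
  have F1: "cdga_map (cone_algebra M1 \<omega>1 p) (cone_algebra L \<omega> p) (cone_pullback L M1 (fst \<circ> j))"
    unfolding \<omega>1 by (rule cdga_map_cone_pullback[OF L M1(1) f1 M1(2-4)])
  have F2: "cdga_map (cone_algebra M2 \<omega>2 p) (cone_algebra L \<omega> p) (cone_pullback L M2 (snd \<circ> j))"
    unfolding \<omega>2 by (rule cdga_map_cone_pullback[OF L M2(1) f2 M2(2-4)])
  show ?thesis
    unfolding Let_def
    by (intro conjI f1 f2 cdga_map_pullback[OF L M1(1) f1] cdga_map_pullback[OF L M2(1) f2] F1 F2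
        dg_bimodule_cdga_map)
qed

end
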